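(* Let $F:T^{1,0}M\to[0,+\infty)$ be a strongly convex complex Finsler metric on a complex manifold $M$, let $\nabla$ be the Cartan connection associated to $F$, let $D$ be the Chern-Finsler connection associated to $F$, and let $\mathbf J$ be the canonical complex structure on the complex manifold $T^{1,0}M$. Then $\nabla\mathbf J=0$ if and only if $\nabla$ coincides with $D$.
   Context: Standing conventions. $M$ is a complex manifold of complex dimension $n\ge 2$ with canonical complex structure $J$ on the real tangent bundle $T_{\mathbb R}M$. Greek indices run over $1,\dots,n$, Latin indices over $1,\dots,2n$, $\alpha^*=\alpha+n$, and repeated indices are summed. Local holomorphic coordinates are $z^\alpha=x^\alpha+ix^{\alpha^*}$, with fiber coordinates $v=v^\alpha\frac{\partial}{\partial z^\alpha}\in T^{1,0}M$, $v^\alpha=y^\alpha+iy^{\alpha^*}$. $T_{\mathbb R}M$ and $T^{1,0}M$ are identified by $y=y^j\frac{\partial}{\partial x^j}\mapsto y_o=\frac12(y-iJy)=v$. $\tilde M$ denotes $T^{1,0}M\setminus\{0\}\cong T_{\mathbb R}M\setminus\{0\}$; $\mathbf J$ is its complex structure: $\mathbf J\frac{\partial}{\partial x^\alpha}=\frac{\partial}{\partial x^{\alpha^*}}$, $\mathbf J\frac{\partial}{\partial x^{\alpha^*}}=-\frac{\partial}{\partial x^\alpha}$, $\mathbf J\frac{\partial}{\partial y^\alpha}=\frac{\partial}{\partial y^{\alpha^*}}$, $\mathbf J\frac{\partial}{\partial y^{\alpha^*}}=-\frac{\partial}{\partial y^\alpha}$. A strongly convex complex Finsler metric is a function $F:T^{1,0}M\to[0,+\infty)$,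 positive and $C^\infty$ on $\tilde M$, with $F(z;\lambda v)=|\lambda|F(z;v)$ for $\lambda\in\mathbb C$, such that, viewing $F$ as a function of $(x;y)$, the matrix $g_{jk}=\frac12\frac{\partial^2F^2}{\partial y^j\partial y^k}$ is positive definite on $\tilde M$ (then $G_{\alpha\bar\beta}=\frac{\partial^2F^2}{\partial v^\alpha\partial\bar v^\beta}$ is Hermitian positive definite). Cartan connection. $\hat{\mathbb G}^k=\frac14g^{kl}\big(\frac{\partial^2F^2}{\partial x^a\partial y^l}y^a-\frac{\partial F^2}{\partial x^l}\big)$, $\hat\Gamma^k_j=\frac{\partial\hat{\mathbb G}^k}{\partial y^j}$, $\frac{\delta}{\delta x^j}=\frac{\partial}{\partial x^j}-\hat\Gamma^k_j\frac{\partial}{\partial y^k}$; $\mathcal H_{\mathbb R}=\mathrm{span}\{\frac{\delta}{\delta x^j}\}$ and $\mathcal V_{\mathbb R}=\mathrm{span}\{\frac{\partial}{\partial y^j}\}$, so $T_{\mathbb R}\tilde M=\mathcal H_{\mathbb R}\oplus\mathcal V_{\mathbb R}$. With $\hat\Gamma^k_{j;l}=\frac{g^{ks}}2\big(\frac{\delta g_{sj}}{\delta x^l}-\frac{\delta g_{jl}}{\delta x^s}+\frac{\delta g_{ls}}{\delta x^j}\big)$ and $\hat\Gamma^k_{jl}=\frac14g^{ks}\frac{\partial^3F^2}{\partial y^j\partial y^l\partial y^s}$, the Cartan connection $\nabla$ is the linear connection on the bundle $\mathcal V_{\mathbb R}\to\tilde M$ with $\nabla_{\frac{\delta}{\delta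 x^l}}\frac{\partial}{\partial y^j}=\hat\Gamma^k_{j;l}\frac{\partial}{\partial y^k}$ and $\nabla_{\frac{\partial}{\partial y^l}}\frac{\partial}{\partial y^j}=\hat\Gamma^k_{jl}\frac{\partial}{\partial y^k}$. $\nabla\mathbf J=0$ means $(\nabla_X\mathbf J)(Y):=\nabla_X(\mathbf JY)-\mathbf J(\nabla_XY)=0$ for all $X\in T_{\mathbb R}\tilde M$ and all sections $Y$ of $\mathcal V_{\mathbb R}$. Chern-Finsler connection. $\mathcal V^{1,0}=\mathrm{span}_{\mathbb C}\{\frac{\partial}{\partial v^\alpha}\}$. With $G^{\bar\tau\alpha}$ inverse to $G_{\beta\bar\tau}$ ($G^{\bar\tau\alpha}G_{\beta\bar\tau}=\delta^\alpha_\beta$), set $\Gamma^\alpha_{;\mu}=G^{\bar\tau\alpha}\frac{\partial^2F^2}{\partial z^\mu\partial\bar v^\tau}$, $\delta_\mu=\frac{\partial}{\partial z^\mu}-\Gamma^\alpha_{;\mu}\frac{\partial}{\partial v^\alpha}$, $\Gamma^\alpha_{\beta;\mu}=G^{\bar\tau\alpha}\delta_\mu(G_{\beta\bar\tau})$, $\Gamma^\alpha_{\beta\gamma}=G^{\bar\tau\alpha}\frac{\partial G_{\beta\bar\tau}}{\partial v^\gamma}$, $\psi^\gamma=dv^\gamma+\Gamma^\gamma_{;\mu}dz^\mu$. The Chern-Finsler connection $D$ is the linear connection on $\mathcal V^{1,0}\to\tilde M$ with $D_X\frac{\partial}{\partial v^\beta}=\omega^\alpha_\beta(X)\frac{\partial}{\partial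 v^\alpha}$, $\omega^\alpha_\beta=\Gamma^\alpha_{\beta;\mu}dz^\mu+\Gamma^\alpha_{\beta\gamma}\psi^\gamma$, for $X\in T_{\mathbb C}\tilde M$. "$\nabla$ coincides with $D$" means: the $\mathbb C$-linear extension of $\nabla$ (in both arguments) to $T_{\mathbb C}\tilde M$ and $\mathcal V_{\mathbb C}=\mathcal V_{\mathbb R}\otimes\mathbb C=\mathcal V^{1,0}\oplus\mathcal V^{0,1}$ satisfies $\nabla_XV=D_XV$ for all $X\in T_{\mathbb C}\tilde M$ and all sections $V$ of $\mathcal V^{1,0}$. *)

theory Defs
  imports "HOL-Analysis.Analysis" "HOL-Library.Function_Algebras"
begin

section \<open>Smooth functions on open subsets of Euclidean spaces\<close>

fun Ck_on :: "nat \<Rightarrow> 'e::euclidean_space set \<Rightarrow> ('e \<Rightarrow> 'b::real_normed_vector) \<Rightarrow> bool" where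
  "Ck_on 0 S f \<longleftrightarrow> continuous_on S f"
| "Ck_on (Suc k) S f \<longleftrightarrow>
     (\<forall>x\<in>S. f differentiable (at x)) \<and> (\<forall>e. Ck_on k S (\<lambda>x. frechet_derivative f (at x) e))"

text \<open>Only used for open sets \<open>S\<close>.\<close>

definition smooth_on :: "'e::euclidean_space set \<Rightarrow> ('e \<Rightarrow> 'b::real_normed_vector) \<Rightarrow> bool" where
  "smooth_on S f \<longleftrightarrow> (\<forall>k. Ck_on k S f)"

text \<open>Holomorphic maps in several variables: smooth maps with complex linear differential.\<close>

definition holomorphic_map_on :: "(complex^'n) set \<Rightarrow> (complex^'n \<Rightarrow> complex^'n) \<Rightarrow> bool" where
  "holomorphic_map_on S f \<longleftrightarrow> smooth_on S f \<and>
     (\<forall>z\<in>S. \<forall>v. frechet_derivative f (at z) (\<i> *s v) = \<i> *s frechet_derivative f (at z) v)"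


section \<open>Charts, tangent vectors and vector fields\<close>

text \<open>A chart is a domain together with a coordinate map; the values of the coordinate map outside
  the domain are irrelevant.\<close>

type_synonym ('p, 'e) chart = "'p set \<times> ('p \<Rightarrow> 'e)"

abbreviation local_rep :: "('p, 'e) chart \<Rightarrow> ('p \<Rightarrow> 'b) \<Rightarrow> 'e \<Rightarrow> 'b" where
  "local_rep c f \<equiv> f \<circ> inv_into (fst c) (snd c)"

definition transition :: "('p, 'e) chart \<Rightarrow> ('p, 'e) chart \<Rightarrow> 'e \<Rightarrow> 'e" where
  "transition c d = local_rep c (snd d)"

text \<open>A tangent vector at \<open>p\<close> is the family of its component vectors in all the charts of the
  atlas around \<open>p\<close>, related by the differentials of the coordinate changes.  The value at charts not
  containing \<open>p\<close> is fixed to be \<open>0\<close>, so that equality of families is equality of tangent vectors.\<close>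

type_synonym ('p, 'e) tvec = "('p, 'e) chart \<Rightarrow> 'e"

definition tangent_space ::
  "('p, 'e::euclidean_space) chart set \<Rightarrow> 'p \<Rightarrow> ('p, 'e) tvec set" where
  "tangent_space A p = {X.
     (\<forall>c\<in>A. \<forall>d\<in>A. p \<in> fst c \<and> p \<in> fst d \<longrightarrow>
        X d = frechet_derivative (transition c d) (at (snd c p)) (X c)) \<and>
     (\<forall>c. \<not> (c \<in> A \<and> p \<in> fst c) \<longrightarrow> X c = 0)}"

text \<open>The tangent vector at \<open>p\<close> with components \<open>e\<close> in the chart \<open>c\<close>.\<close>

definition tvec_of ::
  "('p, 'e::euclidean_space) chart set \<Rightarrow> ('p, 'e) chart \<Rightarrow> 'p \<Rightarrow> 'e \<Rightarrow> ('p, 'e) tvec" where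
  "tvec_of A c p e = (\<lambda>d. if d \<in> A \<and> p \<in> fst d
     then frechet_derivative (transition c d) (at (snd c p)) e else 0)"

definition scale_tvec :: "real \<Rightarrow> ('p, 'e::real_vector) tvec \<Rightarrow> ('p, 'e) tvec" where
  "scale_tvec a X = (\<lambda>c. a *\<^sub>R X c)"

definition open_set :: "('p, 'e::euclidean_space) chart set \<Rightarrow> 'p set \<Rightarrow> bool" where
  "open_set A W \<longleftrightarrow> W \<subseteq> (\<Union>c\<in>A. fst c) \<and> (\<forall>c\<in>A. open (snd c ` (W \<inter> fst c)))"

definition smooth_fun ::
  "('p, 'e::euclidean_space) chart set \<Rightarrow> 'p set \<Rightarrow> ('p \<Rightarrow> 'b::real_normed_vector) \<Rightarrow> bool" where
  "smooth_fun A W f \<longleftrightarrow>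
     (\<forall>u\<in>W. \<exists>c\<in>A. u \<in> fst c \<and> smooth_on (snd c ` (W \<inter> fst c)) (local_rep c f))"

text \<open>Smooth sections over \<open>W\<close> of a subbundle \<open>E\<close> of the tangent bundle.\<close>

definition smooth_section ::
  "('p, 'e::euclidean_space) chart set \<Rightarrow> ('p \<Rightarrow> ('p, 'e) tvec set) \<Rightarrow> 'p set
    \<Rightarrow> ('p \<Rightarrow> ('p, 'e) tvec) \<Rightarrow> bool" where
  "smooth_section A E W Y \<longleftrightarrow> (\<forall>u\<in>W. Y u \<in> E u) \<and>
     (\<forall>u\<in>W. \<exists>c\<in>A. u \<in> fst c \<and> smooth_on (snd c ` (W \<inter> fst c)) (local_rep c (\<lambda>q. Y q c)))"


section \<open>Complexified tangent vectors\<close>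

text \<open>The pair \<open>(X, Y)\<close> stands for \<open>X + \<i>Y\<close> in \<open>T \<otimes> \<complex>\<close>.\<close>

type_synonym ('p, 'e) ctvec = "('p, 'e) tvec \<times> ('p, 'e) tvec"

definition ctangent_space ::
  "('p, 'e::euclidean_space) chart set \<Rightarrow> 'p \<Rightarrow> ('p, 'e) ctvec set" where
  "ctangent_space A p = tangent_space A p \<times> tangent_space A p"

definition scale_ctvec :: "complex \<Rightarrow> ('p, 'e::real_vector) ctvec \<Rightarrow> ('p, 'e) ctvec" where
  "scale_ctvec a X =
     ((\<lambda>c. Re a *\<^sub>R fst X c - Im a *\<^sub>R snd X c), (\<lambda>c. Re a *\<^sub>R snd X c + Im a *\<^sub>R fst X c))"

definition smooth_csection ::
  "('p, 'e::euclidean_space) chart set \<Rightarrow> ('p \<Rightarrow> ('p, 'e) ctvec set) \<Rightarrow> 'p set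
    \<Rightarrow> ('p \<Rightarrow> ('p, 'e) ctvec) \<Rightarrow> bool" where
  "smooth_csection A E W V \<longleftrightarrow> (\<forall>u\<in>W. V u \<in> E u) \<and>
     smooth_section A (tangent_space A) W (\<lambda>u. fst (V u)) \<and>
     smooth_section A (tangent_space A) W (\<lambda>u. snd (V u))"


section \<open>Linear connections\<close>

text \<open>A connection acts on local sections: \<open>nab u X Y\<close> is the derivative at \<open>u\<close>, in the direction of
  the tangent vector \<open>X\<close> at \<open>u\<close>, of a section \<open>Y\<close> that is defined and smooth on some neighbourhood
  \<open>W\<close> of \<open>u\<close>; the values of \<open>Y\<close> outside of \<open>W\<close> do not matter.\<close>

definition linear_connection ::
  "('p, 'e::euclidean_space) chart set \<Rightarrow> ('p \<Rightarrow> ('p, 'e) tvec set)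
    \<Rightarrow> ('p \<Rightarrow> ('p, 'e) tvec \<Rightarrow> ('p \<Rightarrow> ('p, 'e) tvec) \<Rightarrow> ('p, 'e) tvec) \<Rightarrow> bool" where
  "linear_connection A E nab \<longleftrightarrow>
    (\<forall>W Y. open_set A W \<and> smooth_section A E W Y \<longrightarrow>
      (\<forall>u\<in>W. \<forall>X\<in>tangent_space A u. nab u X Y \<in> E u) \<and>
      (\<forall>Z. smooth_section A (tangent_space A) W Z \<longrightarrow>
         smooth_section A E W (\<lambda>u. nab u (Z u) Y)) \<and>
      (\<forall>u\<in>W. \<forall>X\<in>tangent_space A u. \<forall>X'\<in>tangent_space A u. \<forall>a b.
         nab u (scale_tvec a X + scale_tvec b X') Y
           = scale_tvec a (nab u X Y) + scale_tvec b (nab u X' Y)) \<and>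
      (\<forall>Y'. (\<forall>u\<in>W. Y' u = Y u) \<longrightarrow>
         (\<forall>u\<in>W. \<forall>X\<in>tangent_space A u. nab u X Y' = nab u X Y)) \<and>
      (\<forall>Y'. smooth_section A E W Y' \<longrightarrow>
         (\<forall>u\<in>W. \<forall>X\<in>tangent_space A u.
            nab u X (\<lambda>q. Y q + Y' q) = nab u X Y + nab u X Y')) \<and>
      (\<forall>f :: 'p \<Rightarrow> real. smooth_fun A W f \<longrightarrow>
         (\<forall>u\<in>W. \<forall>X\<in>tangent_space A u. \<forall>c\<in>A. u \<in> fst c \<longrightarrow>
            nab u X (\<lambda>q. scale_tvec (f q) (Y q))
              = scale_tvec (frechet_derivative (local_rep c f) (at (snd c u)) (X c)) (Y u)
                + scale_tvec (f u) (nab u X Y))))"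

text \<open>The same for complex subbundles of the complexified tangent bundle, with complex directions
  and complex-valued functions.\<close>

definition complex_linear_connection ::
  "('p, 'e::euclidean_space) chart set \<Rightarrow> ('p \<Rightarrow> ('p, 'e) ctvec set)
    \<Rightarrow> ('p \<Rightarrow> ('p, 'e) ctvec \<Rightarrow> ('p \<Rightarrow> ('p, 'e) ctvec) \<Rightarrow> ('p, 'e) ctvec) \<Rightarrow> bool" where
  "complex_linear_connection A E D \<longleftrightarrow>
    (\<forall>W V. open_set A W \<and> smooth_csection A E W V \<longrightarrow>
      (\<forall>u\<in>W. \<forall>X\<in>ctangent_space A u. D u X V \<in> E u) \<and>
      (\<forall>Z. smooth_csection A (ctangent_space A) W Z \<longrightarrow>
         smooth_csection A E W (\<lambda>u. D u (Z u) V)) \<and>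
      (\<forall>u\<in>W. \<forall>X\<in>ctangent_space A u. \<forall>X'\<in>ctangent_space A u. \<forall>a b.
         D u (scale_ctvec a X + scale_ctvec b X') V
           = scale_ctvec a (D u X V) + scale_ctvec b (D u X' V)) \<and>
      (\<forall>V'. (\<forall>u\<in>W. V' u = V u) \<longrightarrow>
         (\<forall>u\<in>W. \<forall>X\<in>ctangent_space A u. D u X V' = D u X V)) \<and>
      (\<forall>V'. smooth_csection A E W V' \<longrightarrow>
         (\<forall>u\<in>W. \<forall>X\<in>ctangent_space A u.
            D u X (\<lambda>q. V q + V' q) = D u X V + D u X V')) \<and>
      (\<forall>f :: 'p \<Rightarrow> complex. smooth_fun A W f \<longrightarrow>
         (\<forall>u\<in>W. \<forall>X\<in>ctangent_space A u. \<forall>c\<in>A. u \<in> fst c \<longrightarrow>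
            D u X (\<lambda>q. scale_ctvec (f q) (V q))
              = scale_ctvec (frechet_derivative (local_rep c f) (at (snd c u)) (fst X c)
                  + \<i> * frechet_derivative (local_rep c f) (at (snd c u)) (snd X c)) (V u)
                + scale_ctvec (f u) (D u X V))))"


section \<open>Complex manifolds and the slit holomorphic tangent bundle\<close>

definition complex_manifold :: "'a topology \<Rightarrow> ('a, complex^'n) chart set \<Rightarrow> bool" where
  "complex_manifold M A \<longleftrightarrow>
     Hausdorff_space M \<and> second_countable M \<and>
     (\<Union>c\<in>A. fst c) = topspace M \<and>
     (\<forall>c\<in>A. openin M (fst c) \<and> open (snd c ` fst c) \<and>
        homeomorphic_map (subtopology M (fst c)) (top_of_set (snd c ` fst c)) (snd c)) \<and>
     (\<forall>c\<in>A. \<forall>d\<in>A. holomorphic_map_on (snd c ` (fst c \<inter> fst d)) (transition c d))"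

text \<open>Points of \<open>T\<^sup>1\<^sup>,\<^sup>0M\<close> are pairs \<open>(p, v)\<close>; the component vector \<open>v c\<close> in the chart \<open>c = (z\<^sup>\<alpha>)\<close> is
  \<open>(v\<^sup>\<alpha>)\<close>, where \<open>v = v\<^sup>\<alpha> \<partial>/\<partial>z\<^sup>\<alpha>\<close>.\<close>

type_synonym ('a, 'n) tpoint = "'a \<times> ('a, (complex, 'n) vec) tvec"

definition T10 :: "('a, complex^'n) chart set \<Rightarrow> ('a, 'n) tpoint set" where
  "T10 A = {(p, v). p \<in> (\<Union>c\<in>A. fst c) \<and> v \<in> tangent_space A p}"

definition slit_T10 :: "('a, complex^'n) chart set \<Rightarrow> ('a, 'n) tpoint set" where
  "slit_T10 A = {(p, v) \<in> T10 A. v \<noteq> 0}"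

text \<open>The index set \<open>{1,\<dots>,2n}\<close> is the type \<open>'n + 'n\<close>, where \<open>Inl \<alpha>\<close> stands for \<open>\<alpha>\<close> and \<open>Inr \<alpha>\<close> for
  \<open>\<alpha>\<^sup>* = \<alpha> + n\<close>.  A coordinate tuple \<open>(x, y)\<close> of a point in the slit tangent bundle is an element of
  type \<open>'n tcoord\<close>, and so are the components of a tangent vector with respect to
  \<open>\<partial>/\<partial>x\<^sup>j, \<partial>/\<partial>y\<^sup>j\<close>.\<close>

type_synonym 'n rvec = "(real, 'n + 'n) vec"
type_synonym 'n tcoord = "'n rvec \<times> 'n rvec"
type_synonym 'n ctcoord = "(complex, 'n + 'n) vec \<times> (complex, 'n + 'n) vec"

definition realify :: "complex^'n \<Rightarrow> 'n rvec" where
  "realify z = (\<chi> j. case j of Inl \<alpha> \<Rightarrow> Re (z $ \<alpha>) | Inr \<alpha> \<Rightarrow> Im (z $ \<alpha>))"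

text \<open>The chart \<open>(x\<^sup>j, y\<^sup>j)\<close> of the slit tangent bundle induced by a chart of \<open>M\<close>.  Reading
  \<open>y\<^sup>j\<close> as the components of a real tangent vector \<open>y\<close> of \<open>M\<close>, the relation
  \<open>v\<^sup>\<alpha> = y\<^sup>\<alpha> + \<i> y\<^sup>\<alpha>\<^sup>*\<close> is the identification \<open>y \<mapsto> (y - \<i>Jy)/2\<close>.\<close>

definition slit_chart ::
  "('a, complex^'n) chart set \<Rightarrow> ('a, complex^'n) chart \<Rightarrow> (('a, 'n) tpoint, 'n tcoord) chart" where
  "slit_chart A c =
     ({(p, v) \<in> slit_T10 A. p \<in> fst c}, (\<lambda>(p, v). (realify (snd c p), realify (v c))))"

definition slit_atlas ::
  "('a, complex^'n) chart set \<Rightarrow> (('a, 'n) tpoint, 'n tcoord) chart set" where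
  "slit_atlas A = slit_chart A ` A"

type_synonym ('a, 'n) rtan = "(('a, 'n) tpoint, 'n tcoord) tvec"
type_synonym ('a, 'n) ctan = "(('a, 'n) tpoint, 'n tcoord) ctvec"

definition Jvec :: "'n::finite rvec \<Rightarrow> 'n rvec" where
  "Jvec \<xi> = (\<chi> j. case j of Inl \<alpha> \<Rightarrow> - \<xi> $ Inr \<alpha> | Inr \<alpha> \<Rightarrow> \<xi> $ Inl \<alpha>)"

definition JJ :: "('a, 'n::finite) rtan \<Rightarrow> ('a, 'n) rtan" where
  "JJ X = (\<lambda>c. (Jvec (fst (X c)), Jvec (snd (X c))))"

definition VR :: "('a, complex^'n) chart set \<Rightarrow> ('a, 'n) tpoint \<Rightarrow> ('a, 'n) rtan set" where
  "VR A u = {X \<in> tangent_space (slit_atlas A) u.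
     \<forall>b\<in>slit_atlas A. u \<in> fst b \<longrightarrow> X b \<in> span (range (\<lambda>j. (0, axis j 1)))}"

definition ccomp ::
  "('a, 'n) ctan \<Rightarrow> (('a, 'n) tpoint, 'n::finite tcoord) chart \<Rightarrow> 'n ctcoord" where
  "ccomp X b = ((\<chi> k. Complex (fst (fst X b) $ k) (fst (snd X b) $ k)),
                (\<chi> k. Complex (snd (fst X b) $ k) (snd (snd X b) $ k)))"

definition ctvec_of ::
  "('a, complex^'n) chart set \<Rightarrow> (('a, 'n) tpoint, 'n tcoord) chart \<Rightarrow> ('a, 'n) tpoint
    \<Rightarrow> 'n ctcoord \<Rightarrow> ('a, 'n) ctan" where
  "ctvec_of A b u e =
     (tvec_of (slit_atlas A) b u ((\<chi> k. Re (fst e $ k)), (\<chi> k. Re (snd e $ k))),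
      tvec_of (slit_atlas A) b u ((\<chi> k. Im (fst e $ k)), (\<chi> k. Im (snd e $ k))))"

text \<open>Components of \<open>\<partial>/\<partial>v\<^sup>\<beta> = (\<partial>/\<partial>y\<^sup>\<beta> - \<i> \<partial>/\<partial>y\<^sup>\<beta>\<^sup>*)/2\<close>.\<close>

definition dv_vec :: "'n \<Rightarrow> (complex, 'n::finite + 'n) vec" where
  "dv_vec \<beta> = (\<chi> k. case k of Inl \<alpha> \<Rightarrow> (if \<alpha> = \<beta> then 1/2 else 0)
                            | Inr \<alpha> \<Rightarrow> (if \<alpha> = \<beta> then - \<i>/2 else 0))"

definition V10 :: "('a, complex^'n) chart set \<Rightarrow> ('a, 'n) tpoint \<Rightarrow> ('a, 'n) ctan set" where
  "V10 A u = {V \<in> ctangent_space (slit_atlas A) u.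
     \<forall>b\<in>slit_atlas A. u \<in> fst b \<longrightarrow>
       (\<exists>w :: complex^'n. ccomp V b = (0, \<Sum>\<beta>\<in>UNIV. w $ \<beta> *s dv_vec \<beta>))}"


section \<open>Coordinate derivatives\<close>

definition dx :: "'n + 'n \<Rightarrow> ('n::finite tcoord \<Rightarrow> 'b::real_normed_vector) \<Rightarrow> 'n tcoord \<Rightarrow> 'b" where
  "dx j f w = frechet_derivative f (at w) (axis j 1, 0)"

definition dy :: "'n + 'n \<Rightarrow> ('n::finite tcoord \<Rightarrow> 'b::real_normed_vector) \<Rightarrow> 'n tcoord \<Rightarrow> 'b" where
  "dy j f w = frechet_derivative f (at w) (0, axis j 1)"

definition dz :: "'n \<Rightarrow> ('n::finite tcoord \<Rightarrow> complex) \<Rightarrow> 'n tcoord \<Rightarrow> complex" where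
  "dz \<mu> f w = (dx (Inl \<mu>) f w - \<i> * dx (Inr \<mu>) f w) / 2"

definition dv :: "'n \<Rightarrow> ('n::finite tcoord \<Rightarrow> complex) \<Rightarrow> 'n tcoord \<Rightarrow> complex" where
  "dv \<mu> f w = (dy (Inl \<mu>) f w - \<i> * dy (Inr \<mu>) f w) / 2"

definition dvbar :: "'n \<Rightarrow> ('n::finite tcoord \<Rightarrow> complex) \<Rightarrow> 'n tcoord \<Rightarrow> complex" where
  "dvbar \<mu> f w = (dy (Inl \<mu>) f w + \<i> * dy (Inr \<mu>) f w) / 2"


section \<open>Strongly convex complex Finsler metrics\<close>

text \<open>In what follows \<open>L\<close> is the local expression of \<open>F\<^sup>2\<close> in a chart \<open>(x; y)\<close>.\<close>

definition g_fund :: "('n::finite tcoord \<Rightarrow> real) \<Rightarrow> 'n + 'n \<Rightarrow> 'n + 'n \<Rightarrow> 'n tcoord \<Rightarrow> real" where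
  "g_fund L j k w = 1/2 * dy j (dy k L) w"

definition energy ::
  "('a, complex^'n) chart set \<Rightarrow> (('a, 'n) tpoint \<Rightarrow> real) \<Rightarrow> ('a, complex^'n) chart
    \<Rightarrow> 'n tcoord \<Rightarrow> real" where
  "energy A F c = local_rep (slit_chart A c) (\<lambda>u. (F u)\<^sup>2)"

definition strongly_convex_complex_Finsler ::
  "('a, complex^'n) chart set \<Rightarrow> (('a, 'n) tpoint \<Rightarrow> real) \<Rightarrow> bool" where
  "strongly_convex_complex_Finsler A F \<longleftrightarrow>
     (\<forall>u\<in>T10 A. F u \<ge> 0) \<and>
     (\<forall>u\<in>slit_T10 A. F u > 0) \<and>
     smooth_fun (slit_atlas A) (slit_T10 A) F \<and>
     (\<forall>(p, v)\<in>T10 A. \<forall>a :: complex. F (p, \<lambda>c. a *s v c) = cmod a * F (p, v)) \<and>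
     (\<forall>c\<in>A. \<forall>u\<in>fst (slit_chart A c). \<forall>\<xi> :: 'n rvec. \<xi> \<noteq> 0 \<longrightarrow>
        (\<Sum>j\<in>UNIV. \<Sum>k\<in>UNIV. g_fund (energy A F c) j k (snd (slit_chart A c) u) * \<xi> $ j * \<xi> $ k) > 0)"


section \<open>The Cartan connection\<close>

definition ginv :: "('n::finite tcoord \<Rightarrow> real) \<Rightarrow> 'n + 'n \<Rightarrow> 'n + 'n \<Rightarrow> 'n tcoord \<Rightarrow> real" where
  "ginv L k l w = matrix_inv (\<chi> i j. g_fund L i j w) $ k $ l"

definition Ghat :: "('n::finite tcoord \<Rightarrow> real) \<Rightarrow> 'n + 'n \<Rightarrow> 'n tcoord \<Rightarrow> real" where
  "Ghat L k w = 1/4 * (\<Sum>l\<in>UNIV. ginv L k l w *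
     ((\<Sum>a\<in>UNIV. dx a (dy l L) w * snd w $ a) - dx l L w))"

definition Nhat :: "('n::finite tcoord \<Rightarrow> real) \<Rightarrow> 'n + 'n \<Rightarrow> 'n + 'n \<Rightarrow> 'n tcoord \<Rightarrow> real" where
  "Nhat L k j w = dy j (Ghat L k) w"

definition deltax ::
  "('n::finite tcoord \<Rightarrow> real) \<Rightarrow> 'n + 'n \<Rightarrow> ('n tcoord \<Rightarrow> real) \<Rightarrow> 'n tcoord \<Rightarrow> real" where
  "deltax L j f w = dx j f w - (\<Sum>k\<in>UNIV. Nhat L k j w * dy k f w)"

definition Gamma_hor ::
  "('n::finite tcoord \<Rightarrow> real) \<Rightarrow> 'n + 'n \<Rightarrow> 'n + 'n \<Rightarrow> 'n + 'n \<Rightarrow> 'n tcoord \<Rightarrow> real" where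
  "Gamma_hor L k j l w = (\<Sum>s\<in>UNIV. ginv L k s w / 2 *
     (deltax L l (g_fund L s j) w - deltax L s (g_fund L j l) w + deltax L j (g_fund L l s) w))"

definition Gamma_ver ::
  "('n::finite tcoord \<Rightarrow> real) \<Rightarrow> 'n + 'n \<Rightarrow> 'n + 'n \<Rightarrow> 'n + 'n \<Rightarrow> 'n tcoord \<Rightarrow> real" where
  "Gamma_ver L k j l w = 1/4 * (\<Sum>s\<in>UNIV. ginv L k s w * dy j (dy l (dy s L)) w)"

definition ddy ::
  "('a, complex^'n) chart set \<Rightarrow> ('a, complex^'n) chart \<Rightarrow> 'n + 'n \<Rightarrow> ('a, 'n) tpoint
    \<Rightarrow> ('a, 'n) rtan" where
  "ddy A c j u = tvec_of (slit_atlas A) (slit_chart A c) u (0, axis j 1)"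

definition deltadx ::
  "('a, complex^'n) chart set \<Rightarrow> (('a, 'n) tpoint \<Rightarrow> real) \<Rightarrow> ('a, complex^'n) chart
    \<Rightarrow> 'n + 'n \<Rightarrow> ('a, 'n) tpoint \<Rightarrow> ('a, 'n) rtan" where
  "deltadx A F c j u = tvec_of (slit_atlas A) (slit_chart A c) u
     (axis j 1, - (\<chi> k. Nhat (energy A F c) k j (snd (slit_chart A c) u)))"

definition Cartan_connection ::
  "('a, complex^'n) chart set \<Rightarrow> (('a, 'n) tpoint \<Rightarrow> real)
    \<Rightarrow> (('a, 'n) tpoint \<Rightarrow> ('a, 'n) rtan \<Rightarrow> (('a, 'n) tpoint \<Rightarrow> ('a, 'n) rtan) \<Rightarrow> ('a, 'n) rtan)
    \<Rightarrow> bool" where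
  "Cartan_connection A F nab \<longleftrightarrow>
     linear_connection (slit_atlas A) (VR A) nab \<and>
     (\<forall>c\<in>A. \<forall>u\<in>fst (slit_chart A c). \<forall>j l.
        nab u (deltadx A F c l u) (ddy A c j)
          = (\<Sum>k\<in>UNIV. scale_tvec
               (Gamma_hor (energy A F c) k j l (snd (slit_chart A c) u)) (ddy A c k u)) \<and>
        nab u (ddy A c l u) (ddy A c j)
          = (\<Sum>k\<in>UNIV. scale_tvec
               (Gamma_ver (energy A F c) k j l (snd (slit_chart A c) u)) (ddy A c k u)))"

definition nabla_J_zero ::
  "('a, complex^'n) chart set
    \<Rightarrow> (('a, 'n) tpoint \<Rightarrow> ('a, 'n) rtan \<Rightarrow> (('a, 'n) tpoint \<Rightarrow> ('a, 'n) rtan) \<Rightarrow> ('a, 'n) rtan)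
    \<Rightarrow> bool" where
  "nabla_J_zero A nab \<longleftrightarrow>
     (\<forall>W Y. open_set (slit_atlas A) W \<and> smooth_section (slit_atlas A) (VR A) W Y \<longrightarrow>
        (\<forall>u\<in>W. \<forall>X\<in>tangent_space (slit_atlas A) u.
           nab u X (\<lambda>q. JJ (Y q)) - JJ (nab u X Y) = 0))"


section \<open>The Chern-Finsler connection\<close>

definition G_herm :: "('n::finite tcoord \<Rightarrow> real) \<Rightarrow> 'n \<Rightarrow> 'n \<Rightarrow> 'n tcoord \<Rightarrow> complex" where
  "G_herm L \<alpha> \<beta> w = dv \<alpha> (dvbar \<beta> (\<lambda>w. complex_of_real (L w))) w"

text \<open>\<open>Ginv L \<tau> \<alpha>\<close> is \<open>G\<close> with upper indices \<open>\<tau>\<close> (barred) and \<open>\<alpha>\<close>.\<close>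

definition Ginv :: "('n::finite tcoord \<Rightarrow> real) \<Rightarrow> 'n \<Rightarrow> 'n \<Rightarrow> 'n tcoord \<Rightarrow> complex" where
  "Ginv L \<tau> \<alpha> w = matrix_inv (\<chi> \<beta> \<sigma>. G_herm L \<beta> \<sigma> w) $ \<tau> $ \<alpha>"

definition CF_N :: "('n::finite tcoord \<Rightarrow> real) \<Rightarrow> 'n \<Rightarrow> 'n \<Rightarrow> 'n tcoord \<Rightarrow> complex" where
  "CF_N L \<alpha> \<mu> w =
     (\<Sum>\<tau>\<in>UNIV. Ginv L \<tau> \<alpha> w * dz \<mu> (dvbar \<tau> (\<lambda>w. complex_of_real (L w))) w)"

definition deltaz ::
  "('n::finite tcoord \<Rightarrow> real) \<Rightarrow> 'n \<Rightarrow> ('n tcoord \<Rightarrow> complex) \<Rightarrow> 'n tcoord \<Rightarrow> complex" where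
  "deltaz L \<mu> f w = dz \<mu> f w - (\<Sum>\<alpha>\<in>UNIV. CF_N L \<alpha> \<mu> w * dv \<alpha> f w)"

definition CF_hor :: "('n::finite tcoord \<Rightarrow> real) \<Rightarrow> 'n \<Rightarrow> 'n \<Rightarrow> 'n \<Rightarrow> 'n tcoord \<Rightarrow> complex" where
  "CF_hor L \<alpha> \<beta> \<mu> w = (\<Sum>\<tau>\<in>UNIV. Ginv L \<tau> \<alpha> w * deltaz L \<mu> (G_herm L \<beta> \<tau>) w)"

definition CF_ver :: "('n::finite tcoord \<Rightarrow> real) \<Rightarrow> 'n \<Rightarrow> 'n \<Rightarrow> 'n \<Rightarrow> 'n tcoord \<Rightarrow> complex" where
  "CF_ver L \<alpha> \<beta> \<gamma> w = (\<Sum>\<tau>\<in>UNIV. Ginv L \<tau> \<alpha> w * dv \<gamma> (G_herm L \<beta> \<tau>) w)"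

text \<open>The value of the one-form \<open>dz\<^sup>\<mu> = dx\<^sup>\<mu> + \<i> dx\<^sup>\<mu>\<^sup>*\<close>, respectively \<open>dv\<^sup>\<mu> = dy\<^sup>\<mu> + \<i> dy\<^sup>\<mu>\<^sup>*\<close>, on a complex
  vector with real-frame components \<open>e\<close>.\<close>

definition dz_form :: "'n \<Rightarrow> 'n::finite ctcoord \<Rightarrow> complex" where
  "dz_form \<mu> e = fst e $ Inl \<mu> + \<i> * fst e $ Inr \<mu>"

definition dv_form :: "'n \<Rightarrow> 'n::finite ctcoord \<Rightarrow> complex" where
  "dv_form \<mu> e = snd e $ Inl \<mu> + \<i> * snd e $ Inr \<mu>"

definition psi_form :: "('n::finite tcoord \<Rightarrow> real) \<Rightarrow> 'n \<Rightarrow> 'n tcoord \<Rightarrow> 'n ctcoord \<Rightarrow> complex" where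
  "psi_form L \<gamma> w e = dv_form \<gamma> e + (\<Sum>\<mu>\<in>UNIV. CF_N L \<gamma> \<mu> w * dz_form \<mu> e)"

definition omega_form ::
  "('n::finite tcoord \<Rightarrow> real) \<Rightarrow> 'n \<Rightarrow> 'n \<Rightarrow> 'n tcoord \<Rightarrow> 'n ctcoord \<Rightarrow> complex" where
  "omega_form L \<alpha> \<beta> w e = (\<Sum>\<mu>\<in>UNIV. CF_hor L \<alpha> \<beta> \<mu> w * dz_form \<mu> e)
                          + (\<Sum>\<gamma>\<in>UNIV. CF_ver L \<alpha> \<beta> \<gamma> w * psi_form L \<gamma> w e)"

definition ddv ::
  "('a, complex^'n) chart set \<Rightarrow> ('a, complex^'n) chart \<Rightarrow> 'n \<Rightarrow> ('a, 'n) tpoint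
    \<Rightarrow> ('a, 'n) ctan" where
  "ddv A c \<beta> u = ctvec_of A (slit_chart A c) u (0, dv_vec \<beta>)"

definition Chern_Finsler_connection ::
  "('a, complex^'n) chart set \<Rightarrow> (('a, 'n) tpoint \<Rightarrow> real)
    \<Rightarrow> (('a, 'n) tpoint \<Rightarrow> ('a, 'n) ctan \<Rightarrow> (('a, 'n) tpoint \<Rightarrow> ('a, 'n) ctan) \<Rightarrow> ('a, 'n) ctan)
    \<Rightarrow> bool" where
  "Chern_Finsler_connection A F D \<longleftrightarrow>
     complex_linear_connection (slit_atlas A) (V10 A) D \<and>
     (\<forall>c\<in>A. \<forall>u\<in>fst (slit_chart A c). \<forall>X\<in>ctangent_space (slit_atlas A) u. \<forall>\<beta>.
        D u X (ddv A c \<beta>)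
          = (\<Sum>\<alpha>\<in>UNIV. scale_ctvec
               (omega_form (energy A F c) \<alpha> \<beta> (snd (slit_chart A c) u) (ccomp X (slit_chart A c)))
               (ddv A c \<alpha> u)))"


section \<open>Coincidence of the two connections\<close>

definition complex_extension ::
  "('p \<Rightarrow> ('p, 'e::euclidean_space) tvec \<Rightarrow> ('p \<Rightarrow> ('p, 'e) tvec) \<Rightarrow> ('p, 'e) tvec)
    \<Rightarrow> 'p \<Rightarrow> ('p, 'e) ctvec \<Rightarrow> ('p \<Rightarrow> ('p, 'e) ctvec) \<Rightarrow> ('p, 'e) ctvec" where
  "complex_extension nab u X V =
     (nab u (fst X) (\<lambda>q. fst (V q)) - nab u (snd X) (\<lambda>q. snd (V q)),
      nab u (snd X) (\<lambda>q. fst (V q)) + nab u (fst X) (\<lambda>q. snd (V q)))"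

definition coincide ::
  "('a, complex^'n) chart set
    \<Rightarrow> (('a, 'n) tpoint \<Rightarrow> ('a, 'n) rtan \<Rightarrow> (('a, 'n) tpoint \<Rightarrow> ('a, 'n) rtan) \<Rightarrow> ('a, 'n) rtan)
    \<Rightarrow> (('a, 'n) tpoint \<Rightarrow> ('a, 'n) ctan \<Rightarrow> (('a, 'n) tpoint \<Rightarrow> ('a, 'n) ctan) \<Rightarrow> ('a, 'n) ctan)
    \<Rightarrow> bool" where
  "coincide A nab D \<longleftrightarrow>
     (\<forall>W V. open_set (slit_atlas A) W \<and> smooth_csection (slit_atlas A) (V10 A) W V \<longrightarrow>
        (\<forall>u\<in>W. \<forall>X\<in>ctangent_space (slit_atlas A) u.
           complex_extension nab u X V = D u X V))"

end

theory Submission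
  imports Defs
begin

text \<open>If the two connections coincide, then \<open>\<nabla>\<close>, extended complex linearly, preserves \<open>V\<^sup>1\<^sup>,\<^sup>0\<close>.  A
  section of \<open>V\<^sup>1\<^sup>,\<^sup>0\<close> is exactly \<open>Y - \<i> J Y\<close> with \<open>Y\<close> a real vertical field (\<open>V10_iff\<close>), so for a real
  direction \<open>X\<close> the value \<open>\<nabla>\<^sub>X Y - \<i> \<nabla>\<^sub>X (J Y)\<close> is again of this form, which says
  \<open>\<nabla>\<^sub>X (J Y) = J \<nabla>\<^sub>X Y\<close>.

  The converse rests on the fact that \<open>\<nabla> J = 0\<close> forces \<open>F\<^sup>2\<close> to be a Hermitian quadratic form on each
  fibre.  Write \<open>L = F\<^sup>2\<close> in a chart and let \<open>H\<close> and \<open>T\<close> be the second and third derivatives of \<open>L\<close> along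
  the fibre.  The vertical coefficients of \<open>\<nabla>\<close> are \<open>T\<close> with an index raised by \<open>H\<close>; they are symmetric,
  hence complex linear in both arguments once \<open>\<nabla> J = 0\<close>.  Since \<open>T(y, \<cdot>, \<cdot>) = 0\<close> by homogeneity, also
  \<open>T(J y, \<cdot>, \<cdot>) = 0\<close> (\<open>third_J_radial_eq_0\<close>).  On the other hand \<open>L\<close> is invariant under the circle action,
  and differentiating \<open>dL(J y) = 0\<close> twice gives
  \<open>T(\<zeta>, \<eta>, J y) + H(\<zeta>, J \<eta>) + H(\<eta>, J \<zeta>) = 0\<close> (\<open>third_J_radial\<close>).  Therefore \<open>H\<close> is \<open>J\<close>-invariant
  (\<open>hess_J_J\<close>).  Then \<open>T\<close> is \<open>J\<close>-invariant in every pair of arguments, and a real trilinear symmetric form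
  with this property is zero (\<open>third_eq_0\<close>).

  Thus the real metric \<open>g = H/2\<close> depends on the base point only, the vertical coefficients of both
  connections vanish, and the horizontal coefficients of \<open>\<nabla>\<close> are the Christoffel symbols of \<open>g\<close>.  These
  are symmetric and commute with \<open>J\<close>, so they are complex bilinear; as in Kaehler geometry, compatibility
  with \<open>g\<close> then identifies them with \<open>G\<^sup>-\<^sup>1 \<partial>G\<close>, the coefficients of the Chern-Finsler connection
  (\<open>dz_G_herm\<close>, \<open>CF_hor_eq\<close>).  Since vertical directions contribute
  nothing, horizontal lifts may be replaced by coordinate vectors.  Expanding a section in the frames \<open>\<partial>/\<partial>y\<^sup>j\<close> and \<open>\<partial>/\<partial>v\<^sup>\<beta>\<close> extends the equality from the
  frames to all sections (\<open>nab_section_component\<close>, \<open>D_section_half_component\<close>).\<close>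


section \<open>Calculus of smooth functions\<close>

lemma Ck_on_subset: "Ck_on k S f \<Longrightarrow> T \<subseteq> S \<Longrightarrow> Ck_on k T f"
  by (induction k arbitrary: f) (auto intro: continuous_on_subset)

lemma Ck_on_cong_imp:
  assumes "open S" "\<And>x. x \<in> S \<Longrightarrow> f x = g x" "Ck_on k S f"
  shows "Ck_on k S g"
  using assms(2,3)
proof (induction k arbitrary: f g)
  case 0
  then show ?case by (simp cong: continuous_on_cong)
next
  case (Suc k)
  have eq: "frechet_derivative f (at x) = frechet_derivative g (at x) \<and> g differentiable (at x)"
    if "x \<in> S" for x
  proof -
    have "f differentiable (at x)" using Suc.prems that by simp
    then have "(g has_derivative frechet_derivative f (at x)) (at x)"
      using has_derivative_transform_within_open[of f "frechet_derivative f (at x)" x UNIV S g]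
        \<open>open S\<close> that Suc.prems(1) by (simp add: frechet_derivative_works)
    then show ?thesis
      using frechet_derivative_at differentiableI by blast
  qed
  moreover have "Ck_on k S (\<lambda>x. frechet_derivative g (at x) e)" for e
    by (rule Suc.IH[of "\<lambda>x. frechet_derivative f (at x) e"]) (use eq Suc.prems in auto)
  ultimately show ?case by simp
qed

lemma Ck_on_SucI:
  assumes "open S"
    and "\<And>x. x \<in> S \<Longrightarrow> (f has_derivative f' x) (at x)"
    and "\<And>e. Ck_on k S (\<lambda>x. f' x e)"
  shows "Ck_on (Suc k) S f"
proof -
  have "Ck_on k S (\<lambda>x. frechet_derivative f (at x) e)" for e
    by (rule Ck_on_cong_imp[OF \<open>open S\<close> _ assms(3)[of e]])
      (use assms(2) frechet_derivative_at in metis)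
  then show ?thesis using assms(2) by (auto intro: differentiableI)
qed

lemma Ck_on_SucD:
  assumes "Ck_on (Suc k) S f" "x \<in> S"
  shows "(f has_derivative frechet_derivative f (at x)) (at x)"
  using assms by (simp add: frechet_derivative_works)

lemma Ck_on_Suc_imp: "Ck_on (Suc k) S f \<Longrightarrow> Ck_on k S f"
proof (induction k arbitrary: f)
  case 0
  then show ?case
    by (auto intro!: continuous_at_imp_continuous_on differentiable_imp_continuous_within)
qed auto

lemma Ck_on_locally:
  assumes "\<And>x. x \<in> S \<Longrightarrow> \<exists>T. open T \<and> x \<in> T \<and> Ck_on k T f"
  shows "Ck_on k S f"
  using assms
proof (induction k arbitrary: f)
  case 0
  show ?case
    unfolding Ck_on.simps
  proof (rule continuous_at_imp_continuous_on, rule ballI)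
    fix x assume "x \<in> S"
    then obtain T where "open T" "x \<in> T" "continuous_on T f" using 0 by auto
    then show "isCont f x" by (simp add: continuous_on_eq_continuous_at)
  qed
next
  case (Suc k)
  have "Ck_on k S (\<lambda>x. frechet_derivative f (at x) e)" for e
    by (rule Suc.IH) (use Suc.prems in fastforce)
  then show ?case using Suc.prems by fastforce
qed

lemma Ck_on_const [simp]: "Ck_on k S (\<lambda>x. c)"
  by (induction k arbitrary: c) auto

lemma Ck_on_bounded_linear:
  assumes "open S" "bounded_linear h"
  shows "Ck_on k S h"
  using assms
  by (cases k) (auto simp: linear_continuous_on
      intro!: Ck_on_SucI[where f' = "\<lambda>_. h"] bounded_linear_imp_has_derivative simp del: Ck_on.simps(2))

lemma Ck_on_bounded_linear_comp:
  assumes "open S" "bounded_linear h" "Ck_on k S f"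
  shows "Ck_on k S (\<lambda>x. h (f x))"
  using assms(3)
proof (induction k arbitrary: f)
  case 0
  then show ?case
    using bounded_linear.continuous_on[OF assms(2)] by auto
next
  case (Suc k)
  show ?case
  proof (rule Ck_on_SucI[OF \<open>open S\<close>])
    show "((\<lambda>x. h (f x)) has_derivative (\<lambda>e. h (frechet_derivative f (at x) e))) (at x)"
      if "x \<in> S" for x
      using bounded_linear.has_derivative[OF assms(2) Ck_on_SucD[OF Suc.prems that]] .
  qed (use Suc in auto)
qed

lemma Ck_on_add:
  assumes "open S" "Ck_on k S f" "Ck_on k S g"
  shows "Ck_on k S (\<lambda>x. f x + g x)"
  using assms(2,3)
proof (induction k arbitrary: f g)
  case 0
  then show ?case by (auto intro: continuous_on_add)
next
  case (Suc k)
  show ?case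
    by (rule Ck_on_SucI[OF \<open>open S\<close>])
      (use Suc in \<open>auto intro!: has_derivative_add simp: frechet_derivative_works\<close>)
qed

lemma Ck_on_sum:
  assumes "open S" "\<And>i. i \<in> I \<Longrightarrow> Ck_on k S (f i)"
  shows "Ck_on k S (\<lambda>x. \<Sum>i\<in>I. f i x)"
  using assms(2) by (induction I rule: infinite_finite_induct) (auto intro: Ck_on_add[OF \<open>open S\<close>])

lemma Ck_on_bilinear:
  assumes "open S" "bounded_bilinear B" "Ck_on k S f" "Ck_on k S g"
  shows "Ck_on k S (\<lambda>x. B (f x) (g x))"
  using assms(3,4)
proof (induction k arbitrary: f g)
  case 0
  then show ?case using bounded_bilinear.continuous_on[OF assms(2)] by auto
next
  case (Suc k)
  have fg: "Ck_on k S f" "Ck_on k S g" using Suc.prems Ck_on_Suc_imp by blast+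
  show ?case
  proof (rule Ck_on_SucI[OF \<open>open S\<close>])
    show "((\<lambda>x. B (f x) (g x)) has_derivative
        (\<lambda>e. B (f x) (frechet_derivative g (at x) e) + B (frechet_derivative f (at x) e) (g x))) (at x)"
      if "x \<in> S" for x
      using bounded_bilinear.FDERIV[OF assms(2)
          Ck_on_SucD[OF Suc.prems(1) that] Ck_on_SucD[OF Suc.prems(2) that]] .
    show "Ck_on k S (\<lambda>x. B (f x) (frechet_derivative g (at x) e)
        + B (frechet_derivative f (at x) e) (g x))" for e
      by (intro Ck_on_add[OF \<open>open S\<close>] Suc.IH fg) (use Suc.prems in auto)
  qed
qed

lemma linear_eq_sum_Basis:
  fixes h :: "'e::euclidean_space \<Rightarrow> 'b::real_normed_vector"
  assumes "linear h"
  shows "h x = (\<Sum>b\<in>Basis. (x \<bullet> b) *\<^sub>R h b)"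
proof -
  have "h x = h (\<Sum>b\<in>Basis. (x \<bullet> b) *\<^sub>R b)" by (simp only: euclidean_representation)
  also have "\<dots> = (\<Sum>b\<in>Basis. (x \<bullet> b) *\<^sub>R h b)"
    by (simp only: linear_sum[OF assms] linear_cmul[OF assms])
  finally show ?thesis .
qed

text \<open>The differential of \<open>g \<circ> f\<close> evaluates \<open>Dg\<close> on the moving vector \<open>Df(x) e\<close>, whereas \<open>Ck_on\<close> speaks of
  derivatives in fixed directions; expanding the moving vector in the basis makes the induction
  hypothesis applicable.\<close>

lemma Ck_on_compose:
  fixes f :: "'e::euclidean_space \<Rightarrow> 'f::euclidean_space"
  assumes "open S" "open T" "f ` S \<subseteq> T" "Ck_on k S f" "Ck_on k T g"
  shows "Ck_on k S (\<lambda>x. g (f x))"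
  using assms(4,5)
proof (induction k arbitrary: g)
  case 0
  then show ?case
    using continuous_on_compose2[of T g S f] assms(3) by simp
next
  case (Suc k)
  have f: "Ck_on k S f" using Suc.prems Ck_on_Suc_imp by blast
  show ?case
  proof (rule Ck_on_SucI[OF \<open>open S\<close>])
    fix x assume x: "x \<in> S"
    have df: "(f has_derivative frechet_derivative f (at x)) (at x)"
      using Ck_on_SucD[OF Suc.prems(1) x] .
    have dg: "(g has_derivative frechet_derivative g (at (f x))) (at (f x))"
      using Ck_on_SucD[OF Suc.prems(2)] assms(3) x by auto
    have lin: "linear (frechet_derivative g (at (f x)))" using dg has_derivative_linear by blast
    have "((\<lambda>x. g (f x)) has_derivative
        (\<lambda>e. frechet_derivative g (at (f x)) (frechet_derivative f (at x) e))) (at x)"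
      using diff_chain_at[OF df dg] by (simp add: o_def)
    also have "(\<lambda>e. frechet_derivative g (at (f x)) (frechet_derivative f (at x) e)) =
        (\<lambda>e. \<Sum>b\<in>Basis. (frechet_derivative f (at x) e \<bullet> b) *\<^sub>R frechet_derivative g (at (f x)) b)"
      by (intro ext linear_eq_sum_Basis[OF lin])
    finally show "((\<lambda>x. g (f x)) has_derivative
        (\<lambda>e. \<Sum>b\<in>Basis. (frechet_derivative f (at x) e \<bullet> b) *\<^sub>R frechet_derivative g (at (f x)) b)) (at x)" .
  next
    fix e
    show "Ck_on k S (\<lambda>x. \<Sum>b\<in>Basis. (frechet_derivative f (at x) e \<bullet> b)
        *\<^sub>R frechet_derivative g (at (f x)) b)"
    proof (intro Ck_on_sum[OF \<open>open S\<close>]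
        Ck_on_bilinear[OF \<open>open S\<close> bounded_bilinear_scaleR])
      show "Ck_on k S (\<lambda>x. frechet_derivative f (at x) e \<bullet> b)" for b
        by (rule Ck_on_bounded_linear_comp[OF \<open>open S\<close> bounded_linear_inner_left])
          (use Suc.prems in simp)
      show "Ck_on k S (\<lambda>x. frechet_derivative g (at (f x)) b)" for b
        using Suc.IH[of "\<lambda>y. frechet_derivative g (at y) b"] f Suc.prems by simp
    qed
  qed
qed

lemma smooth_on_subset: "smooth_on S f \<Longrightarrow> T \<subseteq> S \<Longrightarrow> smooth_on T f"
  by (auto simp: smooth_on_def intro: Ck_on_subset)

lemma smooth_on_cong_imp:
  "open S \<Longrightarrow> (\<And>x. x \<in> S \<Longrightarrow> f x = g x) \<Longrightarrow> smooth_on S f \<Longrightarrow> smooth_on S g"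
  unfolding smooth_on_def using Ck_on_cong_imp by blast

lemma smooth_on_locally:
  "(\<And>x. x \<in> S \<Longrightarrow> \<exists>T. open T \<and> x \<in> T \<and> smooth_on T f) \<Longrightarrow> smooth_on S f"
  unfolding smooth_on_def by (rule allI, rule Ck_on_locally) blast

lemma smooth_on_const [simp]: "smooth_on S (\<lambda>x. c)"
  by (simp add: smooth_on_def)

lemma smooth_on_bounded_linear: "open S \<Longrightarrow> bounded_linear h \<Longrightarrow> smooth_on S h"
  by (simp add: smooth_on_def Ck_on_bounded_linear)

lemma smooth_on_bounded_linear_comp:
  "open S \<Longrightarrow> bounded_linear h \<Longrightarrow> smooth_on S f \<Longrightarrow> smooth_on S (\<lambda>x. h (f x))"
  by (simp add: smooth_on_def Ck_on_bounded_linear_comp)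

lemma smooth_on_sum:
  "open S \<Longrightarrow> (\<And>i. i \<in> I \<Longrightarrow> smooth_on S (f i)) \<Longrightarrow> smooth_on S (\<lambda>x. \<Sum>i\<in>I. f i x)"
  by (simp add: smooth_on_def Ck_on_sum)

lemma smooth_on_add:
  "open S \<Longrightarrow> smooth_on S f \<Longrightarrow> smooth_on S g \<Longrightarrow> smooth_on S (\<lambda>x. f x + g x)"
  by (simp add: smooth_on_def Ck_on_add)

lemma smooth_on_bilinear:
  "open S \<Longrightarrow> bounded_bilinear B \<Longrightarrow> smooth_on S f \<Longrightarrow> smooth_on S g \<Longrightarrow>
    smooth_on S (\<lambda>x. B (f x) (g x))"
  by (simp add: smooth_on_def Ck_on_bilinear)

lemma smooth_on_compose:
  fixes f :: "'e::euclidean_space \<Rightarrow> 'f::euclidean_space"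
  shows "open S \<Longrightarrow> open T \<Longrightarrow> f ` S \<subseteq> T \<Longrightarrow> smooth_on S f \<Longrightarrow> smooth_on T g \<Longrightarrow>
    smooth_on S (\<lambda>x. g (f x))"
  unfolding smooth_on_def by (auto intro: Ck_on_compose[of S T f])

lemma smooth_on_frechet_derivative:
  "smooth_on S f \<Longrightarrow> smooth_on S (\<lambda>x. frechet_derivative f (at x) e)"
  unfolding smooth_on_def using Ck_on.simps(2) by blast

lemma smooth_on_has_derivative:
  "smooth_on S f \<Longrightarrow> x \<in> S \<Longrightarrow> (f has_derivative frechet_derivative f (at x)) (at x)"
  unfolding smooth_on_def using Ck_on_SucD by blast

lemma smooth_on_imp_continuous_on: "smooth_on S f \<Longrightarrow> continuous_on S f"
  unfolding smooth_on_def using Ck_on.simps(1) by blast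


section \<open>Symmetry of second derivatives\<close>

text \<open>Two applications of the mean value theorem to the second
  difference of \<open>f\<close> along a small parallelogram with sides \<open>tu\<close> and \<open>tv\<close> produce a value of the
  mixed derivative at a point close to \<open>x\<close>; the second difference does not distinguish between
  \<open>u\<close> and \<open>v\<close>.\<close>

lemma second_difference_eq_mixed_derivative:
  fixes f :: "'e::euclidean_space \<Rightarrow> real"
  assumes f: "smooth_on S f" and t: "0 < t"
    and box: "\<And>a b. 0 \<le> a \<Longrightarrow> a \<le> t \<Longrightarrow> 0 \<le> b \<Longrightarrow> b \<le> t \<Longrightarrow> x + a *\<^sub>R u + b *\<^sub>R v \<in> S"
  shows "\<exists>a b. 0 \<le> a \<and> a \<le> t \<and> 0 \<le> b \<and> b \<le> t \<and>
    f (x + t *\<^sub>R u + t *\<^sub>R v) - f (x + t *\<^sub>R u) - f (x + t *\<^sub>R v) + f x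
      = t * t * frechet_derivative (\<lambda>y. frechet_derivative f (at y) u) (at (x + a *\<^sub>R u + b *\<^sub>R v)) v"
proof -
  define f' where "f' y = frechet_derivative f (at y) u" for y
  have f': "smooth_on S f'" unfolding f'_def by (rule smooth_on_frechet_derivative[OF f])
  have d: "((\<lambda>s. f (x + s *\<^sub>R u + b *\<^sub>R v)) has_field_derivative f' (x + s *\<^sub>R u + b *\<^sub>R v)) (at s)"
    if "0 \<le> s" "s \<le> t" "0 \<le> b" "b \<le> t" for s b
  proof -
    have D: "(f has_derivative frechet_derivative f (at (x + s *\<^sub>R u + b *\<^sub>R v))) (at (x + s *\<^sub>R u + b *\<^sub>R v))"
      by (rule smooth_on_has_derivative[OF f]) (use box that in auto)
    have "((\<lambda>s. x + s *\<^sub>R u + b *\<^sub>R v) has_derivative (\<lambda>h. h *\<^sub>R u)) (at s)"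
      by (auto intro!: derivative_eq_intros)
    from diff_chain_at[OF this D] show ?thesis
      by (simp add: has_field_derivative_def o_def f'_def
          linear_cmul[OF has_derivative_linear[OF D]] mult.commute[of _ "frechet_derivative _ _ _"])
  qed
  have "\<exists>s>0. s < t \<and> (f (x + t *\<^sub>R u + t *\<^sub>R v) - f (x + t *\<^sub>R u + 0 *\<^sub>R v))
        - (f (x + 0 *\<^sub>R u + t *\<^sub>R v) - f (x + 0 *\<^sub>R u + 0 *\<^sub>R v))
      = (t - 0) * (f' (x + s *\<^sub>R u + t *\<^sub>R v) - f' (x + s *\<^sub>R u + 0 *\<^sub>R v))"
    by (rule MVT2[of 0 t "\<lambda>s. f (x + s *\<^sub>R u + t *\<^sub>R v) - f (x + s *\<^sub>R u + 0 *\<^sub>R v)"])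
      (use t in \<open>auto intro!: DERIV_diff d d[where b=0, simplified]\<close>)
  then obtain a where a: "0 < a" "a < t" and e1:
    "f (x + t *\<^sub>R u + t *\<^sub>R v) - f (x + t *\<^sub>R u) - f (x + t *\<^sub>R v) + f x
      = t * (f' (x + a *\<^sub>R u + t *\<^sub>R v) - f' (x + a *\<^sub>R u))"
    by auto
  have "\<exists>s>0. s < t \<and> f' (x + a *\<^sub>R u + t *\<^sub>R v) - f' (x + a *\<^sub>R u + 0 *\<^sub>R v)
      = (t - 0) * frechet_derivative f' (at (x + a *\<^sub>R u + s *\<^sub>R v)) v"
  proof (rule MVT2[of 0 t "\<lambda>s. f' (x + a *\<^sub>R u + s *\<^sub>R v)"])
    fix s assume s: "0 \<le> s" "s \<le> t"
    have D: "(f' has_derivative frechet_derivative f' (at (x + a *\<^sub>R u + s *\<^sub>R v))) (at (x + a *\<^sub>R u + s *\<^sub>R v))"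
      by (rule smooth_on_has_derivative[OF f']) (use box s a in auto)
    have "((\<lambda>s. x + a *\<^sub>R u + s *\<^sub>R v) has_derivative (\<lambda>h. h *\<^sub>R v)) (at s)"
      by (auto intro!: derivative_eq_intros)
    from diff_chain_at[OF this D]
    show "((\<lambda>s. f' (x + a *\<^sub>R u + s *\<^sub>R v)) has_field_derivative
        frechet_derivative f' (at (x + a *\<^sub>R u + s *\<^sub>R v)) v) (at s)"
      by (simp add: has_field_derivative_def o_def
          linear_cmul[OF has_derivative_linear[OF D]] mult.commute[of _ "frechet_derivative _ _ _"])
  qed (use t in auto)
  then obtain b where b: "0 < b" "b < t" and e2: "f' (x + a *\<^sub>R u + t *\<^sub>R v) - f' (x + a *\<^sub>R u)
      = t * frechet_derivative f' (at (x + a *\<^sub>R u + b *\<^sub>R v)) v"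
    by auto
  show ?thesis
    using a b e1 e2 unfolding f'_def[abs_def]
    by (intro exI[of _ a] exI[of _ b]) (simp add: mult.assoc)
qed

text \<open>The second difference equals \<open>t\<^sup>2\<close> times either mixed derivative, each at some point of the small
  parallelogram; continuity of the mixed derivatives then gives equality in the limit.\<close>

lemma mixed_derivatives_commute:
  fixes f :: "'e::euclidean_space \<Rightarrow> real"
  assumes f: "smooth_on S f" and S: "open S" "x \<in> S"
  shows "frechet_derivative (\<lambda>y. frechet_derivative f (at y) u) (at x) v
    = frechet_derivative (\<lambda>y. frechet_derivative f (at y) v) (at x) u"
proof -
  define P where "P y = frechet_derivative (\<lambda>y. frechet_derivative f (at y) u) (at y) v" for y
  define Q where "Q y = frechet_derivative (\<lambda>y. frechet_derivative f (at y) v) (at y) u" for y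
  have cont: "isCont P x" "isCont Q x"
    using smooth_on_imp_continuous_on[OF smooth_on_frechet_derivative[OF
        smooth_on_frechet_derivative[OF f]]] S
    unfolding P_def Q_def by (auto simp: continuous_on_eq_continuous_at)
  have "\<bar>P x - Q x\<bar> \<le> e" if "e > 0" for e
  proof -
    obtain d1 where d1: "d1 > 0" "\<And>y. dist y x < d1 \<Longrightarrow> dist (P y) (P x) < e/2"
      using cont(1) \<open>e > 0\<close> by (metis continuous_at_eps_delta half_gt_zero dist_norm real_norm_def)
    obtain d2 where d2: "d2 > 0" "\<And>y. dist y x < d2 \<Longrightarrow> dist (Q y) (Q x) < e/2"
      using cont(2) \<open>e > 0\<close> by (metis continuous_at_eps_delta half_gt_zero dist_norm real_norm_def)
    obtain d3 where d3: "d3 > 0" "ball x d3 \<subseteq> S"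
      using S by (meson open_contains_ball)
    define d where "d = min d1 (min d2 d3)"
    define t where "t = d / (norm u + norm v + 1)"
    have n: "norm u + norm v + 1 > 0" by (simp add: add_nonneg_pos)
    have "d > 0" using d1 d2 d3 by (simp add: d_def)
    then have t: "t > 0" using n by (simp add: t_def)
    have near: "dist (x + a *\<^sub>R u + b *\<^sub>R v) x < d" if "0 \<le> a" "a \<le> t" "0 \<le> b" "b \<le> t" for a b
    proof -
      have "dist (x + a *\<^sub>R u + b *\<^sub>R v) x = norm (a *\<^sub>R u + b *\<^sub>R v)"
        by (simp add: dist_norm add.assoc)
      also have "\<dots> \<le> a * norm u + b * norm v"
        using that by (metis abs_of_nonneg norm_scaleR norm_triangle_ineq)
      also have "\<dots> \<le> t * norm u + t * norm v"
        using that by (intro add_mono mult_right_mono) auto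
      also have "\<dots> < t * (norm u + norm v + 1)" using t by (simp add: algebra_simps)
      also have "\<dots> = d" using n by (simp add: t_def)
      finally show ?thesis .
    qed
    have in1: "x + a *\<^sub>R u + b *\<^sub>R v \<in> S" if "0 \<le> a" "a \<le> t" "0 \<le> b" "b \<le> t" for a b
      using near[OF that] d3 by (auto simp: d_def subset_eq dist_commute)
    have in2: "x + a *\<^sub>R v + b *\<^sub>R u \<in> S" if "0 \<le> a" "a \<le> t" "0 \<le> b" "b \<le> t" for a b
      using in1[OF that(3,4,1,2)] by (simp add: algebra_simps)
    obtain a b where ab: "0 \<le> a" "a \<le> t" "0 \<le> b" "b \<le> t" and e1:
      "f (x + t *\<^sub>R u + t *\<^sub>R v) - f (x + t *\<^sub>R u) - f (x + t *\<^sub>R v) + f x = t * t * P (x + a *\<^sub>R u + b *\<^sub>R v)"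
      using second_difference_eq_mixed_derivative[OF f t in1] unfolding P_def by blast
    obtain a' b' where ab': "0 \<le> a'" "a' \<le> t" "0 \<le> b'" "b' \<le> t" and e2:
      "f (x + t *\<^sub>R v + t *\<^sub>R u) - f (x + t *\<^sub>R v) - f (x + t *\<^sub>R u) + f x = t * t * Q (x + a' *\<^sub>R v + b' *\<^sub>R u)"
      using second_difference_eq_mixed_derivative[OF f t in2] unfolding Q_def by blast
    have swap: "x + t *\<^sub>R v + t *\<^sub>R u = x + t *\<^sub>R u + t *\<^sub>R v" by simp
    have "t * t * P (x + a *\<^sub>R u + b *\<^sub>R v) = t * t * Q (x + a' *\<^sub>R v + b' *\<^sub>R u)"
      using e1 e2 unfolding swap by linarith
    with t have "P (x + a *\<^sub>R u + b *\<^sub>R v) = Q (x + a' *\<^sub>R v + b' *\<^sub>R u)" by simp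
    moreover have "dist (P (x + a *\<^sub>R u + b *\<^sub>R v)) (P x) < e/2"
      by (rule d1(2)) (use near[OF ab] in \<open>simp add: d_def\<close>)
    moreover have "dist (x + a' *\<^sub>R v + b' *\<^sub>R u) x < d"
      using near[OF ab'(3,4,1,2)] by (simp only: add.commute add.left_commute)
    then have "dist (Q (x + a' *\<^sub>R v + b' *\<^sub>R u)) (Q x) < e/2"
      by (intro d2(2)) (simp add: d_def)
    ultimately show ?thesis unfolding dist_real_def by linarith
  qed
  then have "\<bar>P x - Q x\<bar> \<le> 0" by (rule field_le_epsilon) simp
  then have "P x = Q x" by simp
  then show ?thesis by (simp add: P_def Q_def)
qed


section \<open>Tangent vectors and sections on a manifold given by an atlas\<close>

text \<open>The part of the manifold structure that tangent vectors and sections depend on.  It is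
  instantiated twice, by the atlas of the base and by that of the slit tangent bundle.\<close>

locale smooth_atlas =
  fixes A :: "('p, 'e::euclidean_space) chart set"
  assumes inj_chart: "c \<in> A \<Longrightarrow> inj_on (snd c) (fst c)"
    and open_overlap: "c \<in> A \<Longrightarrow> d \<in> A \<Longrightarrow> open (snd c ` (fst c \<inter> fst d))"
    and smooth_transition:
      "c \<in> A \<Longrightarrow> d \<in> A \<Longrightarrow> smooth_on (snd c ` (fst c \<inter> fst d)) (transition c d)"
begin

lemma local_rep_apply: "c \<in> A \<Longrightarrow> p \<in> fst c \<Longrightarrow> local_rep c f (snd c p) = f p"
  by (simp add: inj_chart)

lemma transition_apply: "c \<in> A \<Longrightarrow> p \<in> fst c \<Longrightarrow> transition c d (snd c p) = snd d p"
  by (simp add: transition_def inj_chart)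

lemma open_chart: "c \<in> A \<Longrightarrow> open (snd c ` fst c)"
  using open_overlap[of c c] by simp

lemma transition_derivative:
  assumes "c \<in> A" "d \<in> A" "p \<in> fst c" "p \<in> fst d"
  shows "(transition c d has_derivative frechet_derivative (transition c d) (at (snd c p)))
    (at (snd c p))"
  using smooth_on_has_derivative[OF smooth_transition[OF assms(1,2)]] assms by auto

lemma transition_linear:
  assumes "c \<in> A" "d \<in> A" "p \<in> fst c" "p \<in> fst d"
  shows "linear (frechet_derivative (transition c d) (at (snd c p)))"
  using has_derivative_linear[OF transition_derivative[OF assms]] .

lemma transition_chain:
  assumes c: "c \<in> A" "p \<in> fst c" and d: "d \<in> A" "p \<in> fst d" and e: "e \<in> A" "p \<in> fst e"
  shows "frechet_derivative (transition d e) (at (snd d p))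
      (frechet_derivative (transition c d) (at (snd c p)) x)
    = frechet_derivative (transition c e) (at (snd c p)) x"
proof -
  have "((transition d e \<circ> transition c d) has_derivative
      (frechet_derivative (transition d e) (at (snd d p)) \<circ>
       frechet_derivative (transition c d) (at (snd c p)))) (at (snd c p))"
    using diff_chain_at[OF transition_derivative[OF c(1) d(1) c(2) d(2)]]
      transition_derivative[OF d(1) e(1) d(2) e(2)] transition_apply[OF c] by metis
  moreover have "snd c p \<in> snd c ` (fst c \<inter> fst d)" using c d by blast
  moreover have "(transition d e \<circ> transition c d) y = transition c e y"
    if y: "y \<in> snd c ` (fst c \<inter> fst d)" for y
    using y by (auto simp: transition_apply c d)
  ultimately have "(transition c e has_derivative
      (frechet_derivative (transition d e) (at (snd d p)) \<circ>
       frechet_derivative (transition c d) (at (snd c p)))) (at (snd c p))"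
    by (rule has_derivative_transform_within_open[OF _ open_overlap[OF c(1) d(1)]])
  from fun_cong[OF frechet_derivative_at[OF this], of x] show ?thesis by simp
qed

lemma transition_self:
  assumes "c \<in> A" "p \<in> fst c"
  shows "frechet_derivative (transition c c) (at (snd c p)) x = x"
proof -
  have "((\<lambda>y. y) has_derivative (\<lambda>y. y)) (at (snd c p))" by simp
  then have "(transition c c has_derivative (\<lambda>y. y)) (at (snd c p))"
    by (rule has_derivative_transform_within_open[OF _ open_chart[OF assms(1)]])
      (auto simp: transition_apply assms)
  from fun_cong[OF frechet_derivative_at[OF this], of x] show ?thesis by simp
qed

lemma tvec_of_self:
  assumes "c \<in> A" "p \<in> fst c"
  shows "tvec_of A c p e c = e"
  by (simp add: tvec_of_def transition_self assms)

lemma tvec_of_in_tangent_space: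
  assumes "c \<in> A" "p \<in> fst c"
  shows "tvec_of A c p e \<in> tangent_space A p"
  by (simp add: tangent_space_def tvec_of_def transition_chain assms)

lemma tangent_space_change:
  "X \<in> tangent_space A p \<Longrightarrow> c \<in> A \<Longrightarrow> d \<in> A \<Longrightarrow> p \<in> fst c \<Longrightarrow> p \<in> fst d \<Longrightarrow>
    X d = frechet_derivative (transition c d) (at (snd c p)) (X c)"
  unfolding tangent_space_def by blast

lemma tangent_space_eqI:
  assumes "X \<in> tangent_space A p" "Y \<in> tangent_space A p" "c \<in> A" "p \<in> fst c" "X c = Y c"
  shows "X = Y"
proof
  fix d
  show "X d = Y d"
  proof (cases "d \<in> A \<and> p \<in> fst d")
    case True
    then show ?thesis
      using tangent_space_change[OF assms(1,3) _ assms(4)] tangent_space_change[OF assms(2,3) _ assms(4)]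
        assms(5) by simp
  next
    case False
    then have "X d = 0" "Y d = 0" using assms(1,2) unfolding tangent_space_def by blast+
    then show ?thesis by simp
  qed
qed

lemma tvec_of_component:
  assumes "X \<in> tangent_space A p" "c \<in> A" "p \<in> fst c"
  shows "tvec_of A c p (X c) = X"
  by (rule tangent_space_eqI[OF tvec_of_in_tangent_space[OF assms(2,3)] assms])
    (rule tvec_of_self[OF assms(2,3)])

lemma tangent_spaceI:
  assumes "\<And>c d. c \<in> A \<Longrightarrow> d \<in> A \<Longrightarrow> p \<in> fst c \<Longrightarrow> p \<in> fst d \<Longrightarrow>
      X d = frechet_derivative (transition c d) (at (snd c p)) (X c)"
    and "\<And>c. \<not> (c \<in> A \<and> p \<in> fst c) \<Longrightarrow> X c = 0"
  shows "X \<in> tangent_space A p"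
  using assms unfolding tangent_space_def by blast

lemma tangent_space_outside:
  "X \<in> tangent_space A p \<Longrightarrow> \<not> (c \<in> A \<and> p \<in> fst c) \<Longrightarrow> X c = 0"
  unfolding tangent_space_def by blast

lemma tangent_space_zero: "0 \<in> tangent_space A p"
  by (rule tangent_spaceI) (simp_all add: linear_0 transition_linear)

lemma tangent_space_add:
  assumes "X \<in> tangent_space A p" "Y \<in> tangent_space A p"
  shows "X + Y \<in> tangent_space A p"
proof (rule tangent_spaceI)
  fix c d assume cd: "c \<in> A" "d \<in> A" "p \<in> fst c" "p \<in> fst d"
  show "(X + Y) d = frechet_derivative (transition c d) (at (snd c p)) ((X + Y) c)"
    unfolding plus_fun_apply linear_add[OF transition_linear[OF cd]]
    using tangent_space_change[OF assms(1) cd] tangent_space_change[OF assms(2) cd] by argo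
qed (use tangent_space_outside[OF assms(1)] tangent_space_outside[OF assms(2)] in simp)

lemma tangent_space_scale:
  assumes "X \<in> tangent_space A p"
  shows "scale_tvec a X \<in> tangent_space A p"
proof (rule tangent_spaceI)
  fix c d assume cd: "c \<in> A" "d \<in> A" "p \<in> fst c" "p \<in> fst d"
  show "scale_tvec a X d = frechet_derivative (transition c d) (at (snd c p)) (scale_tvec a X c)"
    unfolding scale_tvec_def linear_cmul[OF transition_linear[OF cd]]
    using tangent_space_change[OF assms(1) cd] by argo
qed (use tangent_space_outside[OF assms(1)] in \<open>simp add: scale_tvec_def\<close>)

lemma open_set_chart: "c \<in> A \<Longrightarrow> open_set A (fst c)"
  by (simp add: open_set_def open_overlap Int_commute UN_upper)

lemma open_set_Int:
  assumes "open_set A V" "open_set A W"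
  shows "open_set A (V \<inter> W)"
  unfolding open_set_def
proof (intro conjI ballI)
  fix c assume c: "c \<in> A"
  have "snd c ` (V \<inter> W \<inter> fst c) = snd c ` (V \<inter> fst c) \<inter> snd c ` (W \<inter> fst c)"
    using inj_on_image_Int[OF inj_chart[OF c], of "V \<inter> fst c" "W \<inter> fst c"]
    by (simp add: Int_ac)
  then show "open (snd c ` (V \<inter> W \<inter> fst c))" using assms c by (auto simp: open_set_def)
qed (use assms in \<open>auto simp: open_set_def\<close>)

text \<open>Smoothness may be tested in any chart, because the coordinate changes are smooth.\<close>

lemma smooth_fun_in_chart:
  assumes "smooth_fun A W f" "open_set A W" "c \<in> A"
  shows "smooth_on (snd c ` (W \<inter> fst c)) (local_rep c f)"
proof (rule smooth_on_locally)
  fix x assume "x \<in> snd c ` (W \<inter> fst c)"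
  then obtain u where u: "u \<in> W" "u \<in> fst c" "x = snd c u" by auto
  obtain d where d: "d \<in> A" "u \<in> fst d" "smooth_on (snd d ` (W \<inter> fst d)) (local_rep d f)"
    using assms(1) u unfolding smooth_fun_def by blast
  define T where "T = snd c ` (W \<inter> fst d \<inter> fst c)"
  have T: "open T"
    using open_set_Int[OF assms(2) open_set_chart[OF d(1)]] assms(3)
    unfolding T_def open_set_def by blast
  \<comment> \<open>Near \<open>u\<close> the representation in \<open>c\<close> is the one in \<open>d\<close> after the coordinate change.\<close>
  have "smooth_on T (\<lambda>y. local_rep d f (transition c d y))"
  proof (rule smooth_on_compose[OF T, of "snd d ` (W \<inter> fst d)"])
    show "open (snd d ` (W \<inter> fst d))" using assms(2) d(1) unfolding open_set_def by blast
    show "transition c d ` T \<subseteq> snd d ` (W \<inter> fst d)"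
      by (auto simp: T_def transition_apply assms(3))
    show "smooth_on T (transition c d)"
      by (rule smooth_on_subset[OF smooth_transition[OF assms(3) d(1)]]) (auto simp: T_def)
  qed (rule d(3))
  then have "smooth_on T (local_rep c f)"
    by (rule smooth_on_cong_imp[OF T, rotated])
      (auto simp: T_def transition_apply assms(3) inj_chart d(1))
  then show "\<exists>T. open T \<and> x \<in> T \<and> smooth_on T (local_rep c f)"
    using T u d(2) unfolding T_def by blast
qed

lemma smooth_sectionI:
  assumes "c \<in> A" "W \<subseteq> fst c" "\<And>u. u \<in> W \<Longrightarrow> Y u \<in> E u"
    and "smooth_on (snd c ` W) (local_rep c (\<lambda>q. Y q c))"
  shows "smooth_section A E W Y"
proof -
  have "W \<inter> fst c = W" using assms(2) by blast
  then show ?thesis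
    unfolding smooth_section_def using assms(1,2,4) by (intro conjI ballI assms(3) bexI[of _ c]) auto
qed

lemma smooth_funI:
  assumes "c \<in> A" "W \<subseteq> fst c" "smooth_on (snd c ` W) (local_rep c f)"
  shows "smooth_fun A W f"
proof -
  have "W \<inter> fst c = W" using assms(2) by blast
  then show ?thesis
    unfolding smooth_fun_def using assms by (intro ballI bexI[of _ c]) auto
qed

lemma smooth_on_local_rep_cong:
  assumes "c \<in> A" "W \<subseteq> fst c" "open (snd c ` W)" "\<And>q. q \<in> W \<Longrightarrow> f q = g q"
    and "smooth_on (snd c ` W) (local_rep c f)"
  shows "smooth_on (snd c ` W) (local_rep c g)"
proof (rule smooth_on_cong_imp[OF assms(3) _ assms(5)])
  fix x assume "x \<in> snd c ` W"
  then obtain q where q: "q \<in> W" "q \<in> fst c" "x = snd c q" using assms(2) by blast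
  show "local_rep c f x = local_rep c g x"
    by (simp only: q(3) local_rep_apply[OF assms(1) q(2)] assms(4)[OF q(1)])
qed

end


section \<open>Real and complex fibre coordinates\<close>

definition complexify :: "'n::finite rvec \<Rightarrow> complex^'n" where
  "complexify \<xi> = (\<chi> \<alpha>. Complex (\<xi> $ Inl \<alpha>) (\<xi> $ Inr \<alpha>))"

lemma all_sum_index: "(\<forall>k::'n + 'n. P k) \<longleftrightarrow> (\<forall>\<alpha>. P (Inl \<alpha>)) \<and> (\<forall>\<alpha>. P (Inr \<alpha>))"
  by (metis sum.exhaust)

lemma complexify_realify [simp]: "complexify (realify z) = z"
  by (simp add: complexify_def realify_def vec_eq_iff complex_eq_iff)

lemma realify_complexify [simp]: "realify (complexify \<xi>) = \<xi>"
  by (simp add: complexify_def realify_def vec_eq_iff all_sum_index)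

lemma linear_realify: "linear realify"
  by (rule linearI) (simp_all add: realify_def vec_eq_iff all_sum_index)

lemma linear_complexify: "linear complexify"
  by (rule linearI) (simp_all add: complexify_def vec_eq_iff complex_eq_iff)

lemma linear_Jvec: "linear Jvec"
  by (rule linearI) (simp_all add: Jvec_def vec_eq_iff all_sum_index)

lemma bounded_linear_realify: "bounded_linear realify"
  and bounded_linear_complexify: "bounded_linear complexify"
  and bounded_linear_Jvec: "bounded_linear Jvec"
  using linear_realify linear_complexify linear_Jvec by (simp_all add: linear_conv_bounded_linear)

lemma complexify_Jvec: "complexify (Jvec \<xi>) = \<i> *s complexify \<xi>"
  by (simp add: complexify_def Jvec_def vec_eq_iff complex_eq_iff)

lemma realify_times_ii: "realify (\<i> *s z) = Jvec (realify z)"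
  by (simp add: realify_def Jvec_def vec_eq_iff all_sum_index)

lemma Jvec_Jvec [simp]: "Jvec (Jvec \<xi>) = - \<xi>"
  by (simp add: Jvec_def vec_eq_iff all_sum_index)

lemma realify_eq_0_iff: "realify z = 0 \<longleftrightarrow> z = 0"
  by (metis complexify_realify linear_complexify linear_realify linear_0)

lemma complexify_eq_0_iff: "complexify \<xi> = 0 \<longleftrightarrow> \<xi> = 0"
  by (metis realify_complexify linear_complexify linear_realify linear_0)

lemma Jvec_axis:
  "Jvec (axis (Inl \<alpha>) 1) = axis (Inr \<alpha>) 1" "Jvec (axis (Inr \<alpha>) 1) = - axis (Inl \<alpha>) 1"
  by (simp_all add: Jvec_def axis_def vec_eq_iff all_sum_index)

lemma sum_sum_index:
  fixes f :: "'n::finite + 'n \<Rightarrow> 'b::comm_monoid_add"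
  shows "(\<Sum>j\<in>UNIV. f j) = (\<Sum>\<alpha>\<in>UNIV. f (Inl \<alpha>)) + (\<Sum>\<alpha>\<in>UNIV. f (Inr \<alpha>))"
  by (subst UNIV_Plus_UNIV[symmetric], subst sum.Plus) simp_all

lemma complexify_sum: "complexify (\<Sum>i\<in>I. f i) = (\<Sum>i\<in>I. complexify (f i))"
  by (rule linear_sum[OF linear_complexify])

lemma complexify_scaleR: "complexify (r *\<^sub>R \<xi>) = complex_of_real r *s complexify \<xi>"
  by (simp add: complexify_def vec_eq_iff complex_eq_iff)

text \<open>The hypothesis says that \<open>\<eta> \<mapsto> \<Sum>\<^sub>j \<eta>\<^sub>j f\<^sub>j\<close> commutes with \<open>J\<close>, so in complex coordinates this map
  is determined by its values on the first half of the frame.\<close>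

lemma complexify_complex_linear_sum:
  fixes f :: "'n::finite + 'n \<Rightarrow> 'n rvec"
  assumes "\<And>\<alpha>. f (Inr \<alpha>) = Jvec (f (Inl \<alpha>))"
  shows "complexify (\<Sum>j\<in>UNIV. \<eta> $ j *\<^sub>R f j)
    = (\<Sum>\<beta>\<in>UNIV. complexify \<eta> $ \<beta> *s complexify (f (Inl \<beta>)))"
proof -
  have "complexify (\<Sum>j\<in>UNIV. \<eta> $ j *\<^sub>R f j)
      = (\<Sum>\<alpha>\<in>UNIV. complex_of_real (\<eta> $ Inl \<alpha>) *s complexify (f (Inl \<alpha>))
        + complex_of_real (\<eta> $ Inr \<alpha>) *s (\<i> *s complexify (f (Inl \<alpha>))))"
    by (simp add: linear_add[OF linear_complexify] complexify_sum complexify_scaleR sum_sum_index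
        assms complexify_Jvec sum.distrib)
  also have "\<dots> = (\<Sum>\<beta>\<in>UNIV. complexify \<eta> $ \<beta> *s complexify (f (Inl \<beta>)))"
    by (rule sum.cong) (simp_all add: complexify_def vec_eq_iff complex_eq_iff algebra_simps)
  finally show ?thesis .
qed

lemma complexify_complex_bilinear_sum:
  fixes B :: "'n::finite + 'n \<Rightarrow> 'n + 'n \<Rightarrow> 'n rvec"
  assumes J: "\<And>\<alpha> l. B (Inr \<alpha>) l = Jvec (B (Inl \<alpha>) l)" and sym: "\<And>j l. B j l = B l j"
  shows "complexify (\<Sum>j\<in>UNIV. \<eta> $ j *\<^sub>R (\<Sum>l\<in>UNIV. \<xi> $ l *\<^sub>R B j l)) $ \<alpha>
    = (\<Sum>\<beta>\<in>UNIV. complexify \<eta> $ \<beta> * (\<Sum>\<mu>\<in>UNIV. complexify \<xi> $ \<mu> * complexify (B (Inl \<beta>) (Inl \<mu>)) $ \<alpha>))"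
proof -
  have "complexify (\<Sum>j\<in>UNIV. \<eta> $ j *\<^sub>R (\<Sum>l\<in>UNIV. \<xi> $ l *\<^sub>R B j l))
      = (\<Sum>\<beta>\<in>UNIV. complexify \<eta> $ \<beta> *s complexify (\<Sum>l\<in>UNIV. \<xi> $ l *\<^sub>R B (Inl \<beta>) l))"
    by (rule complexify_complex_linear_sum)
      (simp add: J linear_sum[OF linear_Jvec] linear_cmul[OF linear_Jvec])
  also have "\<dots> = (\<Sum>\<beta>\<in>UNIV. complexify \<eta> $ \<beta> *s
      (\<Sum>\<mu>\<in>UNIV. complexify \<xi> $ \<mu> *s complexify (B (Inl \<beta>) (Inl \<mu>))))"
  proof (intro sum.cong refl arg_cong[where f = "\<lambda>t. _ *s t"] complexify_complex_linear_sum)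
    show "B (Inl \<beta>) (Inr \<alpha>) = Jvec (B (Inl \<beta>) (Inl \<alpha>))" for \<alpha> \<beta>
      using J[of \<alpha> "Inl \<beta>"] sym by simp
  qed
  finally show ?thesis by simp
qed

lemma Jvec_complex_linear_sum:
  fixes f :: "'n::finite + 'n \<Rightarrow> 'n rvec"
  assumes "\<And>\<alpha>. f (Inr \<alpha>) = Jvec (f (Inl \<alpha>))"
  shows "(\<Sum>j\<in>UNIV. Jvec \<eta> $ j *\<^sub>R f j) = Jvec (\<Sum>j\<in>UNIV. \<eta> $ j *\<^sub>R f j)"
proof -
  have "complexify (\<Sum>j\<in>UNIV. Jvec \<eta> $ j *\<^sub>R f j) = complexify (Jvec (\<Sum>j\<in>UNIV. \<eta> $ j *\<^sub>R f j))"
    unfolding complexify_Jvec complexify_complex_linear_sum[OF assms]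
    by (simp add: vec_eq_iff sum_distrib_left mult.assoc)
  from arg_cong[OF this, of realify] show ?thesis by (simp only: realify_complexify)
qed

lemma span_vertical: "a \<in> span (range (\<lambda>j. (0, axis j 1))) \<longleftrightarrow> fst a = 0"
  for a :: "'n::finite tcoord"
proof
  have "span (range (\<lambda>j. (0, axis j 1))) \<subseteq> {a :: 'n tcoord. fst a = 0}"
    by (rule span_minimal) (auto simp: subspace_def)
  then show "a \<in> span (range (\<lambda>j. (0, axis j 1))) \<Longrightarrow> fst a = 0" by blast
next
  assume a: "fst a = 0"
  have eq: "(\<Sum>j\<in>UNIV. (snd a $ j) *\<^sub>R ((0, axis j 1) :: 'n tcoord)) = a"
    using a basis_expansion[of "snd a"]
    by (simp add: prod_eq_iff fst_sum snd_sum scalar_mult_eq_scaleR)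
  have "(\<Sum>j\<in>UNIV. (snd a $ j) *\<^sub>R ((0, axis j 1) :: 'n tcoord)) \<in> span (range (\<lambda>j. (0, axis j 1)))"
    by (intro span_sum span_scale span_base rangeI)
  then show "a \<in> span (range (\<lambda>j. (0, axis j 1)))" unfolding eq .
qed


section \<open>The slit tangent bundle as a smooth manifold\<close>

lemma complex_manifold_smooth_atlas:
  assumes "complex_manifold M A"
  shows "smooth_atlas A"
proof
  have M: "openin M (fst c)" "open (snd c ` fst c)"
    "homeomorphic_map (subtopology M (fst c)) (top_of_set (snd c ` fst c)) (snd c)"
    if "c \<in> A" for c
    using assms that unfolding complex_manifold_def by blast+
  have top: "topspace (subtopology M (fst c)) = fst c" if "c \<in> A" for c
    using openin_subset[OF M(1)[OF that]] by (auto simp: topspace_subtopology)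
  show "inj_on (snd c) (fst c)" if "c \<in> A" for c
    using homeomorphic_imp_injective_map[OF M(3)[OF that]] top[OF that] by simp
  show "open (snd c ` (fst c \<inter> fst d))" if "c \<in> A" "d \<in> A" for c d
  proof -
    have "openin (subtopology M (fst c)) (fst c \<inter> fst d)"
      using M(1)[OF that(2)] by (metis Int_commute openin_subtopology_Int)
    then have "openin (top_of_set (snd c ` fst c)) (snd c ` (fst c \<inter> fst d))"
      using homeomorphic_imp_open_map[OF M(3)[OF that(1)]] unfolding open_map_def by blast
    then show ?thesis using M(2)[OF that(1)] openin_open_eq by blast
  qed
  show "smooth_on (snd c ` (fst c \<inter> fst d)) (transition c d)" if "c \<in> A" "d \<in> A" for c d
    using assms that unfolding complex_manifold_def holomorphic_map_on_def by blast
qed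

text \<open>Complex linearity of the coordinate changes is what makes \<open>J\<close> well defined on tangent vectors.\<close>

locale complex_atlas = smooth_atlas A
  for A :: "('a, complex^'n) chart set" +
  assumes transition_holomorphic: "c \<in> A \<Longrightarrow> d \<in> A \<Longrightarrow> p \<in> fst c \<Longrightarrow> p \<in> fst d \<Longrightarrow>
    frechet_derivative (transition c d) (at (snd c p)) (\<i> *s v)
      = \<i> *s frechet_derivative (transition c d) (at (snd c p)) v"
begin

lemma slit_chart_domain: "(p, v) \<in> fst (slit_chart A c) \<longleftrightarrow>
    p \<in> fst c \<and> p \<in> (\<Union>c\<in>A. fst c) \<and> v \<in> tangent_space A p \<and> v \<noteq> 0"
  by (auto simp: slit_chart_def slit_T10_def T10_def)

lemma slit_chart_apply: "snd (slit_chart A c) (p, v) = (realify (snd c p), realify (v c))"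
  by (simp add: slit_chart_def)

lemma slit_component_nonzero:
  assumes "c \<in> A" "(p, v) \<in> fst (slit_chart A c)"
  shows "v c \<noteq> 0"
  using tangent_space_eqI[OF _ tangent_space_zero, of v p c] assms
  by (auto simp: slit_chart_domain)

lemma inj_on_slit_chart:
  assumes c: "c \<in> A"
  shows "inj_on (snd (slit_chart A c)) (fst (slit_chart A c))"
proof (rule inj_onI)
  fix u u' assume uu': "u \<in> fst (slit_chart A c)" "u' \<in> fst (slit_chart A c)"
    "snd (slit_chart A c) u = snd (slit_chart A c) u'"
  obtain p v p' v' where u: "u = (p, v)" "u' = (p', v')" by fastforce
  have "p = p'" "v c = v' c"
    using uu' inj_onD[OF inj_chart[OF c], of p p'] unfolding u slit_chart_apply slit_chart_domain
    by (metis complexify_realify fst_conv, metis complexify_realify snd_conv)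
  then show "u = u'"
    using uu' tangent_space_eqI[of v p v' c] c unfolding u slit_chart_domain by blast
qed

text \<open>Surjectivity onto the fibre without its origin: the tangent vector with prescribed components in
  \<open>c\<close> is \<open>tvec_of A c p\<close>.\<close>

lemma slit_chart_image:
  assumes c: "c \<in> A" and W: "W \<subseteq> fst c"
  shows "snd (slit_chart A c) ` {u \<in> fst (slit_chart A c). fst u \<in> W}
    = {w. complexify (fst w) \<in> snd c ` W \<and> snd w \<noteq> 0}" (is "?L = ?R")
proof
  show "?L \<subseteq> ?R"
    using slit_component_nonzero[OF c] by (auto simp: slit_chart_apply realify_eq_0_iff)
  show "?R \<subseteq> ?L"
  proof
    fix w assume w: "w \<in> ?R"
    then obtain p where p: "p \<in> W" "complexify (fst w) = snd c p" by auto
    have pc: "p \<in> fst c" using p W by blast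
    define v where "v = tvec_of A c p (complexify (snd w))"
    have v: "v \<in> tangent_space A p" "v c = complexify (snd w)"
      unfolding v_def using tvec_of_in_tangent_space[OF c pc] tvec_of_self[OF c pc] by blast+
    have "v \<noteq> 0" using v(2) w by (auto simp: complexify_eq_0_iff)
    then have "(p, v) \<in> fst (slit_chart A c)" using v pc c by (auto simp: slit_chart_domain)
    moreover have "snd (slit_chart A c) (p, v) = w"
      unfolding slit_chart_apply v(2) p(2)[symmetric] by simp
    ultimately show "w \<in> ?L" using p(1) by (metis (mono_tags, lifting) fst_conv image_eqI mem_Collect_eq)
  qed
qed

lemma slit_chart_overlap: "c \<in> A \<Longrightarrow> d \<in> A \<Longrightarrow>
    fst (slit_chart A c) \<inter> fst (slit_chart A d)
      = {u \<in> fst (slit_chart A c). fst u \<in> fst c \<inter> fst d}"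
  by (auto simp: slit_chart_domain)

lemma open_slit_image:
  assumes "open S"
  shows "open {w :: 'n tcoord. complexify (fst w) \<in> S \<and> snd w \<noteq> 0}"
proof -
  have "{w :: 'n tcoord. complexify (fst w) \<in> S \<and> snd w \<noteq> 0}
      = (\<lambda>w. complexify (fst w)) -` S \<inter> snd -` (- {0})" by auto
  moreover have "continuous_on UNIV (\<lambda>w :: 'n tcoord. complexify (fst w))"
    by (intro bounded_linear.continuous_on[OF bounded_linear_complexify] continuous_intros)
  ultimately show ?thesis
    using assms by (auto intro!: open_Int open_vimage open_vimage_snd)
qed

lemma slit_transition:
  assumes c: "c \<in> A" and d: "d \<in> A"
    and w: "complexify (fst w) \<in> snd c ` (fst c \<inter> fst d)" "snd w \<noteq> 0"
  shows "transition (slit_chart A c) (slit_chart A d) w =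
    (realify (transition c d (complexify (fst w))),
     realify (frechet_derivative (transition c d) (at (complexify (fst w))) (complexify (snd w))))"
proof -
  have "w \<in> snd (slit_chart A c) ` {u \<in> fst (slit_chart A c). fst u \<in> fst c \<inter> fst d}"
    using slit_chart_image[OF c, of "fst c \<inter> fst d"] w by blast
  then obtain p v where u: "(p, v) \<in> fst (slit_chart A c)" "p \<in> fst d"
      "w = snd (slit_chart A c) (p, v)"
    by auto
  have p: "p \<in> fst c" "v \<in> tangent_space A p" using u(1) by (auto simp: slit_chart_domain)
  have "transition (slit_chart A c) (slit_chart A d) w = snd (slit_chart A d) (p, v)"
    unfolding transition_def u(3) using u(1) inj_on_slit_chart[OF c] by simp
  also have "\<dots> = (realify (transition c d (snd c p)),
      realify (frechet_derivative (transition c d) (at (snd c p)) (v c)))"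
    unfolding slit_chart_apply transition_apply[OF c p(1)]
    using tangent_space_change[OF p(2) c d p(1) u(2)] by argo
  finally show ?thesis using u(3) by (simp add: slit_chart_apply)
qed

lemma smooth_on_slit_transition:
  assumes c: "c \<in> A" and d: "d \<in> A"
  shows "smooth_on {w. complexify (fst w) \<in> snd c ` (fst c \<inter> fst d) \<and> snd w \<noteq> 0}
    (transition (slit_chart A c) (slit_chart A d))" (is "smooth_on ?S _")
proof -
  let ?O = "snd c ` (fst c \<inter> fst d)"
  have S: "open ?S" by (rule open_slit_image[OF open_overlap[OF c d]])
  have bl: "bounded_linear (\<lambda>w :: 'n tcoord. complexify (fst w))"
    "bounded_linear (\<lambda>w :: 'n tcoord. complexify (snd w))"
    using bounded_linear_compose[OF bounded_linear_complexify bounded_linear_fst]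
      bounded_linear_compose[OF bounded_linear_complexify bounded_linear_snd] by auto
  have base: "smooth_on ?S (\<lambda>w. f (complexify (fst w)))" if "smooth_on ?O f"
    for f :: "complex^'n \<Rightarrow> complex^'n"
    by (rule smooth_on_compose[OF S open_overlap[OF c d] _ smooth_on_bounded_linear[OF S bl(1)] that])
      auto
  \<comment> \<open>The differential is applied to the varying vector \<open>snd w\<close>; in a basis it is a sum of products.\<close>
  have "smooth_on ?S (\<lambda>w. \<Sum>b\<in>Basis. (complexify (snd w) \<bullet> b) *\<^sub>R
      frechet_derivative (transition c d) (at (complexify (fst w))) b)"
  proof (intro smooth_on_sum[OF S] smooth_on_bilinear[OF S bounded_bilinear_scaleR])
    fix b
    show "smooth_on ?S (\<lambda>w. complexify (snd w) \<bullet> b)"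
      by (rule smooth_on_bounded_linear_comp[OF S bounded_linear_inner_left
            smooth_on_bounded_linear[OF S bl(2)]])
    show "smooth_on ?S (\<lambda>w. frechet_derivative (transition c d) (at (complexify (fst w))) b)"
      using base[OF smooth_on_frechet_derivative[OF smooth_transition[OF c d]]] .
  qed
  then have fib: "smooth_on ?S (\<lambda>w. frechet_derivative (transition c d) (at (complexify (fst w)))
      (complexify (snd w)))"
  proof (rule smooth_on_cong_imp[OF S, rotated])
    fix w assume "w \<in> ?S"
    then show "(\<Sum>b\<in>Basis. (complexify (snd w) \<bullet> b) *\<^sub>R
        frechet_derivative (transition c d) (at (complexify (fst w))) b)
      = frechet_derivative (transition c d) (at (complexify (fst w))) (complexify (snd w))"
      using linear_eq_sum_Basis[OF transition_linear[OF c d]] by auto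
  qed
  have b1: "bounded_linear (\<lambda>z. (realify z, 0 :: 'n rvec))"
    and b2: "bounded_linear (\<lambda>z. (0 :: 'n rvec, realify z))"
    by (auto intro!: bounded_linear_Pair bounded_linear_realify bounded_linear_zero)
  have "smooth_on ?S (\<lambda>w. (realify (transition c d (complexify (fst w))), 0) +
      (0, realify (frechet_derivative (transition c d) (at (complexify (fst w))) (complexify (snd w)))))"
    by (intro smooth_on_add[OF S] smooth_on_bounded_linear_comp[OF S b1]
        smooth_on_bounded_linear_comp[OF S b2] base smooth_transition[OF c d] fib)
  then show ?thesis
    by (rule smooth_on_cong_imp[OF S, rotated]) (auto simp: slit_transition[OF c d])
qed

sublocale slit: smooth_atlas "slit_atlas A"
proof
  fix b assume "b \<in> slit_atlas A"
  then show "inj_on (snd b) (fst b)" using inj_on_slit_chart by (auto simp: slit_atlas_def)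
next
  fix b b' assume "b \<in> slit_atlas A" "b' \<in> slit_atlas A"
  then obtain c d where cd: "c \<in> A" "d \<in> A" "b = slit_chart A c" "b' = slit_chart A d"
    unfolding slit_atlas_def by blast
  have im: "snd b ` (fst b \<inter> fst b') = {w. complexify (fst w) \<in> snd c ` (fst c \<inter> fst d) \<and> snd w \<noteq> 0}"
    unfolding cd(3,4) slit_chart_overlap[OF cd(1,2)] by (rule slit_chart_image[OF cd(1)]) simp
  show "open (snd b ` (fst b \<inter> fst b'))"
    unfolding im by (rule open_slit_image[OF open_overlap[OF cd(1,2)]])
  show "smooth_on (snd b ` (fst b \<inter> fst b')) (transition b b')"
    unfolding im unfolding cd(3,4) by (rule smooth_on_slit_transition[OF cd(1,2)])
qed

lemma slit_chart_in: "c \<in> A \<Longrightarrow> slit_chart A c \<in> slit_atlas A"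
  by (simp add: slit_atlas_def)

text \<open>For a fixed base point the coordinate change is linear in the fibre coordinate, hence equal to its own
  vertical derivative.\<close>

lemma slit_transition_vertical:
  assumes c: "c \<in> A" and d: "d \<in> A" and u: "u \<in> fst (slit_chart A c)" "u \<in> fst (slit_chart A d)"
  shows "frechet_derivative (transition (slit_chart A c) (slit_chart A d)) (at (snd (slit_chart A c) u)) (0, \<eta>)
    = (0, realify (frechet_derivative (transition c d) (at (snd c (fst u))) (complexify \<eta>)))"
proof -
  obtain p v where pv: "u = (p, v)" by fastforce
  have p: "p \<in> fst c" "p \<in> fst d" using u by (auto simp: pv slit_chart_domain)
  let ?D = "frechet_derivative (transition c d) (at (snd c p))"
  let ?T = "transition (slit_chart A c) (slit_chart A d)"
  let ?w = "snd (slit_chart A c) u"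
  have w: "fst ?w = realify (snd c p)" "snd ?w \<noteq> 0"
    using slit_component_nonzero[OF c u(1)[unfolded pv]]
    by (auto simp: pv slit_chart_apply realify_eq_0_iff)
  have lin: "bounded_linear ?D"
    using transition_derivative[OF c d p] has_derivative_bounded_linear by blast
  have bl: "bounded_linear (\<lambda>\<eta>. realify (?D (complexify \<eta>)))"
    using bounded_linear_compose[OF bounded_linear_realify
        bounded_linear_compose[OF lin bounded_linear_complexify]] .
  have "((\<lambda>y. (fst ?w, y)) has_derivative (\<lambda>\<eta>. (0, \<eta>))) (at (snd ?w))"
    by (auto intro!: derivative_eq_intros)
  then have "((?T \<circ> (\<lambda>y. (fst ?w, y))) has_derivative
      (frechet_derivative ?T (at ?w) \<circ> (\<lambda>\<eta>. (0, \<eta>)))) (at (snd ?w))"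
    by (rule diff_chain_at)
      (use slit.transition_derivative[OF slit_chart_in[OF c] slit_chart_in[OF d] u] in simp)
  \<comment> \<open>The formula for the coordinate change holds off the zero section only.\<close>
  then have "((\<lambda>y. (realify (transition c d (snd c p)), realify (?D (complexify y)))) has_derivative
      (frechet_derivative ?T (at ?w) \<circ> (\<lambda>\<eta>. (0, \<eta>)))) (at (snd ?w))"
    by (rule has_derivative_transform_within_open[where s = "- {0}"])
      (use w p in \<open>auto simp: slit_transition[OF c d]\<close>)
  moreover have "((\<lambda>y. (realify (transition c d (snd c p)), realify (?D (complexify y)))) has_derivative
      (\<lambda>\<eta>. (0, realify (?D (complexify \<eta>))))) (at (snd ?w))"
    by (intro has_derivative_Pair has_derivative_const bounded_linear_imp_has_derivative[OF bl])
  ultimately have "frechet_derivative ?T (at ?w) \<circ> (\<lambda>\<eta>. (0, \<eta>)) =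
      (\<lambda>\<eta>. (0, realify (?D (complexify \<eta>))))"
    using has_derivative_unique by blast
  from fun_cong[OF this, of \<eta>] show ?thesis by (simp add: pv)
qed

text \<open>Coordinate changes preserve verticality, so one chart suffices to test it.\<close>

lemma VR_iff:
  assumes c: "c \<in> A" and u: "u \<in> fst (slit_chart A c)"
  shows "X \<in> VR A u \<longleftrightarrow> X \<in> tangent_space (slit_atlas A) u \<and> fst (X (slit_chart A c)) = 0"
proof -
  have "fst (X (slit_chart A d)) = 0"
    if X: "X \<in> tangent_space (slit_atlas A) u" "fst (X (slit_chart A c)) = 0"
      and d: "d \<in> A" "u \<in> fst (slit_chart A d)" for d
  proof -
    obtain \<eta> where "X (slit_chart A c) = (0, \<eta>)" using X(2) by (metis prod.collapse)
    then show ?thesis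
      using slit.tangent_space_change[OF X(1) slit_chart_in[OF c] slit_chart_in[OF d(1)] u d(2)]
        slit_transition_vertical[OF c d(1) u d(2)] by simp
  qed
  then show ?thesis
    unfolding VR_def span_vertical slit_atlas_def using c u by auto
qed

lemma VR_subset: "X \<in> VR A u \<Longrightarrow> X \<in> tangent_space (slit_atlas A) u"
  by (simp add: VR_def)

text \<open>Coordinate changes act on vertical vectors through holomorphic differentials of the base, and these
  commute with \<open>J\<close>.\<close>

lemma JJ_VR:
  assumes X: "X \<in> VR A u" and c: "c \<in> A" "u \<in> fst (slit_chart A c)"
  shows "JJ X \<in> VR A u"
proof -
  have XT: "X \<in> tangent_space (slit_atlas A) u" using X by (rule VR_subset)
  have J0: "Jvec 0 = 0" by (rule linear_0[OF linear_Jvec])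
  have "JJ X \<in> tangent_space (slit_atlas A) u"
  proof (rule slit.tangent_spaceI)
    fix b b' assume bb': "b \<in> slit_atlas A" "b' \<in> slit_atlas A" "u \<in> fst b" "u \<in> fst b'"
    then obtain d e where de: "d \<in> A" "e \<in> A" "b = slit_chart A d" "b' = slit_chart A e"
      unfolding slit_atlas_def by blast
    have ud: "u \<in> fst (slit_chart A d)" "u \<in> fst (slit_chart A e)" using bb' de by auto
    have p: "fst u \<in> fst d" "fst u \<in> fst e" using ud slit_chart_domain by (metis prod.collapse)+
    obtain \<eta> where \<eta>: "X b = (0, \<eta>)"
      using X VR_iff[OF de(1) ud(1)] unfolding de(3) by (metis prod.collapse)
    have "X b' = (0, realify (frechet_derivative (transition d e) (at (snd d (fst u))) (complexify \<eta>)))"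
      using slit.tangent_space_change[OF XT bb'] unfolding \<eta>
      unfolding de(3,4) slit_transition_vertical[OF de(1,2) ud] .
    then show "JJ X b' = frechet_derivative (transition b b') (at (snd b u)) (JJ X b)"
      unfolding JJ_def \<eta> fst_conv snd_conv J0
      unfolding de(3,4) slit_transition_vertical[OF de(1,2) ud] complexify_Jvec
        transition_holomorphic[OF de(1,2) p]
      by (simp add: realify_times_ii J0)
  next
    fix b assume "\<not> (b \<in> slit_atlas A \<and> u \<in> fst b)"
    then show "JJ X b = 0"
      using slit.tangent_space_outside[OF XT] by (simp add: JJ_def J0 zero_prod_def)
  qed
  then show ?thesis
    using X VR_iff[OF c] by (simp add: JJ_def J0)
qed

lemma sum_dv_vec_nth:
  fixes w :: "complex^'n"
  shows "(\<Sum>\<beta>\<in>UNIV. w $ \<beta> *s dv_vec \<beta>) $ Inl \<alpha> = w $ \<alpha> / 2"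
    and "(\<Sum>\<beta>\<in>UNIV. w $ \<beta> *s dv_vec \<beta>) $ Inr \<alpha> = - \<i> * w $ \<alpha> / 2"
  by (simp_all add: dv_vec_def if_distrib[of "\<lambda>x. _ * x"] cong: if_cong)

text \<open>\<open>\<Sum>\<^sub>\<beta> w\<^sub>\<beta> \<partial>/\<partial>v\<^sup>\<beta>\<close> has real part \<open>\<xi>\<close> with \<open>w = 2 \<xi>\<close> in complex coordinates, and imaginary part
  \<open>- J \<xi>\<close>.\<close>

lemma ccomp_V10_iff:
  fixes b :: "(('a, 'n) tpoint, 'n tcoord) chart"
  shows "(\<exists>w :: complex^'n. ccomp V b = (0, \<Sum>\<beta>\<in>UNIV. w $ \<beta> *s dv_vec \<beta>)) \<longleftrightarrow>
    fst (fst V b) = 0 \<and> fst (snd V b) = 0 \<and> snd (snd V b) = - Jvec (snd (fst V b))"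
proof
  assume "\<exists>w :: complex^'n. ccomp V b = (0, \<Sum>\<beta>\<in>UNIV. w $ \<beta> *s dv_vec \<beta>)"
  then obtain w :: "complex^'n" where w: "ccomp V b = (0, \<Sum>\<beta>\<in>UNIV. w $ \<beta> *s dv_vec \<beta>)" by blast
  have h: "Complex (fst (fst V b) $ k) (fst (snd V b) $ k) = 0" for k
    using arg_cong[OF w, of "\<lambda>e. fst e $ k"] by (simp add: ccomp_def)
  have l: "Complex (snd (fst V b) $ Inl \<alpha>) (snd (snd V b) $ Inl \<alpha>) = w $ \<alpha> / 2" for \<alpha>
    using arg_cong[OF w, of "\<lambda>e. snd e $ Inl \<alpha>"] by (simp add: ccomp_def sum_dv_vec_nth del: sum_component)
  have r: "Complex (snd (fst V b) $ Inr \<alpha>) (snd (snd V b) $ Inr \<alpha>) = - \<i> * (w $ \<alpha> / 2)" for \<alpha>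
    using arg_cong[OF w, of "\<lambda>e. snd e $ Inr \<alpha>"] by (simp add: ccomp_def sum_dv_vec_nth del: sum_component)
  show "fst (fst V b) = 0 \<and> fst (snd V b) = 0 \<and> snd (snd V b) = - Jvec (snd (fst V b))"
    using h r unfolding l[symmetric]
    by (simp add: vec_eq_iff all_sum_index Jvec_def complex_eq_iff)
next
  assume V: "fst (fst V b) = 0 \<and> fst (snd V b) = 0 \<and> snd (snd V b) = - Jvec (snd (fst V b))"
  have "ccomp V b = (0, \<Sum>\<beta>\<in>UNIV. (2 *s complexify (snd (fst V b))) $ \<beta> *s dv_vec \<beta>)"
    unfolding ccomp_def prod_eq_iff vec_eq_iff all_sum_index fst_conv snd_conv sum_dv_vec_nth
    using V by (simp add: complexify_def Jvec_def complex_eq_iff)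
  then show "\<exists>w :: complex^'n. ccomp V b = (0, \<Sum>\<beta>\<in>UNIV. w $ \<beta> *s dv_vec \<beta>)" by blast
qed

text \<open>Both conditions on the right are independent of the chart, by \<open>VR_iff\<close> and \<open>JJ_VR\<close>, so the
  component form above needs to be inspected in one chart only.\<close>

lemma V10_iff:
  assumes c: "c \<in> A" and u: "u \<in> fst (slit_chart A c)"
  shows "V \<in> V10 A u \<longleftrightarrow> fst V \<in> VR A u \<and> snd V = - JJ (fst V)"
proof
  assume V: "V \<in> V10 A u"
  then have T: "fst V \<in> tangent_space (slit_atlas A) u" "snd V \<in> tangent_space (slit_atlas A) u"
    by (auto simp: V10_def ctangent_space_def)
  have comp: "fst (fst V (slit_chart A c)) = 0" "fst (snd V (slit_chart A c)) = 0"
    "snd (snd V (slit_chart A c)) = - Jvec (snd (fst V (slit_chart A c)))"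
    using V slit_chart_in[OF c] u unfolding V10_def ccomp_V10_iff by blast+
  have Y: "fst V \<in> VR A u" using T comp VR_iff[OF c u] by blast
  have "JJ (fst V) \<in> tangent_space (slit_atlas A) u" using VR_subset[OF JJ_VR[OF Y c u]] .
  then have J: "- JJ (fst V) \<in> tangent_space (slit_atlas A) u"
    using slit.tangent_space_scale[of "JJ (fst V)" u "-1"]
    by (simp add: scale_tvec_def fun_Compl_def)
  have "snd V (slit_chart A c) = (- JJ (fst V)) (slit_chart A c)"
    using comp by (simp add: JJ_def prod_eq_iff linear_0[OF linear_Jvec])
  then have "snd V = - JJ (fst V)"
    using slit.tangent_space_eqI[OF T(2) J slit_chart_in[OF c] u] by blast
  with Y show "fst V \<in> VR A u \<and> snd V = - JJ (fst V)" by blast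
next
  assume V: "fst V \<in> VR A u \<and> snd V = - JJ (fst V)"
  have "JJ (fst V) \<in> tangent_space (slit_atlas A) u" using VR_subset[OF JJ_VR[OF _ c u]] V by blast
  then have J: "- JJ (fst V) \<in> tangent_space (slit_atlas A) u"
    using slit.tangent_space_scale[of "JJ (fst V)" u "-1"]
    by (simp add: scale_tvec_def fun_Compl_def)
  have "\<exists>w :: complex^'n. ccomp V b = (0, \<Sum>\<beta>\<in>UNIV. w $ \<beta> *s dv_vec \<beta>)"
    if b: "b \<in> slit_atlas A" "u \<in> fst b" for b
  proof -
    have "fst V b \<in> span (range (\<lambda>j. (0, axis j 1)))" using V b unfolding VR_def by blast
    then have "fst (fst V b) = 0" using span_vertical by blast
    then show ?thesis
      unfolding ccomp_V10_iff using V by (simp add: JJ_def linear_0[OF linear_Jvec])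
  qed
  then show "V \<in> V10 A u"
    unfolding V10_def ctangent_space_def using V VR_subset J by (auto simp: mem_Times_iff)
qed

end


lemma complex_manifold_complex_atlas:
  assumes "complex_manifold M A"
  shows "complex_atlas A"
proof -
  interpret smooth_atlas A by (rule complex_manifold_smooth_atlas[OF assms])
  show ?thesis
  proof
    fix c d p and v :: "complex^'b"
    assume "c \<in> A" "d \<in> A" "p \<in> fst c" "p \<in> fst d"
    moreover from this have "holomorphic_map_on (snd c ` (fst c \<inter> fst d)) (transition c d)"
      using assms unfolding complex_manifold_def by blast
    ultimately show "frechet_derivative (transition c d) (at (snd c p)) (\<i> *s v)
        = \<i> *s frechet_derivative (transition c d) (at (snd c p)) v"
      unfolding holomorphic_map_on_def by blast
  qed
qed


section \<open>Derivatives along the fibres\<close>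

definition vderiv :: "'n rvec \<Rightarrow> ('n::finite tcoord \<Rightarrow> 'b::real_normed_vector) \<Rightarrow> 'n tcoord \<Rightarrow> 'b" where
  "vderiv \<eta> f w = frechet_derivative f (at w) (0, \<eta>)"

lemma dy_eq_vderiv: "dy j = vderiv (axis j 1)"
  by (intro ext) (simp add: dy_def vderiv_def)

lemma smooth_on_vderiv: "smooth_on S f \<Longrightarrow> smooth_on S (vderiv \<eta> f)"
  unfolding vderiv_def[abs_def] by (rule smooth_on_frechet_derivative)

lemma frechet_derivative_cong_on:
  assumes "open S" "w \<in> S" "smooth_on S f" "\<And>w. w \<in> S \<Longrightarrow> f w = g w"
  shows "frechet_derivative f (at w) = frechet_derivative g (at w)"
  using has_derivative_transform_within_open[OF smooth_on_has_derivative[OF assms(3,2)] assms(1,2,4)]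
  by (rule frechet_derivative_at)

lemma linear_vderiv:
  assumes "smooth_on S f" "w \<in> S"
  shows "linear (\<lambda>\<eta>. vderiv \<eta> f w)"
proof -
  have lin: "linear (frechet_derivative f (at w))"
    using has_derivative_linear[OF smooth_on_has_derivative[OF assms]] .
  show ?thesis
    by (rule linearI)
      (simp_all add: vderiv_def linear_add[OF lin, symmetric] linear_cmul[OF lin, symmetric])
qed

lemma vderiv_commute:
  fixes f :: "'n::finite tcoord \<Rightarrow> real"
  assumes "smooth_on S f" "open S" "w \<in> S"
  shows "vderiv \<eta> (vderiv \<zeta> f) w = vderiv \<zeta> (vderiv \<eta> f) w"
  unfolding vderiv_def[abs_def] by (rule mixed_derivatives_commute[OF assms])

text \<open>A product rule: \<open>P\<close> is evaluated on the vector \<open>M y\<close>, which itself varies along the fibre.  In the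
  last term this vector is frozen at \<open>w\<close>.\<close>

lemma vderiv_along_radial_field:
  fixes P :: "'n::finite rvec \<Rightarrow> 'n tcoord \<Rightarrow> real"
  assumes S: "open S" "w \<in> S" and P: "\<And>\<zeta>. smooth_on S (P \<zeta>)"
    and lin: "\<And>w. w \<in> S \<Longrightarrow> linear (\<lambda>\<zeta>. P \<zeta> w)" and M: "linear M"
  shows "vderiv \<eta> (\<lambda>w. P (M (snd w)) w) w = P (M \<eta>) w + vderiv \<eta> (P (M (snd w))) w"
proof -
  have expand: "P \<zeta> w = (\<Sum>b\<in>Basis. (\<zeta> \<bullet> b) * P b w)" if "w \<in> S" for \<zeta> w
    unfolding real_scaleR_def[symmetric] by (rule linear_eq_sum_Basis[OF lin[OF that]])
  have D: "(P b has_derivative frechet_derivative (P b) (at w)) (at w)" for b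
    by (rule smooth_on_has_derivative[OF P S(2)])
  have M': "bounded_linear (\<lambda>w :: 'n tcoord. M (snd w))"
    using bounded_linear_compose[OF iffD1[OF linear_conv_bounded_linear M] bounded_linear_snd] .
  have DM: "((\<lambda>w. M (snd w) \<bullet> b) has_derivative (\<lambda>e. M (snd e) \<bullet> b)) (at w)" for b
    using bounded_linear_imp_has_derivative[OF bounded_linear_compose[OF bounded_linear_inner_left M']] .
  have "((\<lambda>w. \<Sum>b\<in>Basis. (M (snd w) \<bullet> b) * P b w) has_derivative
      (\<lambda>e. \<Sum>b\<in>Basis. (M (snd w) \<bullet> b) * frechet_derivative (P b) (at w) e
        + (M (snd e) \<bullet> b) * P b w)) (at w)"
    by (intro has_derivative_sum has_derivative_mult DM D)
  then have "((\<lambda>w. P (M (snd w)) w) has_derivative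
      (\<lambda>e. \<Sum>b\<in>Basis. (M (snd w) \<bullet> b) * frechet_derivative (P b) (at w) e
        + (M (snd e) \<bullet> b) * P b w)) (at w)"
    by (rule has_derivative_transform_within_open[OF _ S]) (simp add: expand[symmetric])
  then have 1: "vderiv \<eta> (\<lambda>w. P (M (snd w)) w) w =
      (\<Sum>b\<in>Basis. (M (snd w) \<bullet> b) * vderiv \<eta> (P b) w + (M \<eta> \<bullet> b) * P b w)"
    unfolding vderiv_def by (simp add: frechet_derivative_at[symmetric])
  have "((\<lambda>w'. \<Sum>b\<in>Basis. (M (snd w) \<bullet> b) * P b w') has_derivative
      (\<lambda>e. \<Sum>b\<in>Basis. (M (snd w) \<bullet> b) * frechet_derivative (P b) (at w) e)) (at w)"
    by (intro has_derivative_sum has_derivative_mult_right D)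
  then have "(P (M (snd w)) has_derivative
      (\<lambda>e. \<Sum>b\<in>Basis. (M (snd w) \<bullet> b) * frechet_derivative (P b) (at w) e)) (at w)"
    by (rule has_derivative_transform_within_open[OF _ S]) (simp add: expand[symmetric])
  then have 2: "vderiv \<eta> (P (M (snd w))) w = (\<Sum>b\<in>Basis. (M (snd w) \<bullet> b) * vderiv \<eta> (P b) w)"
    unfolding vderiv_def by (simp add: frechet_derivative_at[symmetric])
  show ?thesis
    unfolding 1 2 expand[OF S(2), of "M \<eta>"] by (simp add: sum.distrib)
qed


lemma frechet_derivative_Complex:
  assumes "open S" "w \<in> S" "smooth_on S a" "smooth_on S b" "\<And>w. w \<in> S \<Longrightarrow> f w = Complex (a w) (b w)"
  shows "frechet_derivative f (at w) e = Complex (frechet_derivative a (at w) e) (frechet_derivative b (at w) e)"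
proof -
  have "((\<lambda>w. complex_of_real (a w) + \<i> * complex_of_real (b w)) has_derivative
      (\<lambda>e. complex_of_real (frechet_derivative a (at w) e) + \<i> * complex_of_real (frechet_derivative b (at w) e))) (at w)"
    by (rule has_derivative_add[OF has_derivative_of_real has_derivative_mult_right[OF has_derivative_of_real]])
      (rule smooth_on_has_derivative[OF assms(3,2)], rule smooth_on_has_derivative[OF assms(4,2)])
  then have "(f has_derivative
      (\<lambda>e. complex_of_real (frechet_derivative a (at w) e) + \<i> * complex_of_real (frechet_derivative b (at w) e))) (at w)"
    by (rule has_derivative_transform_within_open[OF _ assms(1,2)]) (simp add: assms(5) Complex_eq)
  from fun_cong[OF frechet_derivative_at[OF this], of e] show ?thesis by (simp add: Complex_eq)
qed


section \<open>Finsler metrics in coordinates\<close>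

lemma matrix_inv_right:
  fixes A :: "'a::semiring_1^'n^'n"
  assumes "invertible A"
  shows "A ** matrix_inv A = mat 1"
  using someI_ex[of "\<lambda>B. A ** B = mat 1 \<and> B ** A = mat 1"] assms
  unfolding invertible_def matrix_inv_def by blast

lemma linear_eq_0_on_axes:
  fixes f :: "real^'m::finite \<Rightarrow> real"
  assumes "linear f" "\<And>j. f (axis j 1) = 0"
  shows "f x = 0"
proof -
  have "f x = f (\<Sum>j\<in>UNIV. x $ j *\<^sub>R axis j 1)"
    using basis_expansion[of x] by (simp add: scalar_mult_eq_scaleR)
  also have "\<dots> = 0" by (simp add: linear_sum[OF assms(1)] linear_cmul[OF assms(1)] assms(2))
  finally show ?thesis .
qed

text \<open>\<open>L\<close> stands for \<open>F\<^sup>2\<close> in a chart \<open>(x; y)\<close> and \<open>S\<close> for the range of that chart.\<close>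

locale local_Finsler =
  fixes L :: "'n::finite tcoord \<Rightarrow> real" and S :: "'n tcoord set"
  assumes open_S: "open S" and smooth_L: "smooth_on S L"
    and positive: "w \<in> S \<Longrightarrow> \<xi> \<noteq> 0 \<Longrightarrow>
      (\<Sum>j\<in>UNIV. \<Sum>k\<in>UNIV. g_fund L j k w * \<xi> $ j * \<xi> $ k) > 0"
    and homogeneous: "w \<in> S \<Longrightarrow> a \<noteq> 0 \<Longrightarrow>
      L (fst w, realify (a *s complexify (snd w))) = (cmod a)\<^sup>2 * L w"
begin

text \<open>\<open>hess\<close> is twice the fundamental tensor, as a bilinear form on the fibre; \<open>third\<close> is four times the
  Cartan tensor.\<close>

definition hess :: "'n rvec \<Rightarrow> 'n rvec \<Rightarrow> 'n tcoord \<Rightarrow> real" where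
  "hess \<eta> \<zeta> = vderiv \<eta> (vderiv \<zeta> L)"

definition third :: "'n rvec \<Rightarrow> 'n rvec \<Rightarrow> 'n rvec \<Rightarrow> 'n tcoord \<Rightarrow> real" where
  "third \<theta> \<eta> \<zeta> = vderiv \<theta> (hess \<eta> \<zeta>)"

lemma g_fund_eq: "g_fund L j k = (\<lambda>w. hess (axis j 1) (axis k 1) w / 2)"
  by (intro ext) (simp add: g_fund_def hess_def dy_eq_vderiv)

lemma smooth_hess: "smooth_on S (hess \<eta> \<zeta>)"
  unfolding hess_def by (intro smooth_on_vderiv smooth_L)

lemma smooth_g_fund: "smooth_on S (g_fund L j k)"
  unfolding g_fund_eq
  using smooth_on_bounded_linear_comp[OF open_S bounded_linear_divide smooth_hess] .

lemma hess_sym: "w \<in> S \<Longrightarrow> hess \<eta> \<zeta> w = hess \<zeta> \<eta> w"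
  unfolding hess_def by (rule vderiv_commute[OF smooth_L open_S])

lemma linear_hess: "w \<in> S \<Longrightarrow> linear (\<lambda>\<eta>. hess \<eta> \<zeta> w)"
  unfolding hess_def by (rule linear_vderiv[OF smooth_on_vderiv[OF smooth_L]])

lemma linear_hess2: "w \<in> S \<Longrightarrow> linear (\<lambda>\<zeta>. hess \<eta> \<zeta> w)"
  using linear_hess[of w \<eta>] hess_sym by (metis (no_types, lifting) ext)

lemma third_sym12: "w \<in> S \<Longrightarrow> third \<theta> \<eta> \<zeta> w = third \<eta> \<theta> \<zeta> w"
  unfolding third_def hess_def by (rule vderiv_commute[OF smooth_on_vderiv[OF smooth_L] open_S])

lemma third_sym23: "w \<in> S \<Longrightarrow> third \<theta> \<eta> \<zeta> w = third \<theta> \<zeta> \<eta> w"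
  unfolding third_def vderiv_def
  by (subst frechet_derivative_cong_on[OF open_S _ smooth_hess hess_sym]) auto

lemma linear_third: "w \<in> S \<Longrightarrow> linear (\<lambda>\<theta>. third \<theta> \<eta> \<zeta> w)"
  unfolding third_def by (rule linear_vderiv[OF smooth_hess])

lemma hess_eq_0D:
  assumes w: "w \<in> S" and "hess \<xi> \<xi> w = 0"
  shows "\<xi> = 0"
proof (rule ccontr)
  assume "\<xi> \<noteq> 0"
  have \<xi>: "\<xi> = (\<Sum>j\<in>UNIV. \<xi> $ j *\<^sub>R axis j 1)"
    using basis_expansion[of \<xi>] by (simp add: scalar_mult_eq_scaleR)
  have "hess \<xi> \<xi> w = (\<Sum>j\<in>UNIV. \<xi> $ j * hess (axis j 1) \<xi> w)"
    by (subst (1) \<xi>) (simp only: linear_sum[OF linear_hess[OF w]] linear_cmul[OF linear_hess[OF w]] real_scaleR_def)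
  also have "\<dots> = (\<Sum>j\<in>UNIV. \<xi> $ j * (\<Sum>k\<in>UNIV. \<xi> $ k * hess (axis j 1) (axis k 1) w))"
  proof (intro sum.cong refl arg_cong[where f = "\<lambda>t. _ * t"])
    fix j
    show "hess (axis j 1) \<xi> w = (\<Sum>k\<in>UNIV. \<xi> $ k * hess (axis j 1) (axis k 1) w)"
      by (subst (1) \<xi>) (simp only: linear_sum[OF linear_hess2[OF w]] linear_cmul[OF linear_hess2[OF w]] real_scaleR_def)
  qed
  also have "\<dots> = 2 * (\<Sum>j\<in>UNIV. \<Sum>k\<in>UNIV. g_fund L j k w * \<xi> $ j * \<xi> $ k)"
    by (simp add: g_fund_eq sum_distrib_left mult_ac)
  finally show False using positive[OF w \<open>\<xi> \<noteq> 0\<close>] assms(2) by simp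
qed

text \<open>Euler's relation for the action of the complex scalars, obtained by differentiating
  \<open>L (y + t c y) = \<bar>1 + t c\<bar>\<^sup>2 L y\<close> at \<open>t = 0\<close>.  The case \<open>c = 1\<close> expresses homogeneity and
  the case \<open>c = \<i>\<close> the invariance under the circle action.\<close>

lemma Euler_relation:
  assumes w: "w \<in> S"
  shows "vderiv (realify (c *s complexify (snd w))) L w = 2 * Re c * L w"
proof -
  define v where "v = (0 :: 'n rvec, realify (c *s complexify (snd w)))"
  have "((\<lambda>t. w + t *\<^sub>R v) has_derivative (\<lambda>h. h *\<^sub>R v)) (at 0)"
    by (auto intro!: derivative_eq_intros)
  then have "((L \<circ> (\<lambda>t. w + t *\<^sub>R v)) has_derivative
      (frechet_derivative L (at w) \<circ> (\<lambda>h. h *\<^sub>R v))) (at 0)"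
    by (rule diff_chain_at) (use smooth_on_has_derivative[OF smooth_L w] in simp)
  moreover have "linear (frechet_derivative L (at w))"
    using has_derivative_linear[OF smooth_on_has_derivative[OF smooth_L w]] .
  ultimately have "((\<lambda>t. L (w + t *\<^sub>R v)) has_field_derivative frechet_derivative L (at w) v) (at 0)"
    by (simp add: has_field_derivative_def o_def linear_cmul mult_commute_abs)
  moreover have "((\<lambda>t. ((1 + t * Re c)\<^sup>2 + (t * Im c)\<^sup>2) * L w) has_field_derivative 2 * Re c * L w) (at 0)"
    by (auto intro!: derivative_eq_intros)
  then have "((\<lambda>t. L (w + t *\<^sub>R v)) has_field_derivative 2 * Re c * L w) (at 0)"
  proof (rule has_field_derivative_transform_within_open)
    \<comment> \<open>Homogeneity is available for nonzero scalars, that is for \<open>t\<close> near \<open>0\<close>.\<close>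
    show "open {t. 1 + complex_of_real t * c \<noteq> 0}"
      by (intro open_Collect_neq continuous_intros)
    fix t assume t: "t \<in> {t. 1 + complex_of_real t * c \<noteq> 0}"
    have "w + t *\<^sub>R v = (fst w, realify ((1 + complex_of_real t * c) *s complexify (snd w)))"
      by (simp add: v_def prod_eq_iff realify_def complexify_def vec_eq_iff all_sum_index algebra_simps)
    moreover have "(cmod (1 + complex_of_real t * c))\<^sup>2 = (1 + t * Re c)\<^sup>2 + (t * Im c)\<^sup>2"
      by (simp add: cmod_power2)
    ultimately show "((1 + t * Re c)\<^sup>2 + (t * Im c)\<^sup>2) * L w = L (w + t *\<^sub>R v)"
      using homogeneous[OF w, of "1 + complex_of_real t * c"] t
      by (simp only: mem_Collect_eq simp_thms)
  qed simp
  ultimately show ?thesis unfolding vderiv_def v_def[symmetric] by (rule DERIV_unique)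
qed

text \<open>Euler's relation reads \<open>dL(M y) = 2 Re c L\<close> with \<open>M\<close> linear.  Each derivative along the fibre hits
  either \<open>dL\<close> or the argument \<open>M y\<close>.\<close>

lemma Euler_relation_third:
  fixes c :: complex
  defines "M \<equiv> \<lambda>\<eta> :: 'n rvec. realify (c *s complexify \<eta>)"
  assumes w: "w \<in> S"
  shows "hess \<zeta> (M \<eta>) w + hess \<eta> (M \<zeta>) w + third \<zeta> \<eta> (M (snd w)) w = 2 * Re c * hess \<zeta> \<eta> w"
proof -
  have M: "linear M"
    by (rule linearI) (simp_all add: M_def realify_def complexify_def vec_eq_iff all_sum_index algebra_simps)
  have const: "vderiv \<zeta> (\<lambda>w. 2 * Re c * f w) w = 2 * Re c * vderiv \<zeta> f w"
    if "smooth_on S f" "w \<in> S" for f \<zeta> w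
  proof -
    have "((\<lambda>w. 2 * Re c * f w) has_derivative (\<lambda>e. 2 * Re c * frechet_derivative f (at w) e)) (at w)"
      by (intro has_derivative_mult_right smooth_on_has_derivative[OF that])
    from fun_cong[OF frechet_derivative_at[OF this]] show ?thesis unfolding vderiv_def by metis
  qed
  have first: "vderiv (M \<eta>) L w + hess \<eta> (M (snd w)) w = 2 * Re c * vderiv \<eta> L w"
    if w: "w \<in> S" for w
  proof -
    have "vderiv \<eta> (\<lambda>w. 2 * Re c * L w) w = vderiv \<eta> (\<lambda>w. vderiv (M (snd w)) L w) w"
      unfolding vderiv_def[of \<eta>]
      by (rule fun_cong[OF frechet_derivative_cong_on[OF open_S w]])
        (auto simp: Euler_relation M_def intro!: smooth_on_bounded_linear_comp[OF open_S _ smooth_L] bounded_linear_mult_right)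
    also have "\<dots> = vderiv (M \<eta>) L w + vderiv \<eta> (vderiv (M (snd w)) L) w"
      by (rule vderiv_along_radial_field[OF open_S w smooth_on_vderiv[OF smooth_L] linear_vderiv[OF smooth_L] M])
    finally show ?thesis using const[OF smooth_L w] by (simp add: hess_def)
  qed
  have "vderiv \<zeta> (\<lambda>w. 2 * Re c * vderiv \<eta> L w + - vderiv (M \<eta>) L w) w
      = vderiv \<zeta> (\<lambda>w. hess \<eta> (M (snd w)) w) w"
    unfolding vderiv_def[of \<zeta>]
  proof (rule fun_cong[OF frechet_derivative_cong_on[OF open_S w]])
    show "smooth_on S (\<lambda>w. 2 * Re c * vderiv \<eta> L w + - vderiv (M \<eta>) L w)"
      by (intro smooth_on_add[OF open_S]
          smooth_on_bounded_linear_comp[OF open_S bounded_linear_mult_right]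
          smooth_on_bounded_linear_comp[OF open_S bounded_linear_minus[OF bounded_linear_ident]]
          smooth_on_vderiv smooth_L)
  qed (use first in fastforce)
  also have "\<dots> = hess \<eta> (M \<zeta>) w + vderiv \<zeta> (hess \<eta> (M (snd w))) w"
    by (rule vderiv_along_radial_field[OF open_S w smooth_hess linear_hess2 M])
  also have "vderiv \<zeta> (\<lambda>w. 2 * Re c * vderiv \<eta> L w + - vderiv (M \<eta>) L w) w
      = 2 * Re c * hess \<zeta> \<eta> w + - hess \<zeta> (M \<eta>) w"
  proof -
    have "((\<lambda>w. 2 * Re c * vderiv \<eta> L w + - vderiv (M \<eta>) L w) has_derivative
        (\<lambda>e. 2 * Re c * frechet_derivative (vderiv \<eta> L) (at w) e
          + - frechet_derivative (vderiv (M \<eta>) L) (at w) e)) (at w)"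
      by (intro has_derivative_add has_derivative_mult_right has_derivative_minus
          smooth_on_has_derivative[OF smooth_on_vderiv[OF smooth_L] w])
    from fun_cong[OF frechet_derivative_at[OF this], of "(0, \<zeta>)"]
    show ?thesis by (simp add: hess_def vderiv_def)
  qed
  finally show ?thesis by (simp add: third_def)
qed

lemma third_radial_eq_0:
  assumes w: "w \<in> S"
  shows "third \<zeta> \<eta> (snd w) w = 0"
proof -
  have "realify (1 *s complexify \<eta>) = \<eta>" for \<eta> :: "'n rvec" by simp
  then show ?thesis
    using Euler_relation_third[OF w, of \<zeta> 1 \<eta>] hess_sym[OF w, of \<zeta> \<eta>] by simp
qed

lemma third_J_radial:
  assumes w: "w \<in> S"
  shows "hess \<zeta> (Jvec \<eta>) w + hess \<eta> (Jvec \<zeta>) w + third \<zeta> \<eta> (Jvec (snd w)) w = 0"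
  using Euler_relation_third[OF w, of \<zeta> \<i> \<eta>] by (simp add: realify_times_ii)

text \<open>Positivity makes the fundamental tensor invertible, so that lowering an index undoes the raising of
  an index in the definition of the connection coefficients.\<close>

lemma sum_ginv:
  assumes w: "w \<in> S"
  shows "(\<Sum>k\<in>UNIV. g_fund L m k w * (\<Sum>s\<in>UNIV. ginv L k s w * t s)) = t m"
proof -
  let ?g = "\<chi> i j. g_fund L i j w"
  have "x = 0" if "?g *v x = 0" for x
  proof (rule ccontr)
    assume "x \<noteq> 0"
    have "(\<Sum>j\<in>UNIV. \<Sum>k\<in>UNIV. g_fund L j k w * x $ j * x $ k) = (\<Sum>j\<in>UNIV. x $ j * (?g *v x) $ j)"
      by (simp add: matrix_vector_mult_def sum_distrib_left mult_ac)
    then show False using positive[OF w \<open>x \<noteq> 0\<close>] that by simp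
  qed
  then have "invertible ?g"
    using matrix_left_invertible_ker[of ?g] invertible_left_inverse[of ?g] by blast
  then have inv: "?g ** matrix_inv ?g = mat 1" by (rule matrix_inv_right)
  have "(\<Sum>k\<in>UNIV. g_fund L m k w * (\<Sum>s\<in>UNIV. ginv L k s w * t s))
      = (\<Sum>s\<in>UNIV. (\<Sum>k\<in>UNIV. g_fund L m k w * ginv L k s w) * t s)"
    unfolding sum_distrib_left sum_distrib_right by (subst sum.swap) (simp add: mult.assoc)
  also have "\<dots> = (\<Sum>s\<in>UNIV. (?g ** matrix_inv ?g) $ m $ s * t s)"
    by (simp add: matrix_matrix_mult_def ginv_def)
  also have "\<dots> = t m"
    unfolding inv by (simp add: mat_def if_distrib[of "\<lambda>x. x * _"] cong: if_cong)
  finally show ?thesis .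
qed

lemma hess_axis_vec:
  assumes w: "w \<in> S"
  shows "hess (axis m 1) \<xi> w = 2 * (\<Sum>k\<in>UNIV. g_fund L m k w * \<xi> $ k)"
proof -
  have \<xi>: "\<xi> = (\<Sum>j\<in>UNIV. \<xi> $ j *\<^sub>R axis j 1)"
    using basis_expansion[of \<xi>] by (simp add: scalar_mult_eq_scaleR)
  show ?thesis
    by (subst (1) \<xi>)
      (simp add: linear_sum[OF linear_hess2[OF w]] linear_cmul[OF linear_hess2[OF w]] g_fund_eq
        sum_distrib_left mult_ac)
qed


lemma hess_nondegenerate:
  assumes w: "w \<in> S" and "\<And>m. hess (axis m 1) \<xi> w = 0"
  shows "\<xi> = 0"
  using hess_eq_0D[OF w] linear_eq_0_on_axes[OF linear_hess[OF w] assms(2)] by blast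

text \<open>The coefficients are handled with their upper index lowered, where they are plain derivatives of \<open>L\<close>.\<close>

lemma hess_Gamma_ver:
  assumes w: "w \<in> S"
  shows "hess (axis m 1) (\<chi> k. Gamma_ver L k j l w) w = third (axis j 1) (axis l 1) (axis m 1) w / 2"
proof -
  have "Gamma_ver L k j l w = (\<Sum>s\<in>UNIV. ginv L k s w * (third (axis j 1) (axis l 1) (axis s 1) w / 4))" for k
    by (simp add: Gamma_ver_def third_def hess_def dy_eq_vderiv sum_distrib_left mult_ac)
  then show ?thesis
    unfolding hess_axis_vec[OF w] by (simp only: vec_lambda_beta sum_ginv[OF w])
qed

lemma hess_Gamma_hor:
  assumes w: "w \<in> S"
  shows "hess (axis m 1) (\<chi> k. Gamma_hor L k j l w) w
    = deltax L l (g_fund L m j) w - deltax L m (g_fund L j l) w + deltax L j (g_fund L l m) w"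
proof -
  have "Gamma_hor L k j l w = (\<Sum>s\<in>UNIV. ginv L k s w * ((deltax L l (g_fund L s j) w
      - deltax L s (g_fund L j l) w + deltax L j (g_fund L l s) w) / 2))" for k
    by (simp add: Gamma_hor_def)
  then show ?thesis
    unfolding hess_axis_vec[OF w] by (simp only: vec_lambda_beta sum_ginv[OF w]) simp
qed

lemma vderiv_g_fund: "w \<in> S \<Longrightarrow> vderiv \<theta> (g_fund L j k) w = third \<theta> (axis j 1) (axis k 1) w / 2"
proof -
  assume w: "w \<in> S"
  have "(g_fund L j k has_derivative (\<lambda>e. frechet_derivative (hess (axis j 1) (axis k 1)) (at w) e / 2)) (at w)"
    unfolding g_fund_eq
    by (rule bounded_linear.has_derivative[OF bounded_linear_divide smooth_on_has_derivative[OF smooth_hess w]])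
  from fun_cong[OF frechet_derivative_at[OF this], of "(0, \<theta>)"] show ?thesis
    by (simp add: vderiv_def third_def)
qed

lemma g_fund_sym: "w \<in> S \<Longrightarrow> g_fund L j k w = g_fund L k j w"
  using hess_sym by (simp add: g_fund_eq)

lemma dx_g_fund_sym: "w \<in> S \<Longrightarrow> dx l (g_fund L j k) w = dx l (g_fund L k j) w"
  unfolding dx_def
  using frechet_derivative_cong_on[OF open_S _ smooth_g_fund g_fund_sym] by simp

end


section \<open>Parallel complex structure in coordinates\<close>

text \<open>The two conditions say that \<open>\<nabla>\<^sub>X (J Y) = J (\<nabla>\<^sub>X Y)\<close> for \<open>Y = \<partial>/\<partial>y\<^sup>\<alpha>\<close> and for \<open>X\<close> a vertical,
  respectively horizontal, vector of the adapted frame; note \<open>J (\<partial>/\<partial>y\<^sup>\<alpha>) = \<partial>/\<partial>y\<^sup>\<alpha>\<^sup>*\<close>.  The case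
  \<open>Y = \<partial>/\<partial>y\<^sup>\<alpha>\<^sup>*\<close> follows from \<open>J\<^sup>2 = -1\<close>.\<close>

locale local_J_parallel = local_Finsler L S
  for L :: "'n::finite tcoord \<Rightarrow> real" and S +
  assumes vertical_J: "w \<in> S \<Longrightarrow>
      (\<chi> k. Gamma_ver L k (Inr \<alpha>) l w) = Jvec (\<chi> k. Gamma_ver L k (Inl \<alpha>) l w)"
    and horizontal_J: "w \<in> S \<Longrightarrow>
      (\<chi> k. Gamma_hor L k (Inr \<alpha>) l w) = Jvec (\<chi> k. Gamma_hor L k (Inl \<alpha>) l w)"
begin

text \<open>The vector \<open>C\<^sub>l(\<eta>)\<close> dual to \<open>T(\<eta>, \<partial>\<^sub>l, \<cdot>)\<close> is complex linear in \<open>\<eta>\<close> and vanishes at \<open>\<eta> = y\<close> by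
  homogeneity, hence also at \<open>\<eta> = J y\<close>.\<close>

lemma third_J_radial_eq_0:
  assumes w: "w \<in> S"
  shows "third \<zeta> \<eta> (Jvec (snd w)) w = 0"
proof -
  have axes: "third (Jvec (snd w)) (axis l 1) (axis m 1) w = 0" for l m
  proof -
    \<comment> \<open>The dual vector is \<open>\<Sum>\<^sub>j \<eta>\<^sub>j c\<^sub>j\<close>.\<close>
    define c where "c j = (\<chi> k. Gamma_ver L k j l w)" for j
    have c: "hess (axis m 1) (\<Sum>j\<in>UNIV. \<eta> $ j *\<^sub>R c j) w = third \<eta> (axis l 1) (axis m 1) w / 2"
      for \<eta> :: "'n rvec" and m
    proof -
      have "hess (axis m 1) (\<Sum>j\<in>UNIV. \<eta> $ j *\<^sub>R c j) w
          = (\<Sum>j\<in>UNIV. \<eta> $ j * third (axis j 1) (axis l 1) (axis m 1) w) / 2"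
        by (simp add: linear_sum[OF linear_hess2[OF w]] linear_cmul[OF linear_hess2[OF w]]
            c_def hess_Gamma_ver[OF w] sum_divide_distrib)
      also have "(\<Sum>j\<in>UNIV. \<eta> $ j * third (axis j 1) (axis l 1) (axis m 1) w)
          = third (\<Sum>j\<in>UNIV. \<eta> $ j *\<^sub>R axis j 1) (axis l 1) (axis m 1) w"
        by (simp add: linear_sum[OF linear_third[OF w]] linear_cmul[OF linear_third[OF w]])
      also have "(\<Sum>j\<in>UNIV. \<eta> $ j *\<^sub>R axis j 1) = \<eta>"
        using basis_expansion[of \<eta>] by (simp add: scalar_mult_eq_scaleR)
      finally show ?thesis .
    qed
    have "third (snd w) (axis l 1) (axis m 1) w = 0" for m
      using third_radial_eq_0[OF w, of "axis l 1" "axis m 1"]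
        third_sym12[OF w, of "snd w" "axis l 1" "axis m 1"]
        third_sym23[OF w, of "axis l 1" "snd w" "axis m 1"] by simp
    then have "(\<Sum>j\<in>UNIV. snd w $ j *\<^sub>R c j) = 0"
      using c[of _ "snd w"] by (intro hess_nondegenerate[OF w]) simp
    then have "(\<Sum>j\<in>UNIV. Jvec (snd w) $ j *\<^sub>R c j) = 0"
      using Jvec_complex_linear_sum[of c "snd w"] vertical_J[OF w] linear_0[OF linear_Jvec]
      unfolding c_def by simp
    then show ?thesis using c[of m "Jvec (snd w)"] linear_0[OF linear_hess2[OF w]] by simp
  qed
  have half: "third \<eta> (Jvec (snd w)) (axis l 1) w = 0" for l \<eta>
    by (rule linear_eq_0_on_axes[OF linear_third[OF w]])
      (simp add: axes third_sym12[OF w, of "axis _ 1" "Jvec (snd w)"])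
  have "third (axis l 1) (Jvec (snd w)) \<eta> w = 0" for l
    using half[of \<eta> l] third_sym23[OF w, of "axis l 1" "Jvec (snd w)" \<eta>]
      third_sym12[OF w, of "axis l 1" \<eta> "Jvec (snd w)"]
      third_sym23[OF w, of \<eta> "Jvec (snd w)" "axis l 1"] by simp
  then have "third \<zeta> (Jvec (snd w)) \<eta> w = 0"
    by (rule linear_eq_0_on_axes[OF linear_third[OF w]])
  then show ?thesis using third_sym23[OF w, of \<zeta> \<eta> "Jvec (snd w)"] by simp
qed

text \<open>Circle invariance of \<open>L\<close> expresses the failure of \<open>J\<close>-invariance of the metric by
  \<open>T(\<cdot>, \<cdot>, J y)\<close>, which is now known to vanish.\<close>

lemma hess_J_J:
  assumes w: "w \<in> S"
  shows "hess (Jvec \<eta>) (Jvec \<zeta>) w = hess \<eta> \<zeta> w"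
proof -
  have "hess (Jvec \<zeta>) (Jvec \<eta>) w + hess \<eta> (Jvec (Jvec \<zeta>)) w = 0"
    using third_J_radial[OF w, of "Jvec \<zeta>" \<eta>] third_J_radial_eq_0[OF w] by simp
  then show ?thesis
    using hess_sym[OF w, of "Jvec \<zeta>"] linear_neg[OF linear_hess2[OF w]] by simp
qed

lemma hess_J_right: "w \<in> S \<Longrightarrow> hess \<eta> (Jvec \<zeta>) w = - hess (Jvec \<eta>) \<zeta> w"
  using hess_J_J[of w "Jvec \<eta>" \<zeta>] linear_neg[OF linear_hess[of w]] by simp

lemma third_J_J:
  assumes w: "w \<in> S"
  shows "third \<theta> (Jvec \<eta>) (Jvec \<zeta>) w = third \<theta> \<eta> \<zeta> w"
  unfolding third_def vderiv_def
  using frechet_derivative_cong_on[OF open_S w smooth_hess hess_J_J] by simp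

text \<open>Differentiating \<open>H(J \<eta>, J \<zeta>) = H(\<eta>, \<zeta>)\<close> shows that \<open>T\<close> does not change when \<open>J\<close> is applied to two of
  its arguments.  Using the three pairs in turn makes \<open>J\<^sup>2 = -1\<close> act on a single argument, so \<open>T = - T\<close>.\<close>

lemma third_eq_0:
  assumes w: "w \<in> S"
  shows "third \<theta> \<eta> \<zeta> w = 0"
proof -
  note sym12 = third_sym12[OF w] and sym23 = third_sym23[OF w] and J = third_J_J[OF w]
  have "third \<theta> \<eta> \<zeta> w = third (Jvec \<eta>) \<theta> (Jvec \<zeta>) w"
    using J[of \<theta> \<eta> \<zeta>] sym12[of \<theta> "Jvec \<eta>" "Jvec \<zeta>"] by simp
  also have "\<dots> = third (Jvec \<eta>) (Jvec \<theta>) (- \<zeta>) w"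
    using J[of "Jvec \<eta>" \<theta> "Jvec \<zeta>"] by simp
  also have "\<dots> = third (- \<zeta>) (Jvec \<eta>) (Jvec \<theta>) w"
    using sym23[of "Jvec \<eta>" "Jvec \<theta>" "- \<zeta>"] sym12[of "Jvec \<eta>" "- \<zeta>" "Jvec \<theta>"] by simp
  also have "\<dots> = - third \<zeta> \<eta> \<theta> w"
    using J[of "- \<zeta>" \<eta> \<theta>] linear_neg[OF linear_third[OF w]] by simp
  also have "third \<zeta> \<eta> \<theta> w = third \<theta> \<eta> \<zeta> w"
    using sym12[of \<zeta> \<eta> \<theta>] sym23[of \<eta> \<zeta> \<theta>] sym12[of \<eta> \<theta> \<zeta>] by simp
  finally show ?thesis by simp
qed

lemma Gamma_ver_eq_0:
  assumes w: "w \<in> S"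
  shows "Gamma_ver L k j l w = 0"
proof -
  have "(\<chi> k. Gamma_ver L k j l w) = 0"
    by (rule hess_nondegenerate[OF w]) (simp add: hess_Gamma_ver[OF w] third_eq_0[OF w])
  then show ?thesis by (simp add: vec_eq_iff)
qed

lemma vderiv_g_fund_eq_0: "w \<in> S \<Longrightarrow> vderiv \<theta> (g_fund L j k) w = 0"
  by (simp add: vderiv_g_fund third_eq_0)

text \<open>The fundamental tensor is constant along the fibres, so the vertical part of \<open>\<delta>/\<delta>x\<^sup>l\<close> annihilates it
  and the horizontal coefficients become Christoffel symbols.\<close>

lemma deltax_g_fund: "w \<in> S \<Longrightarrow> deltax L l (g_fund L j k) w = dx l (g_fund L j k) w"
  by (simp add: deltax_def dy_eq_vderiv vderiv_g_fund_eq_0)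

lemma Gamma_hor_sym:
  assumes w: "w \<in> S"
  shows "Gamma_hor L k j l w = Gamma_hor L k l j w"
  unfolding Gamma_hor_def deltax_g_fund[OF w]
  using dx_g_fund_sym[OF w] by (intro sum.cong refl arg_cong[where f = "\<lambda>t. _ * t"]) simp

text \<open>Metric compatibility of the Christoffel symbols.\<close>

lemma dx_g_fund:
  assumes w: "w \<in> S"
  shows "dx l (g_fund L j s) w
    = (hess (axis s 1) (\<chi> k. Gamma_hor L k j l w) w + hess (axis j 1) (\<chi> k. Gamma_hor L k s l w) w) / 2"
  unfolding hess_Gamma_hor[OF w] deltax_g_fund[OF w]
  using dx_g_fund_sym[OF w, of l j s] dx_g_fund_sym[OF w, of s j l] dx_g_fund_sym[OF w, of j s l]
  by simp

lemma dvbar_L: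
  assumes w: "w \<in> S"
  shows "dvbar \<beta> (\<lambda>w. complex_of_real (L w)) w
    = Complex (vderiv (axis (Inl \<beta>) 1) L w / 2) (vderiv (axis (Inr \<beta>) 1) L w / 2)"
proof -
  have "frechet_derivative (\<lambda>w. complex_of_real (L w)) (at w) e
      = Complex (frechet_derivative L (at w) e) (frechet_derivative (\<lambda>w. 0) (at w) e)" for e
    by (rule frechet_derivative_Complex[OF open_S w smooth_L]) (auto simp: complex_eq_iff)
  then show ?thesis
    by (simp add: dvbar_def dy_def vderiv_def complex_eq_iff)
qed

text \<open>\<open>G\<close> combines four real second derivatives of \<open>L\<close>; \<open>J\<close>-invariance identifies them in pairs, and
  \<open>G\<close> becomes the matrix of the Hermitian form \<open>g(\<xi>, \<eta>) + \<i> g(\<xi>, J \<eta>)\<close>.\<close>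

lemma G_herm_eq:
  assumes w: "w \<in> S"
  shows "G_herm L \<alpha> \<beta> w = Complex (g_fund L (Inl \<alpha>) (Inl \<beta>) w) (g_fund L (Inl \<alpha>) (Inr \<beta>) w)"
proof -
  have half: "smooth_on S (\<lambda>w. vderiv \<eta> L w / 2)" for \<eta>
    by (rule smooth_on_bounded_linear_comp[OF open_S bounded_linear_divide smooth_on_vderiv[OF smooth_L]])
  have "((\<lambda>w. vderiv \<eta> L w / 2) has_derivative (\<lambda>e. frechet_derivative (vderiv \<eta> L) (at w) e / 2)) (at w)" for \<eta>
    by (rule bounded_linear.has_derivative[OF bounded_linear_divide
          smooth_on_has_derivative[OF smooth_on_vderiv[OF smooth_L] w]])
  from frechet_derivative_at[OF this]
  have dhalf: "frechet_derivative (\<lambda>w. vderiv \<eta> L w / 2) (at w) (0, \<zeta>) = hess \<zeta> \<eta> w / 2" for \<eta> \<zeta>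
    by (metis hess_def vderiv_def)
  have "frechet_derivative (dvbar \<beta> (\<lambda>w. complex_of_real (L w))) (at w) (0, \<zeta>)
      = Complex (hess \<zeta> (axis (Inl \<beta>) 1) w / 2) (hess \<zeta> (axis (Inr \<beta>) 1) w / 2)" for \<zeta>
    using frechet_derivative_Complex[OF open_S w half half dvbar_L] by (simp add: dhalf)
  moreover have "hess (axis (Inr \<alpha>) 1) (axis (Inr \<beta>) 1) w = hess (axis (Inl \<alpha>) 1) (axis (Inl \<beta>) 1) w"
    using hess_J_J[OF w, of "axis (Inl \<alpha>) 1" "axis (Inl \<beta>) 1"] by (simp add: Jvec_axis)
  moreover have "hess (axis (Inr \<alpha>) 1) (axis (Inl \<beta>) 1) w = - hess (axis (Inl \<alpha>) 1) (axis (Inr \<beta>) 1) w"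
    using hess_J_right[OF w, of "axis (Inl \<alpha>) 1" "axis (Inl \<beta>) 1"] by (simp add: Jvec_axis)
  ultimately show ?thesis
    unfolding G_herm_def dv_def dy_def by (simp add: g_fund_eq complex_eq_iff)
qed

lemma frechet_derivative_G_herm:
  assumes w: "w \<in> S"
  shows "frechet_derivative (G_herm L \<alpha> \<beta>) (at w) e
    = Complex (frechet_derivative (g_fund L (Inl \<alpha>) (Inl \<beta>)) (at w) e)
        (frechet_derivative (g_fund L (Inl \<alpha>) (Inr \<beta>)) (at w) e)"
  by (rule frechet_derivative_Complex[OF open_S w smooth_g_fund smooth_g_fund G_herm_eq])

lemma dv_G_herm:
  assumes w: "w \<in> S"
  shows "dv \<gamma> (G_herm L \<alpha> \<beta>) w = 0"
  using vderiv_g_fund_eq_0[OF w]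
  by (simp add: dv_def dy_def frechet_derivative_G_herm[OF w] vderiv_def complex_eq_iff)

text \<open>The Hermitian form \<open>h(\<xi>, \<eta>) = g(\<xi>, \<eta>) + \<i> g(\<xi>, J \<eta>)\<close> with \<open>\<partial>/\<partial>y\<^sup>\<tau>\<close> in the second,
  antilinear argument.\<close>

definition herm :: "'n \<Rightarrow> 'n rvec \<Rightarrow> 'n tcoord \<Rightarrow> complex" where
  "herm \<tau> \<xi> w = Complex (hess (axis (Inl \<tau>) 1) \<xi> w / 2) (hess (axis (Inr \<tau>) 1) \<xi> w / 2)"

lemma G_herm_eq_herm: "w \<in> S \<Longrightarrow> G_herm L \<alpha> \<tau> w = herm \<tau> (axis (Inl \<alpha>) 1) w"
  by (simp add: G_herm_eq herm_def g_fund_eq hess_sym)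

lemma herm_Jvec:
  assumes w: "w \<in> S"
  shows "herm \<tau> (Jvec \<xi>) w = \<i> * herm \<tau> \<xi> w"
  using hess_J_right[OF w, of "axis (Inl \<tau>) 1" \<xi>] hess_J_right[OF w, of "axis (Inr \<tau>) 1" \<xi>]
    linear_neg[OF linear_hess[OF w]]
  by (simp add: herm_def Jvec_axis complex_eq_iff)

lemma herm_expand:
  assumes w: "w \<in> S"
  shows "herm \<tau> \<xi> w = (\<Sum>\<alpha>\<in>UNIV. complexify \<xi> $ \<alpha> * G_herm L \<alpha> \<tau> w)"
proof -
  have lin: "linear (\<lambda>\<xi>. herm \<tau> \<xi> w)"
    by (rule linearI)
      (simp_all add: herm_def linear_add[OF linear_hess2[OF w]] linear_cmul[OF linear_hess2[OF w]]
        complex_eq_iff add_divide_distrib)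
  have "\<xi> = (\<Sum>j\<in>UNIV. \<xi> $ j *\<^sub>R axis j 1)"
    using basis_expansion[of \<xi>] by (simp add: scalar_mult_eq_scaleR)
  then have "herm \<tau> \<xi> w = (\<Sum>j\<in>UNIV. \<xi> $ j *\<^sub>R herm \<tau> (axis j 1) w)"
    using linear_sum[OF lin] linear_cmul[OF lin] by (metis (no_types, lifting) sum.cong)
  also have "\<dots> = (\<Sum>\<alpha>\<in>UNIV. \<xi> $ Inl \<alpha> *\<^sub>R herm \<tau> (axis (Inl \<alpha>) 1) w
      + \<xi> $ Inr \<alpha> *\<^sub>R (\<i> * herm \<tau> (axis (Inl \<alpha>) 1) w))"
    by (simp add: sum_sum_index sum.distrib Jvec_axis(1)[symmetric] herm_Jvec[OF w])
  also have "\<dots> = (\<Sum>\<alpha>\<in>UNIV. complexify \<xi> $ \<alpha> * G_herm L \<alpha> \<tau> w)"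
    by (rule sum.cong) (simp_all add: G_herm_eq_herm[OF w] complexify_def complex_eq_iff)
  finally show ?thesis .
qed

lemma herm_nondegenerate:
  assumes w: "w \<in> S" and "\<And>\<tau>. herm \<tau> \<xi> w = 0"
  shows "\<xi> = 0"
proof (rule hess_nondegenerate[OF w])
  fix m :: "'n + 'n"
  show "hess (axis m 1) \<xi> w = 0"
    using assms(2) by (cases m) (simp_all add: herm_def complex_eq_iff)
qed

text \<open>Raising the barred index recovers the complex components of \<open>\<xi>\<close> from its products with the frame.
  Invertibility of \<open>G\<close> comes from the nondegeneracy of the real metric.\<close>

lemma sum_Ginv:
  assumes w: "w \<in> S"
  shows "(\<Sum>\<tau>\<in>UNIV. Ginv L \<tau> \<alpha> w * herm \<tau> \<xi> w) = complexify \<xi> $ \<alpha>"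
proof -
  let ?G = "\<chi> \<beta> \<sigma>. G_herm L \<beta> \<sigma> w"
  have cnj: "cnj (G_herm L \<alpha> \<tau> w) = G_herm L \<tau> \<alpha> w" for \<alpha> \<tau>
    using hess_sym[OF w] hess_J_right[OF w, of "axis (Inl \<tau>) 1" "axis (Inl \<alpha>) 1"]
    by (simp add: G_herm_eq[OF w] g_fund_eq Jvec_axis complex_eq_iff)
  have "x = 0" if x: "?G *v x = 0" for x
  proof -
    \<comment> \<open>A kernel vector of \<open>G\<close> is, up to conjugation, a real vector orthogonal to the frame.\<close>
    let ?\<xi> = "realify (\<chi> \<tau>. cnj (x $ \<tau>))"
    have "herm \<alpha> ?\<xi> w = 0" for \<alpha>
    proof -
      have "herm \<alpha> ?\<xi> w = cnj ((?G *v x) $ \<alpha>)"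
        unfolding herm_expand[OF w] by (simp add: matrix_vector_mult_def cnj mult.commute)
      then show ?thesis using x by simp
    qed
    then have "?\<xi> = 0" by (rule herm_nondegenerate[OF w])
    then have "(\<chi> \<tau>. cnj (x $ \<tau>)) = 0" by (simp only: realify_eq_0_iff)
    then show ?thesis by (simp add: vec_eq_iff)
  qed
  then have "invertible ?G"
    using matrix_left_invertible_ker[of ?G] invertible_left_inverse[of ?G] by blast
  then have inv: "?G ** matrix_inv ?G = mat 1" by (rule matrix_inv_right)
  have "(\<Sum>\<tau>\<in>UNIV. Ginv L \<tau> \<alpha> w * herm \<tau> \<xi> w)
      = (\<Sum>\<beta>\<in>UNIV. complexify \<xi> $ \<beta> * (\<Sum>\<tau>\<in>UNIV. G_herm L \<beta> \<tau> w * Ginv L \<tau> \<alpha> w))"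
    unfolding herm_expand[OF w] sum_distrib_left by (subst sum.swap) (simp add: mult_ac)
  also have "\<dots> = (\<Sum>\<beta>\<in>UNIV. complexify \<xi> $ \<beta> * (?G ** matrix_inv ?G) $ \<beta> $ \<alpha>)"
    by (simp add: matrix_matrix_mult_def Ginv_def)
  also have "\<dots> = complexify \<xi> $ \<alpha>"
    unfolding inv by (simp add: mat_def if_distrib[of "\<lambda>x. _ * x"] cong: if_cong)
  finally show ?thesis .
qed

text \<open>Metric compatibility gives \<open>\<partial>\<^sub>l h(\<beta>, \<tau>) = h(C(\<beta>, l), \<tau>) + h(\<beta>, C(\<tau>, l))\<close>, where \<open>C\<close> is symmetric and
  complex bilinear.  The first summand is complex linear in \<open>l\<close> and the second antilinear, so
  \<open>\<partial>/\<partial>z\<^sup>\<mu>\<close> retains only the first.\<close>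

lemma dz_G_herm:
  assumes w: "w \<in> S"
  shows "dz \<mu> (G_herm L \<beta> \<tau>) w = herm \<tau> (\<chi> k. Gamma_hor L k (Inl \<beta>) (Inl \<mu>) w) w"
proof -
  define C where "C j l = (\<chi> k. Gamma_hor L k j l w)" for j l
  have sym: "C j l = C l j" for j l
    unfolding C_def using Gamma_hor_sym[OF w] by (simp add: vec_eq_iff)
  have J: "C (Inr \<alpha>) l = Jvec (C (Inl \<alpha>) l)" for \<alpha> l
    unfolding C_def by (rule horizontal_J[OF w])
  have J2: "C (Inl \<beta>) (Inr \<mu>) = Jvec (C (Inl \<beta>) (Inl \<mu>))" for \<beta> \<mu>
    using J[of \<mu> "Inl \<beta>"] sym[of "Inl \<beta>" "Inr \<mu>"] sym[of "Inl \<mu>" "Inl \<beta>"] by simp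
  have dx: "dx l (G_herm L \<beta> \<tau>) w = herm \<tau> (C (Inl \<beta>) l) w + cnj (herm \<beta> (C (Inl \<tau>) l) w)" for l
  proof -
    have "dx l (G_herm L \<beta> \<tau>) w
        = Complex (dx l (g_fund L (Inl \<beta>) (Inl \<tau>)) w) (dx l (g_fund L (Inl \<beta>) (Inr \<tau>)) w)"
      by (simp add: dx_def frechet_derivative_G_herm[OF w])
    then show ?thesis
      unfolding dx_g_fund[OF w] C_def[symmetric] J hess_J_right[OF w]
      by (simp add: herm_def complex_eq_iff Jvec_axis add_divide_distrib diff_divide_distrib)
  qed
  show ?thesis
    unfolding dz_def dx C_def[symmetric] J2 herm_Jvec[OF w]
    by (simp add: complex_eq_iff)
qed

lemma CF_hor_eq:
  assumes w: "w \<in> S"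
  shows "CF_hor L \<alpha> \<beta> \<mu> w = complexify (\<chi> k. Gamma_hor L k (Inl \<beta>) (Inl \<mu>) w) $ \<alpha>"
  unfolding CF_hor_def deltaz_def dz_G_herm[OF w] dv_G_herm[OF w]
  using sum_Ginv[OF w] by simp

lemma CF_ver_eq_0: "w \<in> S \<Longrightarrow> CF_ver L \<alpha> \<beta> \<gamma> w = 0"
  by (simp add: CF_ver_def dv_G_herm)

lemma omega_form_eq: "w \<in> S \<Longrightarrow> omega_form L \<alpha> \<beta> w e
    = (\<Sum>\<mu>\<in>UNIV. complexify (\<chi> k. Gamma_hor L k (Inl \<beta>) (Inl \<mu>) w) $ \<alpha> * dz_form \<mu> e)"
  by (simp add: omega_form_def CF_ver_eq_0 CF_hor_eq)

end


section \<open>Linear connections\<close>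

lemma
  assumes "linear_connection A E nab" "open_set A W" "smooth_section A E W Y"
  shows connection_in: "u \<in> W \<Longrightarrow> X \<in> tangent_space A u \<Longrightarrow> nab u X Y \<in> E u"
    and connection_direction: "u \<in> W \<Longrightarrow> X \<in> tangent_space A u \<Longrightarrow> X' \<in> tangent_space A u \<Longrightarrow>
      nab u (scale_tvec a X + scale_tvec b X') Y
        = scale_tvec a (nab u X Y) + scale_tvec b (nab u X' Y)"
    and connection_cong: "(\<And>q. q \<in> W \<Longrightarrow> Y' q = Y q) \<Longrightarrow> u \<in> W \<Longrightarrow> X \<in> tangent_space A u \<Longrightarrow>
      nab u X Y' = nab u X Y"
    and connection_add: "smooth_section A E W Y' \<Longrightarrow> u \<in> W \<Longrightarrow> X \<in> tangent_space A u \<Longrightarrow>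
      nab u X (\<lambda>q. Y q + Y' q) = nab u X Y + nab u X Y'"
    and connection_Leibniz: "smooth_fun A W f \<Longrightarrow> u \<in> W \<Longrightarrow> X \<in> tangent_space A u \<Longrightarrow>
      c \<in> A \<Longrightarrow> u \<in> fst c \<Longrightarrow> nab u X (\<lambda>q. scale_tvec (f q) (Y q))
        = scale_tvec (frechet_derivative (local_rep c f) (at (snd c u)) (X c)) (Y u)
          + scale_tvec (f u) (nab u X Y)"
  using assms(1)[unfolded linear_connection_def, THEN spec, THEN spec, THEN mp, OF conjI[OF assms(2,3)]]
  by blast+

lemma
  assumes "complex_linear_connection A E D" "open_set A W" "smooth_csection A E W V"
  shows complex_connection_in: "u \<in> W \<Longrightarrow> X \<in> ctangent_space A u \<Longrightarrow> D u X V \<in> E u"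
    and complex_connection_cong: "(\<And>q. q \<in> W \<Longrightarrow> V' q = V q) \<Longrightarrow> u \<in> W \<Longrightarrow>
      X \<in> ctangent_space A u \<Longrightarrow> D u X V' = D u X V"
    and complex_connection_add: "smooth_csection A E W V' \<Longrightarrow> u \<in> W \<Longrightarrow> X \<in> ctangent_space A u \<Longrightarrow>
      D u X (\<lambda>q. V q + V' q) = D u X V + D u X V'"
    and complex_connection_Leibniz: "smooth_fun A W f \<Longrightarrow> u \<in> W \<Longrightarrow> X \<in> ctangent_space A u \<Longrightarrow>
      c \<in> A \<Longrightarrow> u \<in> fst c \<Longrightarrow> D u X (\<lambda>q. scale_ctvec (f q) (V q))
        = scale_ctvec (frechet_derivative (local_rep c f) (at (snd c u)) (fst X c)
            + \<i> * frechet_derivative (local_rep c f) (at (snd c u)) (snd X c)) (V u)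
          + scale_ctvec (f u) (D u X V)"
  using assms(1)[unfolded complex_linear_connection_def, THEN spec, THEN spec, THEN mp, OF conjI[OF assms(2,3)]]
  by blast+

lemma sum_fun_apply: "(\<Sum>i\<in>I. f i) x = (\<Sum>i\<in>I. f i x)"
  for f :: "'i \<Rightarrow> 'x \<Rightarrow> 'y::comm_monoid_add"
  by (induction I rule: infinite_finite_induct) auto

lemma scale_tvec_zero [simp]: "scale_tvec 0 X = 0"
  by (simp add: scale_tvec_def fun_eq_iff)

lemma scale_tvec_minus_one: "scale_tvec (- 1) X = - X"
  by (simp add: scale_tvec_def fun_eq_iff)

lemma scale_tvec_apply: "scale_tvec a X c = a *\<^sub>R X c"
  by (simp add: scale_tvec_def)

lemma linear_connection_zero_direction:
  assumes "linear_connection A E nab" "open_set A W" "smooth_section A E W Y"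
    "u \<in> W" "X \<in> tangent_space A u"
  shows "nab u 0 Y = 0"
  using connection_direction[OF assms(1-3) assms(4,5) assms(5), of 0 0] by simp

lemma linear_connection_minus:
  assumes nab: "linear_connection A E nab" "open_set A W" "smooth_section A E W Y"
    and u: "u \<in> W" "X \<in> tangent_space A u"
  shows "nab u X (\<lambda>q. - Y q) = - nab u X Y"
proof -
  have ex: "\<exists>c\<in>A. u \<in> fst c" if "u \<in> W" for u
    using assms(3) that unfolding smooth_section_def by blast
  then obtain c where c: "c \<in> A" "u \<in> fst c" using u(1) by blast
  have const: "local_rep d (\<lambda>_. - 1 :: real) = (\<lambda>_. - 1)" for d :: "('a, 'b) chart"
    by (simp add: fun_eq_iff)
  have "smooth_fun A W (\<lambda>_. - 1 :: real)"
    unfolding smooth_fun_def const using ex by simp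
  from connection_Leibniz[OF nab this u c] show ?thesis
    unfolding const by (simp add: scale_tvec_minus_one)
qed

context smooth_atlas
begin

lemma tvec_of_linear:
  assumes "c \<in> A" "p \<in> fst c"
  shows "tvec_of A c p (a *\<^sub>R e + b *\<^sub>R e') = scale_tvec a (tvec_of A c p e) + scale_tvec b (tvec_of A c p e')"
  by (rule tangent_space_eqI[OF _ _ assms])
    (simp_all add: tvec_of_in_tangent_space tangent_space_add tangent_space_scale assms
      tvec_of_self scale_tvec_apply)

lemma connection_linear_in_components:
  assumes "linear_connection A E nab" "open_set A W" "smooth_section A E W Y"
    and "u \<in> W" "c \<in> A" "u \<in> fst c"
  shows "linear (\<lambda>e. nab u (tvec_of A c u e) Y c)"
proof (rule linearI)
  note dir = connection_direction[OF assms(1-4) tvec_of_in_tangent_space[OF assms(5,6)]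
      tvec_of_in_tangent_space[OF assms(5,6)]]
  fix e e' and r :: real
  show "nab u (tvec_of A c u (e + e')) Y c = nab u (tvec_of A c u e) Y c + nab u (tvec_of A c u e') Y c"
    using tvec_of_linear[OF assms(5,6), of 1 e 1 e'] dir[of 1 e 1 e'] by (simp add: scale_tvec_apply)
  show "nab u (tvec_of A c u (r *\<^sub>R e)) Y c = r *\<^sub>R nab u (tvec_of A c u e) Y c"
    using tvec_of_linear[OF assms(5,6), of r e 0 e] dir[of r e 0 e] by (simp add: scale_tvec_apply)
qed

end

section \<open>The energy function in a chart\<close>

context complex_atlas
begin

lemma transition_complex_linear:
  assumes "c \<in> A" "d \<in> A" "p \<in> fst c" "p \<in> fst d"
  shows "frechet_derivative (transition c d) (at (snd c p)) (a *s v)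
    = a *s frechet_derivative (transition c d) (at (snd c p)) v"
proof -
  have split: "a *s v = Re a *\<^sub>R v + Im a *\<^sub>R (\<i> *s v)" for v :: "complex^'n"
    by (simp add: vec_eq_iff complex_eq_iff)
  note lin = transition_linear[OF assms]
  show ?thesis
    unfolding split linear_add[OF lin] linear_cmul[OF lin] transition_holomorphic[OF assms] ..
qed

lemma scale_in_tangent_space:
  assumes v: "v \<in> tangent_space A p"
  shows "(\<lambda>c. a *s v c) \<in> tangent_space A p"
proof (rule tangent_spaceI)
  fix c d assume cd: "c \<in> A" "d \<in> A" "p \<in> fst c" "p \<in> fst d"
  show "a *s v d = frechet_derivative (transition c d) (at (snd c p)) (a *s v c)"
    unfolding transition_complex_linear[OF cd] tangent_space_change[OF v cd] ..
qed (use tangent_space_outside[OF v] in simp)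

lemma slit_T10_chart: "c \<in> A \<Longrightarrow> slit_T10 A \<inter> fst (slit_chart A c) = fst (slit_chart A c)"
  by (auto simp: slit_chart_def)

lemma open_set_slit_T10: "open_set (slit_atlas A) (slit_T10 A)"
  unfolding open_set_def
proof (intro conjI ballI)
  show "slit_T10 A \<subseteq> (\<Union>b\<in>slit_atlas A. fst b)"
  proof
    fix u assume u: "u \<in> slit_T10 A"
    obtain p v where pv: "u = (p, v)" by fastforce
    obtain c where c: "c \<in> A" "p \<in> fst c" using u unfolding pv slit_T10_def T10_def by blast
    have "u \<in> fst (slit_chart A c)" using u c(2) by (simp add: pv slit_chart_def)
    then show "u \<in> (\<Union>b\<in>slit_atlas A. fst b)" using slit_chart_in[OF c(1)] by blast
  qed
  fix b assume b: "b \<in> slit_atlas A"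
  then obtain c where c: "c \<in> A" "b = slit_chart A c" unfolding slit_atlas_def by blast
  show "open (snd b ` (slit_T10 A \<inter> fst b))"
    using slit.open_chart[OF b] slit_T10_chart[OF c(1)] unfolding c(2) by simp
qed

text \<open>\<open>F\<close> is given as smooth in some chart around each point; the smooth coordinate changes transport this
  to the chart at hand.\<close>

lemma energy_local_Finsler:
  assumes F: "strongly_convex_complex_Finsler A F" and c: "c \<in> A"
  shows "local_Finsler (energy A F c) (snd (slit_chart A c) ` fst (slit_chart A c))"
proof
  let ?b = "slit_chart A c"
  show "open (snd ?b ` fst ?b)" by (rule slit.open_chart[OF slit_chart_in[OF c]])
  have "smooth_fun (slit_atlas A) (slit_T10 A) F"
    using F unfolding strongly_convex_complex_Finsler_def by blast
  from slit.smooth_fun_in_chart[OF this open_set_slit_T10 slit_chart_in[OF c]]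
  have sm: "smooth_on (snd ?b ` fst ?b) (local_rep ?b F)" unfolding slit_T10_chart[OF c] .
  have "energy A F c = (\<lambda>w. local_rep ?b F w * local_rep ?b F w)"
    by (simp add: energy_def fun_eq_iff power2_eq_square)
  then show "smooth_on (snd ?b ` fst ?b) (energy A F c)"
    using smooth_on_bilinear[OF \<open>open _\<close> bounded_bilinear_mult sm sm] by simp
next
  fix w and \<xi> :: "'n rvec"
  assume "w \<in> snd (slit_chart A c) ` fst (slit_chart A c)" and \<xi>: "\<xi> \<noteq> 0"
  then obtain u where u: "u \<in> fst (slit_chart A c)" "w = snd (slit_chart A c) u" by blast
  show "0 < (\<Sum>j\<in>UNIV. \<Sum>k\<in>UNIV. g_fund (energy A F c) j k w * \<xi> $ j * \<xi> $ k)"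
    unfolding u(2)
    using F[unfolded strongly_convex_complex_Finsler_def, THEN conjunct2, THEN conjunct2,
        THEN conjunct2, THEN conjunct2, rule_format, OF c u(1) \<xi>] .
next
  fix w and a :: complex
  assume "w \<in> snd (slit_chart A c) ` fst (slit_chart A c)" and a: "a \<noteq> 0"
  then obtain p v where u: "(p, v) \<in> fst (slit_chart A c)" "w = snd (slit_chart A c) (p, v)" by auto
  have T: "(p, v) \<in> T10 A" using u(1) by (auto simp: slit_chart_domain T10_def)
  \<comment> \<open>Scaling by \<open>a\<close> stays inside the chart domain, since coordinate changes are complex linear.\<close>
  have nz: "(\<lambda>d. a *s v d) c \<noteq> 0" using slit_component_nonzero[OF c u(1)] a by (simp add: vec_eq_iff)
  then have "(\<lambda>d. a *s v d) \<noteq> 0" by (metis zero_fun_apply)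
  then have au: "(p, \<lambda>d. a *s v d) \<in> fst (slit_chart A c)"
    using u(1) scale_in_tangent_space by (simp add: slit_chart_domain)
  have E: "energy A F c (snd (slit_chart A c) q) = (F q)\<^sup>2" if "q \<in> fst (slit_chart A c)" for q
    unfolding energy_def by (rule slit.local_rep_apply[OF slit_chart_in[OF c] that])
  have "F (p, \<lambda>d. a *s v d) = cmod a * F (p, v)"
    using F T unfolding strongly_convex_complex_Finsler_def by blast
  moreover have "(fst w, realify (a *s complexify (snd w))) = snd (slit_chart A c) (p, \<lambda>d. a *s v d)"
    unfolding u(2) slit_chart_apply by simp
  ultimately show "energy A F c (fst w, realify (a *s complexify (snd w))) = (cmod a)\<^sup>2 * energy A F c w"
    using E[OF au] E[OF u(1)] unfolding u(2) by (simp add: power_mult_distrib)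
qed


section \<open>Frames and smooth sections of the vertical bundle\<close>

lemma ddy_component:
  "c \<in> A \<Longrightarrow> u \<in> fst (slit_chart A c) \<Longrightarrow> ddy A c j u (slit_chart A c) = (0, axis j 1)"
  unfolding ddy_def by (rule slit.tvec_of_self[OF slit_chart_in])

lemma ddy_tangent:
  "c \<in> A \<Longrightarrow> u \<in> fst (slit_chart A c) \<Longrightarrow> ddy A c j u \<in> tangent_space (slit_atlas A) u"
  unfolding ddy_def by (rule slit.tvec_of_in_tangent_space[OF slit_chart_in])

lemma ddy_VR:
  assumes "c \<in> A" "u \<in> fst (slit_chart A c)"
  shows "ddy A c j u \<in> VR A u"
  unfolding VR_iff[OF assms] using ddy_tangent[OF assms] ddy_component[OF assms] by simp

lemma VR_eqI:
  assumes "c \<in> A" "u \<in> fst (slit_chart A c)" "X \<in> VR A u" "Y \<in> VR A u"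
    "snd (X (slit_chart A c)) = snd (Y (slit_chart A c))"
  shows "X = Y"
proof (rule slit.tangent_space_eqI[OF _ _ slit_chart_in assms(2)])
  show "X (slit_chart A c) = Y (slit_chart A c)"
    using assms VR_iff[OF assms(1,2)] by (simp add: prod_eq_iff)
qed (use assms VR_subset in auto)

lemma JJ_ddy:
  assumes c: "c \<in> A" "u \<in> fst (slit_chart A c)"
  shows "JJ (ddy A c (Inl \<alpha>) u) = ddy A c (Inr \<alpha>) u"
  by (rule VR_eqI[OF c JJ_VR[OF ddy_VR[OF c] c] ddy_VR[OF c]])
    (simp add: JJ_def ddy_component[OF c] Jvec_axis)

lemma VR_zero: "c \<in> A \<Longrightarrow> u \<in> fst (slit_chart A c) \<Longrightarrow> 0 \<in> VR A u"
  by (simp add: VR_iff slit.tangent_space_zero)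

lemma VR_add:
  assumes "c \<in> A" "u \<in> fst (slit_chart A c)" "X \<in> VR A u" "Y \<in> VR A u"
  shows "X + Y \<in> VR A u"
  using assms slit.tangent_space_add by (simp add: VR_iff)

lemma VR_scale:
  assumes "c \<in> A" "u \<in> fst (slit_chart A c)" "X \<in> VR A u"
  shows "scale_tvec a X \<in> VR A u"
  using assms slit.tangent_space_scale by (simp add: VR_iff scale_tvec_apply)

lemma VR_minus:
  assumes "c \<in> A" "u \<in> fst (slit_chart A c)" "X \<in> VR A u"
  shows "- X \<in> VR A u"
  using VR_scale[OF assms, of "- 1"] by (simp add: scale_tvec_minus_one)

lemma VR_sum:
  assumes "c \<in> A" "u \<in> fst (slit_chart A c)" "\<And>i. i \<in> I \<Longrightarrow> X i \<in> VR A u"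
  shows "(\<Sum>i\<in>I. X i) \<in> VR A u"
  using assms(3)
  by (induction I rule: infinite_finite_induct) (auto intro: VR_zero[OF assms(1,2)] VR_add[OF assms(1,2)])

lemma open_image: "c \<in> A \<Longrightarrow> open_set (slit_atlas A) W \<Longrightarrow> W \<subseteq> fst (slit_chart A c) \<Longrightarrow>
    open (snd (slit_chart A c) ` W)"
  using slit_chart_in unfolding open_set_def by (metis inf.absorb_iff1)

text \<open>The horizontal components vanish, so only the fibre components have to be smooth.\<close>

lemma smooth_VR_sectionI:
  assumes c: "c \<in> A" and W: "open_set (slit_atlas A) W" "W \<subseteq> fst (slit_chart A c)"
    and Y: "\<And>q. q \<in> W \<Longrightarrow> Y q \<in> VR A q"
    and sm: "smooth_on (snd (slit_chart A c) ` W) (local_rep (slit_chart A c) (\<lambda>q. snd (Y q (slit_chart A c))))"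
  shows "smooth_section (slit_atlas A) (VR A) W Y"
proof (rule slit.smooth_sectionI[OF slit_chart_in[OF c] W(2) Y])
  let ?b = "slit_chart A c"
  note o = open_image[OF c W]
  have "bounded_linear (\<lambda>\<eta>. (0 :: 'n rvec, \<eta> :: 'n rvec))"
    by (intro bounded_linear_Pair bounded_linear_zero bounded_linear_ident)
  from smooth_on_bounded_linear_comp[OF o this sm]
  have "smooth_on (snd ?b ` W) (local_rep ?b (\<lambda>q. (0 :: 'n rvec, snd (Y q ?b))))"
    by (simp add: o_def)
  then show "smooth_on (snd ?b ` W) (local_rep ?b (\<lambda>q. Y q ?b))"
  proof (rule slit.smooth_on_local_rep_cong[OF slit_chart_in[OF c] W(2) o, rotated])
    fix q assume "q \<in> W"
    then show "(0, snd (Y q ?b)) = Y q ?b"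
      using VR_iff[OF c, of q "Y q"] Y W(2) by (auto simp: prod_eq_iff)
  qed
qed

lemma smooth_section_ddy:
  assumes c: "c \<in> A" and W: "open_set (slit_atlas A) W" "W \<subseteq> fst (slit_chart A c)"
  shows "smooth_section (slit_atlas A) (VR A) W (ddy A c j)"
proof (rule smooth_VR_sectionI[OF c W])
  let ?b = "slit_chart A c"
  note o = open_image[OF c W]
  have "local_rep ?b (\<lambda>q. axis j 1 :: 'n rvec) = (\<lambda>_. axis j 1)" by (simp add: fun_eq_iff)
  then have "smooth_on (snd ?b ` W) (local_rep ?b (\<lambda>q. axis j 1 :: 'n rvec))" by simp
  then show "smooth_on (snd ?b ` W) (local_rep ?b (\<lambda>q. snd (ddy A c j q ?b)))"
    by (rule slit.smooth_on_local_rep_cong[OF slit_chart_in[OF c] W(2) o, rotated])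
      (use ddy_component[OF c] W(2) in auto)
qed (use ddy_VR[OF c] W(2) in blast)

lemma sum_scale_ddy_component:
  assumes "c \<in> A" "u \<in> fst (slit_chart A c)"
  shows "(\<Sum>k\<in>UNIV. scale_tvec (a k) (ddy A c k u)) (slit_chart A c) = (0, \<chi> k. a k)"
proof -
  have "(\<Sum>k\<in>UNIV. scale_tvec (a k) (ddy A c k u)) (slit_chart A c)
      = (\<Sum>k\<in>UNIV. (0, (\<chi> k. a k) $ k *\<^sub>R axis k 1))"
    by (simp add: sum_fun_apply scale_tvec_apply ddy_component[OF assms])
  also have "\<dots> = (0, \<chi> k. a k)"
    using basis_expansion[of "\<chi> k. a k"]
    by (simp add: prod_eq_iff fst_sum snd_sum scalar_mult_eq_scaleR)
  finally show ?thesis .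
qed


lemma smooth_section_in_slit_chart:
  assumes "smooth_section (slit_atlas A) E W Y" "u \<in> W"
  obtains c where "c \<in> A" "u \<in> fst (slit_chart A c)"
    "smooth_on (snd (slit_chart A c) ` (W \<inter> fst (slit_chart A c)))
      (local_rep (slit_chart A c) (\<lambda>q. Y q (slit_chart A c)))"
proof -
  obtain b where b: "b \<in> slit_atlas A" "u \<in> fst b"
      "smooth_on (snd b ` (W \<inter> fst b)) (local_rep b (\<lambda>q. Y q b))"
    using assms unfolding smooth_section_def by blast
  then obtain c where "c \<in> A" "b = slit_chart A c" unfolding slit_atlas_def by blast
  then show thesis using that b by blast
qed

lemma smooth_section_linear_image:
  assumes W: "open_set (slit_atlas A) W" and Y: "smooth_section (slit_atlas A) (VR A) W Y"
    and h: "bounded_linear h" and comp: "\<And>X b. H X b = h (X b)"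
    and VR: "\<And>c u X. c \<in> A \<Longrightarrow> u \<in> fst (slit_chart A c) \<Longrightarrow> X \<in> VR A u \<Longrightarrow> H X \<in> VR A u"
  shows "smooth_section (slit_atlas A) (VR A) W (\<lambda>q. H (Y q))"
  unfolding smooth_section_def
proof (intro conjI ballI)
  fix u assume u: "u \<in> W"
  obtain c where c: "c \<in> A" "u \<in> fst (slit_chart A c)"
    "smooth_on (snd (slit_chart A c) ` (W \<inter> fst (slit_chart A c)))
      (local_rep (slit_chart A c) (\<lambda>q. Y q (slit_chart A c)))"
    using smooth_section_in_slit_chart[OF Y u] by blast
  have "Y u \<in> VR A u" using Y u unfolding smooth_section_def by blast
  then show "H (Y u) \<in> VR A u" by (rule VR[OF c(1,2)])
  have "open (snd (slit_chart A c) ` (W \<inter> fst (slit_chart A c)))"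
    using W slit_chart_in[OF c(1)] unfolding open_set_def by blast
  from smooth_on_bounded_linear_comp[OF this h c(3)]
  have "smooth_on (snd (slit_chart A c) ` (W \<inter> fst (slit_chart A c)))
      (local_rep (slit_chart A c) (\<lambda>q. H (Y q) (slit_chart A c)))"
    by (simp add: o_def comp)
  then show "\<exists>b\<in>slit_atlas A. u \<in> fst b \<and>
      smooth_on (snd b ` (W \<inter> fst b)) (local_rep b (\<lambda>q. H (Y q) b))"
    using slit_chart_in[OF c(1)] c(2) by blast
qed

lemma smooth_section_JJ:
  assumes "open_set (slit_atlas A) W" "smooth_section (slit_atlas A) (VR A) W Y"
  shows "smooth_section (slit_atlas A) (VR A) W (\<lambda>q. JJ (Y q))"
proof (rule smooth_section_linear_image[OF assms])
  show "bounded_linear (\<lambda>x :: 'n tcoord. (Jvec (fst x), Jvec (snd x)))"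
    by (intro bounded_linear_Pair bounded_linear_compose[OF bounded_linear_Jvec]
        bounded_linear_fst bounded_linear_snd)
  show "JJ X b = (Jvec (fst (X b)), Jvec (snd (X b)))" for X :: "('a, 'n) rtan" and b
    by (simp add: JJ_def)
qed (rule JJ_VR)

lemma smooth_section_minus:
  assumes "open_set (slit_atlas A) W" "smooth_section (slit_atlas A) (VR A) W Y"
  shows "smooth_section (slit_atlas A) (VR A) W (\<lambda>q. - Y q)"
  by (rule smooth_section_linear_image[where H = uminus, OF assms bounded_linear_minus[OF bounded_linear_ident]])
    (simp_all add: VR_minus)


section \<open>The Cartan connection of a metric with parallel complex structure\<close>

lemma nabla_J_zeroD:
  assumes "nabla_J_zero A nab" "open_set (slit_atlas A) W" "smooth_section (slit_atlas A) (VR A) W Y"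
    "u \<in> W" "X \<in> tangent_space (slit_atlas A) u"
  shows "nab u X (\<lambda>q. JJ (Y q)) = JJ (nab u X Y)"
  using assms(1)[unfolded nabla_J_zero_def, THEN spec, THEN spec, THEN mp, OF conjI[OF assms(2,3)],
      THEN bspec, OF assms(4), THEN bspec, OF assms(5)]
  by simp

lemma Cartan_frame_components:
  assumes nab: "Cartan_connection A F nab" and c: "c \<in> A" and u: "u \<in> fst (slit_chart A c)"
  shows "nab u (deltadx A F c l u) (ddy A c j) (slit_chart A c)
      = (0, \<chi> k. Gamma_hor (energy A F c) k j l (snd (slit_chart A c) u))"
    and "nab u (ddy A c l u) (ddy A c j) (slit_chart A c)
      = (0, \<chi> k. Gamma_ver (energy A F c) k j l (snd (slit_chart A c) u))"
proof -
  note frame = nab[unfolded Cartan_connection_def, THEN conjunct2, rule_format, OF c u, of l j]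
  show "nab u (deltadx A F c l u) (ddy A c j) (slit_chart A c)
      = (0, \<chi> k. Gamma_hor (energy A F c) k j l (snd (slit_chart A c) u))"
    unfolding frame[THEN conjunct1] by (rule sum_scale_ddy_component[OF c u])
  show "nab u (ddy A c l u) (ddy A c j) (slit_chart A c)
      = (0, \<chi> k. Gamma_ver (energy A F c) k j l (snd (slit_chart A c) u))"
    unfolding frame[THEN conjunct2] by (rule sum_scale_ddy_component[OF c u])
qed

text \<open>The hypothesis on all sections is applied to the frame fields \<open>\<partial>/\<partial>y\<^sup>\<alpha>\<close>, which \<open>J\<close> maps to
  \<open>\<partial>/\<partial>y\<^sup>\<alpha>\<^sup>*\<close>.\<close>

lemma local_J_parallel_energy:
  assumes F: "strongly_convex_complex_Finsler A F" and nab: "Cartan_connection A F nab"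
    and J: "nabla_J_zero A nab" and c: "c \<in> A"
  shows "local_J_parallel (energy A F c) (snd (slit_chart A c) ` fst (slit_chart A c))"
proof -
  let ?b = "slit_chart A c"
  interpret local_Finsler "energy A F c" "snd ?b ` fst ?b" by (rule energy_local_Finsler[OF F c])
  have lin: "linear_connection (slit_atlas A) (VR A) nab"
    using nab unfolding Cartan_connection_def by blast
  note W = slit.open_set_chart[OF slit_chart_in[OF c]]
  have comm: "nab u X (ddy A c (Inr \<alpha>)) = JJ (nab u X (ddy A c (Inl \<alpha>)))"
    if u: "u \<in> fst ?b" and X: "X \<in> tangent_space (slit_atlas A) u" for u X \<alpha>
  proof -
    have "nab u X (\<lambda>q. JJ (ddy A c (Inl \<alpha>) q)) = nab u X (ddy A c (Inr \<alpha>))"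
      by (rule connection_cong[OF lin W smooth_section_ddy[OF c W order_refl] _ u X])
        (rule JJ_ddy[OF c])
    then show ?thesis
      using nabla_J_zeroD[OF J W smooth_section_ddy[OF c W order_refl] u X] by simp
  qed
  have comp: "snd (nab u X (ddy A c (Inr \<alpha>)) ?b) = Jvec (snd (nab u X (ddy A c (Inl \<alpha>)) ?b))"
    if "u \<in> fst ?b" "X \<in> tangent_space (slit_atlas A) u" for u X \<alpha>
    unfolding comm[OF that] by (simp add: JJ_def)
  show ?thesis
  proof
    fix w \<alpha> l assume "w \<in> snd ?b ` fst ?b"
    then obtain u where u: "u \<in> fst ?b" "w = snd ?b u" by blast
    show "(\<chi> k. Gamma_ver (energy A F c) k (Inr \<alpha>) l w) = Jvec (\<chi> k. Gamma_ver (energy A F c) k (Inl \<alpha>) l w)"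
      using comp[OF u(1) ddy_tangent[OF c u(1), of l], of \<alpha>]
      unfolding Cartan_frame_components[OF nab c u(1)] u(2) by simp
    have "deltadx A F c l u \<in> tangent_space (slit_atlas A) u"
      unfolding deltadx_def by (rule slit.tvec_of_in_tangent_space[OF slit_chart_in[OF c] u(1)])
    from comp[OF u(1) this, of \<alpha>]
    show "(\<chi> k. Gamma_hor (energy A F c) k (Inr \<alpha>) l w) = Jvec (\<chi> k. Gamma_hor (energy A F c) k (Inl \<alpha>) l w)"
      unfolding Cartan_frame_components[OF nab c u(1)] u(2) by simp
  qed
qed

text \<open>Vertical directions contribute nothing, so \<open>\<partial>/\<partial>x\<^sup>l\<close> may be replaced by its horizontal lift.\<close>

lemma nab_ddy_component:
  assumes F: "strongly_convex_complex_Finsler A F" and nab: "Cartan_connection A F nab"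
    and J: "nabla_J_zero A nab" and c: "c \<in> A" and u: "u \<in> fst (slit_chart A c)"
    and X: "X \<in> tangent_space (slit_atlas A) u"
  shows "nab u X (ddy A c j) (slit_chart A c) = (0, \<Sum>l\<in>UNIV. fst (X (slit_chart A c)) $ l *\<^sub>R
      (\<chi> k. Gamma_hor (energy A F c) k j l (snd (slit_chart A c) u)))"
proof -
  let ?b = "slit_chart A c" let ?w = "snd ?b u"
  interpret local_J_parallel "energy A F c" "snd ?b ` fst ?b"
    by (rule local_J_parallel_energy[OF F nab J c])
  have lin: "linear_connection (slit_atlas A) (VR A) nab"
    using nab unfolding Cartan_connection_def by blast
  note W = slit.open_set_chart[OF slit_chart_in[OF c]]
  define \<phi> where "\<phi> e = nab u (tvec_of (slit_atlas A) ?b u e) (ddy A c j) ?b" for e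
  have \<phi>: "linear \<phi>"
    unfolding \<phi>_def[abs_def]
    by (rule slit.connection_linear_in_components[OF lin W smooth_section_ddy[OF c W order_refl] u
          slit_chart_in[OF c] u])
  have ver: "\<phi> (0, axis l 1) = 0" for l
    using Cartan_frame_components(2)[OF nab c u, of l j] Gamma_ver_eq_0[OF imageI[OF u]]
    by (simp add: \<phi>_def ddy_def zero_prod_def vec_eq_iff)
  have ver0: "\<phi> (0, \<eta>) = 0" for \<eta>
  proof -
    have "(0, \<eta>) = (\<Sum>l\<in>UNIV. \<eta> $ l *\<^sub>R ((0, axis l 1) :: 'n tcoord))"
      using basis_expansion[of \<eta>] by (simp add: prod_eq_iff fst_sum snd_sum scalar_mult_eq_scaleR)
    then show ?thesis by (simp only: linear_sum[OF \<phi>] linear_cmul[OF \<phi>] ver) simp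
  qed
  have hor: "\<phi> (axis l 1, 0) = (0, \<chi> k. Gamma_hor (energy A F c) k j l ?w)" for l
  proof -
    let ?N = "\<chi> k. Nhat (energy A F c) k l ?w"
    have "\<phi> (axis l 1, 0) = \<phi> (axis l 1, - ?N) + \<phi> (0, ?N)"
      by (simp add: linear_add[OF \<phi>, symmetric])
    moreover have "\<phi> (axis l 1, - ?N) = (0, \<chi> k. Gamma_hor (energy A F c) k j l ?w)"
      using Cartan_frame_components(1)[OF nab c u, of l j] unfolding \<phi>_def deltadx_def .
    ultimately show ?thesis by (simp add: ver0)
  qed
  have "nab u X (ddy A c j) ?b = \<phi> (X ?b)"
    unfolding \<phi>_def slit.tvec_of_component[OF X slit_chart_in[OF c] u] ..
  also have "X ?b = (\<Sum>l\<in>UNIV. fst (X ?b) $ l *\<^sub>R ((axis l 1, 0) :: 'n tcoord)) + (0, snd (X ?b))"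
    using basis_expansion[of "fst (X ?b)"] by (simp add: prod_eq_iff fst_sum snd_sum scalar_mult_eq_scaleR)
  also have "\<phi> \<dots> = (\<Sum>l\<in>UNIV. fst (X ?b) $ l *\<^sub>R (0, \<chi> k. Gamma_hor (energy A F c) k j l ?w))"
    by (simp only: linear_add[OF \<phi>] linear_sum[OF \<phi>] linear_cmul[OF \<phi>] hor ver0 add_0_right)
  also have "\<dots> = (0, \<Sum>l\<in>UNIV. fst (X ?b) $ l *\<^sub>R (\<chi> k. Gamma_hor (energy A F c) k j l ?w))"
    by (simp add: prod_eq_iff fst_sum snd_sum)
  finally show ?thesis .
qed

text \<open>The section is expanded as \<open>\<Sum>\<^sub>j Y\<^sup>j \<partial>/\<partial>y\<^sup>j\<close>, and the Leibniz rule applied to each term.\<close>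

lemma nab_section_component:
  assumes F: "strongly_convex_complex_Finsler A F" and nab: "Cartan_connection A F nab"
    and J: "nabla_J_zero A nab" and c: "c \<in> A"
    and W: "open_set (slit_atlas A) W" "W \<subseteq> fst (slit_chart A c)"
    and Y: "smooth_section (slit_atlas A) (VR A) W Y"
    and sm: "smooth_on (snd (slit_chart A c) ` W) (local_rep (slit_chart A c) (\<lambda>q. snd (Y q (slit_chart A c))))"
    and u: "u \<in> W" and X: "X \<in> tangent_space (slit_atlas A) u"
  shows "snd (nab u X Y (slit_chart A c)) =
    (\<chi> j. frechet_derivative (local_rep (slit_chart A c) (\<lambda>q. snd (Y q (slit_chart A c)) $ j))
        (at (snd (slit_chart A c) u)) (X (slit_chart A c)))
    + (\<Sum>j\<in>UNIV. snd (Y u (slit_chart A c)) $ j *\<^sub>R (\<Sum>l\<in>UNIV. fst (X (slit_chart A c)) $ l *\<^sub>R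
        (\<chi> k. Gamma_hor (energy A F c) k j l (snd (slit_chart A c) u))))"
proof -
  let ?b = "slit_chart A c"
  have lin: "linear_connection (slit_atlas A) (VR A) nab"
    using nab unfolding Cartan_connection_def by blast
  have ub: "u \<in> fst ?b" using u W by blast
  note bA = slit_chart_in[OF c] and o = open_image[OF c W]
  define f where "f j q = snd (Y q ?b) $ j" for j q
  define T where "T j q = scale_tvec (f j q) (ddy A c j q)" for j q
  have sf: "smooth_on (snd ?b ` W) (local_rep ?b (f j))" for j
    using smooth_on_bounded_linear_comp[OF o bounded_linear_vec_nth sm] by (simp add: f_def[abs_def] o_def)
  have T_comp: "T j q ?b = (0, f j q *\<^sub>R axis j 1)" if "q \<in> fst ?b" for j q
    by (simp add: T_def scale_tvec_apply ddy_component[OF c that])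
  have part: "smooth_section (slit_atlas A) (VR A) W (\<lambda>q. \<Sum>j\<in>I. T j q)" for I
  proof (rule smooth_VR_sectionI[OF c W])
    show "(\<Sum>j\<in>I. T j q) \<in> VR A q" if "q \<in> W" for q
      unfolding T_def using that W(2) by (intro VR_sum[OF c] VR_scale[OF c] ddy_VR[OF c]) blast+
    have "smooth_on (snd ?b ` W) (\<lambda>x. \<Sum>j\<in>I. local_rep ?b (f j) x *\<^sub>R (axis j 1 :: 'n rvec))"
      by (intro smooth_on_sum[OF o] smooth_on_bounded_linear_comp[OF o bounded_linear_scaleR_left] sf)
    then have "smooth_on (snd ?b ` W) (local_rep ?b (\<lambda>q. \<Sum>j\<in>I. f j q *\<^sub>R (axis j 1 :: 'n rvec)))"
      by (simp add: o_def)
    then show "smooth_on (snd ?b ` W) (local_rep ?b (\<lambda>q. snd ((\<Sum>j\<in>I. T j q) ?b)))"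
      by (rule slit.smooth_on_local_rep_cong[OF bA W(2) o, rotated])
        (use W(2) T_comp in \<open>auto simp: sum_fun_apply snd_sum subset_eq\<close>)
  qed
  have expand: "Y q = (\<Sum>j\<in>UNIV. T j q)" if q: "q \<in> W" for q
  proof -
    have qb: "q \<in> fst ?b" using q W by blast
    have YV: "Y q \<in> VR A q" using Y q unfolding smooth_section_def by blast
    show ?thesis
      unfolding T_def
    proof (rule VR_eqI[OF c qb YV])
      show "(\<Sum>j\<in>UNIV. scale_tvec (f j q) (ddy A c j q)) \<in> VR A q"
        by (intro VR_sum[OF c qb] VR_scale[OF c qb] ddy_VR[OF c qb])
      show "snd (Y q ?b) = snd ((\<Sum>j\<in>UNIV. scale_tvec (f j q) (ddy A c j q)) ?b)"
        unfolding sum_scale_ddy_component[OF c qb] by (simp add: f_def vec_eq_iff)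
    qed
  qed
  have one: "nab u X (T j) = scale_tvec (frechet_derivative (local_rep ?b (f j)) (at (snd ?b u)) (X ?b)) (ddy A c j u)
      + scale_tvec (f j u) (nab u X (ddy A c j))" for j
    unfolding T_def
    by (rule connection_Leibniz[OF lin W(1) smooth_section_ddy[OF c W] slit.smooth_funI[OF bA W(2) sf] u X bA ub])
  have sum: "nab u X (\<lambda>q. \<Sum>j\<in>I. T j q) = (\<Sum>j\<in>I. nab u X (T j))" if "finite I" for I
    using that
  proof (induction I rule: finite_induct)
    case empty
    have "nab u X (\<lambda>q. 0) = 0"
      using connection_add[OF lin W(1) part[of "{}"] part[of "{}"] u X] by simp
    then show ?case unfolding sum.empty .
  next
    case (insert j I)
    have "smooth_section (slit_atlas A) (VR A) W (T j)" using part[of "{j}"] by simp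
    from connection_add[OF lin W(1) this part[of I] u X] show ?case
      unfolding sum.insert[OF insert.hyps] insert.IH .
  qed
  have "nab u X Y = (\<Sum>j\<in>UNIV. nab u X (T j))"
    unfolding sum[OF finite, symmetric]
    by (rule connection_cong[OF lin W(1) part expand u X])
  then have "snd (nab u X Y ?b) = (\<Sum>j\<in>UNIV.
      frechet_derivative (local_rep ?b (f j)) (at (snd ?b u)) (X ?b) *\<^sub>R axis j 1
      + f j u *\<^sub>R (\<Sum>l\<in>UNIV. fst (X ?b) $ l *\<^sub>R (\<chi> k. Gamma_hor (energy A F c) k j l (snd ?b u))))"
    by (simp add: one sum_fun_apply snd_sum scale_tvec_apply ddy_component[OF c ub]
        nab_ddy_component[OF F nab J c ub X])
  also have "\<dots> = (\<chi> j. frechet_derivative (local_rep ?b (f j)) (at (snd ?b u)) (X ?b))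
      + (\<Sum>j\<in>UNIV. f j u *\<^sub>R (\<Sum>l\<in>UNIV. fst (X ?b) $ l *\<^sub>R (\<chi> k. Gamma_hor (energy A F c) k j l (snd ?b u))))"
    using basis_expansion[of "\<chi> j. frechet_derivative (local_rep ?b (f j)) (at (snd ?b u)) (X ?b)"]
    by (simp add: sum.distrib scalar_mult_eq_scaleR)
  finally show ?thesis unfolding f_def[abs_def] .
qed


section \<open>Sections of type (1,0) and the Chern-Finsler connection\<close>

text \<open>For \<open>V = \<Sum>\<^sub>\<beta> w\<^sub>\<beta> \<partial>/\<partial>v\<^sup>\<beta>\<close> this is \<open>w / 2\<close>: it reads the real part of \<open>V\<close> in complex fibre coordinates.
  On \<open>V\<^sup>1\<^sup>,\<^sup>0\<close> it is a complex linear isomorphism.\<close>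

definition half_component :: "('a, complex^'n) chart \<Rightarrow> ('a, 'n) ctan \<Rightarrow> complex^'n" where
  "half_component c V = complexify (snd (fst V (slit_chart A c)))"

lemma V10_eqI:
  assumes c: "c \<in> A" "u \<in> fst (slit_chart A c)" and V: "V \<in> V10 A u" "V' \<in> V10 A u"
    and eq: "half_component c V = half_component c V'"
  shows "V = V'"
proof -
  have "snd (fst V (slit_chart A c)) = snd (fst V' (slit_chart A c))"
    using arg_cong[OF eq, of realify] by (simp add: half_component_def)
  then have "fst V = fst V'" using VR_eqI[OF c] V V10_iff[OF c] by blast
  then show ?thesis using V V10_iff[OF c] by (simp add: prod_eq_iff)
qed

lemma JJ_add: "JJ (X + Y) = JJ X + JJ Y"
  and JJ_scale: "JJ (scale_tvec a X) = scale_tvec a (JJ X)"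
  and JJ_JJ: "JJ (JJ X) = - X"
  and JJ_minus: "JJ (- X) = - JJ X"
  and JJ_zero: "JJ 0 = 0"
  by (simp_all add: JJ_def fun_eq_iff scale_tvec_def linear_add[OF linear_Jvec]
      linear_cmul[OF linear_Jvec] linear_neg[OF linear_Jvec] linear_0[OF linear_Jvec] zero_prod_def prod_eq_iff)

lemma scale_ctvec_eq: "scale_ctvec a V = (scale_tvec (Re a) (fst V) + scale_tvec (- Im a) (snd V),
    scale_tvec (Re a) (snd V) + scale_tvec (Im a) (fst V))"
  by (simp add: scale_ctvec_def scale_tvec_def fun_eq_iff)

lemma V10_zero: "c \<in> A \<Longrightarrow> u \<in> fst (slit_chart A c) \<Longrightarrow> 0 \<in> V10 A u"
  by (simp add: V10_iff VR_zero JJ_zero)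

lemma V10_add:
  assumes c: "c \<in> A" "u \<in> fst (slit_chart A c)" and "V \<in> V10 A u" "V' \<in> V10 A u"
  shows "V + V' \<in> V10 A u"
  using assms(3,4) VR_add[OF c] unfolding V10_iff[OF c] by (simp add: JJ_add)

lemma V10_scale:
  assumes c: "c \<in> A" "u \<in> fst (slit_chart A c)" and V: "V \<in> V10 A u"
  shows "scale_ctvec a V \<in> V10 A u"
proof -
  have Y: "fst V \<in> VR A u" "snd V = - JJ (fst V)" using V V10_iff[OF c] by blast+
  have "scale_tvec (Re a) (fst V) + scale_tvec (- Im a) (snd V) \<in> VR A u"
    unfolding Y(2) by (intro VR_add[OF c] VR_scale[OF c] VR_minus[OF c] JJ_VR[OF _ c] Y(1))
  moreover have "scale_tvec (Re a) (snd V) + scale_tvec (Im a) (fst V)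
      = - JJ (scale_tvec (Re a) (fst V) + scale_tvec (- Im a) (snd V))"
    unfolding Y(2) JJ_add JJ_scale JJ_minus JJ_JJ by (simp add: scale_tvec_def fun_eq_iff)
  ultimately show ?thesis unfolding V10_iff[OF c] scale_ctvec_eq by simp
qed

lemma V10_sum:
  assumes c: "c \<in> A" "u \<in> fst (slit_chart A c)" and "\<And>i. i \<in> I \<Longrightarrow> V i \<in> V10 A u"
  shows "(\<Sum>i\<in>I. V i) \<in> V10 A u"
  using assms(3)
  by (induction I rule: infinite_finite_induct) (auto intro: V10_zero[OF c] V10_add[OF c])

lemma half_component_add: "half_component c (V + V') = half_component c V + half_component c V'"
  by (simp add: half_component_def linear_add[OF linear_complexify])

lemma half_component_zero: "half_component c 0 = 0"
  by (simp add: half_component_def linear_0[OF linear_complexify])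

lemma half_component_sum: "half_component c (\<Sum>i\<in>I. V i) = (\<Sum>i\<in>I. half_component c (V i))"
  by (induction I rule: infinite_finite_induct) (simp_all add: half_component_add half_component_zero)

lemma half_component_scale:
  assumes c: "c \<in> A" "u \<in> fst (slit_chart A c)" and V: "V \<in> V10 A u"
  shows "half_component c (scale_ctvec a V) = a *s half_component c V"
proof -
  have Y: "snd V = - JJ (fst V)" using V V10_iff[OF c] by blast
  have "half_component c (scale_ctvec a V) = Re a *\<^sub>R half_component c V + Im a *\<^sub>R (\<i> *s half_component c V)"
    unfolding half_component_def scale_ctvec_eq Y complexify_Jvec[symmetric]
    by (simp add: scale_tvec_def JJ_def linear_add[OF linear_complexify] linear_cmul[OF linear_complexify])
  moreover have "a *s z = Re a *\<^sub>R z + Im a *\<^sub>R (\<i> *s z)" for z :: "complex^'n"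
    by (simp add: vec_eq_iff complex_eq_iff)
  ultimately show ?thesis by simp
qed

lemma
  assumes c: "c \<in> A" "u \<in> fst (slit_chart A c)"
  shows ddv_V10: "ddv A c \<beta> u \<in> V10 A u" and half_component_ddv: "half_component c (ddv A c \<beta> u) = (1 / 2) *s axis \<beta> 1"
proof -
  let ?b = "slit_chart A c"
  have "(\<chi> k. Re (dv_vec \<beta> $ k)) = (1/2) *\<^sub>R axis (Inl \<beta>) 1"
    and "(\<chi> k. Im (dv_vec \<beta> $ k)) = - (1/2) *\<^sub>R axis (Inr \<beta>) 1"
    and "(\<chi> k. Re ((0 :: (complex, 'n + 'n) vec) $ k)) = 0"
    and "(\<chi> k. Im ((0 :: (complex, 'n + 'n) vec) $ k)) = 0"
    by (simp_all add: dv_vec_def axis_def vec_eq_iff all_sum_index)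
  then have re: "fst (ddv A c \<beta> u) = tvec_of (slit_atlas A) ?b u (0, (1/2) *\<^sub>R axis (Inl \<beta>) 1)"
    and im: "snd (ddv A c \<beta> u) = tvec_of (slit_atlas A) ?b u (0, - (1/2) *\<^sub>R axis (Inr \<beta>) 1)"
    by (simp_all only: ddv_def ctvec_of_def fst_conv snd_conv)
  have VR: "tvec_of (slit_atlas A) ?b u (0, \<eta>) \<in> VR A u" for \<eta>
    unfolding VR_iff[OF c] using slit.tvec_of_in_tangent_space[OF slit_chart_in[OF c(1)] c(2)]
      slit.tvec_of_self[OF slit_chart_in[OF c(1)] c(2)] by simp
  have "snd (ddv A c \<beta> u) = - JJ (fst (ddv A c \<beta> u))"
    unfolding re im
    by (rule VR_eqI[OF c VR VR_minus[OF c JJ_VR[OF VR c]]])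
      (simp add: JJ_def slit.tvec_of_self[OF slit_chart_in[OF c(1)] c(2)]
        linear_cmul[OF linear_Jvec] Jvec_axis)
  then show "ddv A c \<beta> u \<in> V10 A u" unfolding V10_iff[OF c] using VR re by simp
  show "half_component c (ddv A c \<beta> u) = (1 / 2) *s axis \<beta> 1"
    unfolding half_component_def re slit.tvec_of_self[OF slit_chart_in[OF c(1)] c(2)]
    by (simp add: complexify_def axis_def vec_eq_iff complex_eq_iff)
qed

text \<open>A section \<open>Y - \<i> J Y\<close> is as smooth as \<open>Y\<close>.\<close>

lemma smooth_csectionI:
  assumes c: "c \<in> A" and W: "open_set (slit_atlas A) W" "W \<subseteq> fst (slit_chart A c)"
    and V: "\<And>q. q \<in> W \<Longrightarrow> V q \<in> V10 A q"
    and sm: "smooth_on (snd (slit_chart A c) ` W) (local_rep (slit_chart A c) (\<lambda>q. half_component c (V q)))"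
  shows "smooth_csection (slit_atlas A) (V10 A) W V"
proof -
  let ?b = "slit_chart A c"
  note o = open_image[OF c W]
  have Y: "fst (V q) \<in> VR A q" "snd (V q) = - JJ (fst (V q))" if "q \<in> W" for q
    using V[OF that] V10_iff[OF c, of q "V q"] that W(2) by blast+
  have sm1: "smooth_on (snd ?b ` W) (local_rep ?b (\<lambda>q. snd (fst (V q) ?b)))"
    using smooth_on_bounded_linear_comp[OF o bounded_linear_realify sm] by (simp add: half_component_def o_def)
  have 1: "smooth_section (slit_atlas A) (VR A) W (\<lambda>q. fst (V q))"
    by (rule smooth_VR_sectionI[OF c W Y(1) sm1])
  have 2: "smooth_section (slit_atlas A) (VR A) W (\<lambda>q. snd (V q))"
  proof (rule smooth_VR_sectionI[OF c W])
    show "snd (V q) \<in> VR A q" if "q \<in> W" for q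
      unfolding Y(2)[OF that] using that W(2)
      by (intro VR_minus[OF c] JJ_VR[OF _ c] Y(1)) blast+
    have "smooth_on (snd ?b ` W) (local_rep ?b (\<lambda>q. - Jvec (snd (fst (V q) ?b))))"
      using smooth_on_bounded_linear_comp[OF o bounded_linear_minus[OF bounded_linear_Jvec] sm1]
      by (simp add: o_def)
    then show "smooth_on (snd ?b ` W) (local_rep ?b (\<lambda>q. snd (snd (V q) ?b)))"
      by (rule slit.smooth_on_local_rep_cong[OF slit_chart_in[OF c] W(2) o, rotated])
        (simp add: Y(2) JJ_def)
  qed
  show ?thesis
    unfolding smooth_csection_def
    using V 1 2 VR_subset unfolding smooth_section_def by blast
qed

text \<open>The counterpart of \<open>nab_section_component\<close>, from the expansion
  \<open>V = \<Sum>\<^sub>\<beta> f\<^sub>\<beta> \<partial>/\<partial>v\<^sup>\<beta>\<close>.\<close>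

lemma D_section_half_component:
  assumes D: "Chern_Finsler_connection A F D" and c: "c \<in> A"
    and W: "open_set (slit_atlas A) W" "W \<subseteq> fst (slit_chart A c)"
    and V: "smooth_csection (slit_atlas A) (V10 A) W V"
    and sm: "smooth_on (snd (slit_chart A c) ` W) (local_rep (slit_chart A c) (\<lambda>q. half_component c (V q)))"
    and u: "u \<in> W" and X: "X \<in> ctangent_space (slit_atlas A) u"
  shows "half_component c (D u X V) $ \<alpha> =
    frechet_derivative (local_rep (slit_chart A c) (\<lambda>q. half_component c (V q) $ \<alpha>))
        (at (snd (slit_chart A c) u)) (fst X (slit_chart A c))
    + \<i> * frechet_derivative (local_rep (slit_chart A c) (\<lambda>q. half_component c (V q) $ \<alpha>))
        (at (snd (slit_chart A c) u)) (snd X (slit_chart A c))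
    + (\<Sum>\<beta>\<in>UNIV. half_component c (V u) $ \<beta> * omega_form (energy A F c) \<alpha> \<beta>
        (snd (slit_chart A c) u) (ccomp X (slit_chart A c)))"
proof -
  let ?b = "slit_chart A c" let ?w = "snd (slit_chart A c) u"
  have lin: "complex_linear_connection (slit_atlas A) (V10 A) D"
    using D unfolding Chern_Finsler_connection_def by blast
  have ub: "u \<in> fst ?b" using u W by blast
  note bA = slit_chart_in[OF c] and o = open_image[OF c W]
  \<comment> \<open>\<open>half_component\<close> gives half of the coefficient of \<open>\<partial>/\<partial>v\<^sup>\<beta>\<close>.\<close>
  define f where "f \<beta> q = 2 * half_component c (V q) $ \<beta>" for \<beta> q
  define T where "T \<beta> q = scale_ctvec (f \<beta> q) (ddv A c \<beta> q)" for \<beta> q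
  have sc: "smooth_on (snd ?b ` W) (local_rep ?b (\<lambda>q. half_component c (V q) $ \<beta>))" for \<beta>
    using smooth_on_bounded_linear_comp[OF o bounded_linear_vec_nth sm] by (simp add: o_def)
  have sf: "smooth_on (snd ?b ` W) (local_rep ?b (f \<beta>))" for \<beta>
    using smooth_on_bounded_linear_comp[OF o bounded_linear_mult_right sc] by (simp add: f_def[abs_def] o_def)
  have df: "frechet_derivative (local_rep ?b (f \<beta>)) (at ?w) e
      = 2 * frechet_derivative (local_rep ?b (\<lambda>q. half_component c (V q) $ \<beta>)) (at ?w) e" for \<beta> e
  proof -
    have "((\<lambda>x. 2 * local_rep ?b (\<lambda>q. half_component c (V q) $ \<beta>) x) has_derivative
        (\<lambda>e. 2 * frechet_derivative (local_rep ?b (\<lambda>q. half_component c (V q) $ \<beta>)) (at ?w) e)) (at ?w)"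
      by (rule has_derivative_mult_right[OF smooth_on_has_derivative[OF sc]]) (use u in blast)
    moreover have "local_rep ?b (f \<beta>) = (\<lambda>x. 2 * local_rep ?b (\<lambda>q. half_component c (V q) $ \<beta>) x)"
      by (simp add: f_def fun_eq_iff)
    ultimately show ?thesis by (metis frechet_derivative_at)
  qed
  have T_V10: "T \<beta> q \<in> V10 A q" and T_half_component: "half_component c (T \<beta> q) = f \<beta> q *s ((1/2) *s axis \<beta> 1)"
    if "q \<in> W" for \<beta> q
  proof -
    have q: "q \<in> fst ?b" using that W by blast
    show "T \<beta> q \<in> V10 A q" unfolding T_def by (rule V10_scale[OF c q ddv_V10[OF c q]])
    show "half_component c (T \<beta> q) = f \<beta> q *s ((1/2) *s axis \<beta> 1)"
      unfolding T_def half_component_scale[OF c q ddv_V10[OF c q]] half_component_ddv[OF c q] ..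
  qed
  have bl: "bounded_linear (\<lambda>z. z *s v)" for v :: "complex^'n"
    unfolding linear_conv_bounded_linear[symmetric]
    by (rule linearI) (simp_all add: vec_eq_iff algebra_simps)
  have part: "smooth_csection (slit_atlas A) (V10 A) W (\<lambda>q. \<Sum>\<beta>\<in>I. T \<beta> q)" for I
  proof (rule smooth_csectionI[OF c W])
    show "(\<Sum>\<beta>\<in>I. T \<beta> q) \<in> V10 A q" if "q \<in> W" for q
      by (rule V10_sum[OF c]) (use that W(2) T_V10 in blast)+
    have "smooth_on (snd ?b ` W) (\<lambda>x. \<Sum>\<beta>\<in>I. local_rep ?b (f \<beta>) x *s ((1/2) *s axis \<beta> 1 :: complex^'n))"
      by (intro smooth_on_sum[OF o] smooth_on_bounded_linear_comp[OF o bl] sf)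
    then have "smooth_on (snd ?b ` W) (local_rep ?b (\<lambda>q. \<Sum>\<beta>\<in>I. f \<beta> q *s ((1/2) *s axis \<beta> 1 :: complex^'n)))"
      by (simp add: o_def)
    then show "smooth_on (snd ?b ` W) (local_rep ?b (\<lambda>q. half_component c (\<Sum>\<beta>\<in>I. T \<beta> q)))"
      by (rule slit.smooth_on_local_rep_cong[OF bA W(2) o, rotated]) (simp only: half_component_sum T_half_component)
  qed
  have sum_axis: "(\<Sum>\<beta>\<in>UNIV. a \<beta> *s axis \<beta> 1) $ \<alpha> = a \<alpha>" for a :: "'n \<Rightarrow> complex" and \<alpha>
    by (simp add: axis_def if_distrib[of "\<lambda>x. _ * x"] cong: if_cong)
  have expand: "V q = (\<Sum>\<beta>\<in>UNIV. T \<beta> q)" if q: "q \<in> W" for q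
  proof (rule V10_eqI[OF c])
    show "V q \<in> V10 A q" using V q unfolding smooth_csection_def by blast
    show "(\<Sum>\<beta>\<in>UNIV. T \<beta> q) \<in> V10 A q"
      by (rule V10_sum[OF c]) (use that W(2) T_V10 in blast)+
    show "half_component c (V q) = half_component c (\<Sum>\<beta>\<in>UNIV. T \<beta> q)"
      unfolding half_component_sum T_half_component[OF q] using basis_expansion[of "half_component c (V q)"]
      by (simp add: f_def)
  qed (use q W in blast)
  have one: "D u X (T \<beta>) = scale_ctvec (frechet_derivative (local_rep ?b (f \<beta>)) (at ?w) (fst X ?b)
        + \<i> * frechet_derivative (local_rep ?b (f \<beta>)) (at ?w) (snd X ?b)) (ddv A c \<beta> u)
      + scale_ctvec (f \<beta> u) (D u X (ddv A c \<beta>))" for \<beta>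
  proof -
    have ddv: "smooth_csection (slit_atlas A) (V10 A) W (ddv A c \<beta>)"
    proof (rule smooth_csectionI[OF c W])
      show "ddv A c \<beta> q \<in> V10 A q" if "q \<in> W" for q using ddv_V10[OF c] W that by blast
      have "local_rep ?b (\<lambda>q. (1/2) *s axis \<beta> 1 :: complex^'n) = (\<lambda>_. (1/2) *s axis \<beta> 1)"
        by (simp add: fun_eq_iff)
      then have "smooth_on (snd ?b ` W) (local_rep ?b (\<lambda>q. (1/2) *s axis \<beta> 1 :: complex^'n))"
        by simp
      then show "smooth_on (snd ?b ` W) (local_rep ?b (\<lambda>q. half_component c (ddv A c \<beta> q)))"
      proof (rule slit.smooth_on_local_rep_cong[OF bA W(2) o, rotated])
        fix q assume "q \<in> W"
        then have "q \<in> fst ?b" using W by blast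
        then show "(1/2) *s axis \<beta> 1 = half_component c (ddv A c \<beta> q)" using half_component_ddv[OF c] by metis
      qed
    qed
    show ?thesis
      unfolding T_def
      by (rule complex_connection_Leibniz[OF lin W(1) ddv slit.smooth_funI[OF bA W(2) sf] u X bA ub])
  qed
  have sum: "D u X (\<lambda>q. \<Sum>\<beta>\<in>I. T \<beta> q) = (\<Sum>\<beta>\<in>I. D u X (T \<beta>))" if "finite I" for I
    using that
  proof (induction I rule: finite_induct)
    case empty
    show ?case
      using complex_connection_add[OF lin W(1) part[of "{}"] part[of "{}"] u X] by simp
  next
    case (insert j I)
    have "smooth_csection (slit_atlas A) (V10 A) W (T j)" using part[of "{j}"] by simp
    from complex_connection_add[OF lin W(1) this part[of I] u X] insert show ?case by simp
  qed
  have DV: "D u X V = (\<Sum>\<beta>\<in>UNIV. D u X (T \<beta>))"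
    unfolding sum[OF finite, symmetric]
    by (rule complex_connection_cong[OF lin W(1) part expand u X])
  have frame: "D u X (ddv A c \<beta>) = (\<Sum>\<alpha>\<in>UNIV. scale_ctvec
      (omega_form (energy A F c) \<alpha> \<beta> ?w (ccomp X ?b)) (ddv A c \<alpha> u))" for \<beta>
    using D[unfolded Chern_Finsler_connection_def, THEN conjunct2, rule_format, OF c ub X] .
  have frame_V10: "D u X (ddv A c \<beta>) \<in> V10 A u" for \<beta>
    unfolding frame by (intro V10_sum[OF c ub] V10_scale[OF c ub] ddv_V10[OF c ub])
  have frame_half_component: "half_component c (D u X (ddv A c \<beta>)) $ \<alpha>
      = omega_form (energy A F c) \<alpha> \<beta> ?w (ccomp X ?b) / 2" for \<beta>
    unfolding frame half_component_sum half_component_scale[OF c ub ddv_V10[OF c ub]] half_component_ddv[OF c ub]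
    using sum_axis[of "\<lambda>\<alpha>. omega_form (energy A F c) \<alpha> \<beta> ?w (ccomp X ?b) / 2"] by simp
  have "half_component c (D u X V) $ \<alpha> = (\<Sum>\<beta>\<in>UNIV.
      ((frechet_derivative (local_rep ?b (\<lambda>q. half_component c (V q) $ \<beta>)) (at ?w) (fst X ?b)
        + \<i> * frechet_derivative (local_rep ?b (\<lambda>q. half_component c (V q) $ \<beta>)) (at ?w) (snd X ?b)) *s axis \<beta> 1) $ \<alpha>
      + half_component c (V u) $ \<beta> * omega_form (energy A F c) \<alpha> \<beta> ?w (ccomp X ?b))"
    unfolding DV half_component_sum sum_component one half_component_add vector_add_component
      half_component_scale[OF c ub ddv_V10[OF c ub]] half_component_scale[OF c ub frame_V10] half_component_ddv[OF c ub]
      vector_smult_component frame_half_component df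
    by (intro sum.cong refl) (simp add: f_def algebra_simps)
  then show ?thesis unfolding sum.distrib sum_axis[unfolded sum_component] .
qed


section \<open>Parallel complex structure and coincidence of the connections\<close>

text \<open>Applied to \<open>V = Y - \<i> J Y\<close> in a real direction, coincidence says that \<open>\<nabla>\<^sub>X Y - \<i> \<nabla>\<^sub>X (J Y)\<close> is of type
  \<open>(1,0)\<close>, because \<open>D\<close> takes values in \<open>V\<^sup>1\<^sup>,\<^sup>0\<close>.\<close>

lemma coincide_imp_nabla_J_zero:
  assumes lin: "linear_connection (slit_atlas A) (VR A) nab"
    and clin: "complex_linear_connection (slit_atlas A) (V10 A) D"
    and co: "coincide A nab D"
  shows "nabla_J_zero A nab"
  unfolding nabla_J_zero_def
proof (intro allI impI ballI)
  fix W and Y :: "('a, 'n) tpoint \<Rightarrow> ('a, 'n) rtan" and u X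
  assume WY: "open_set (slit_atlas A) W \<and> smooth_section (slit_atlas A) (VR A) W Y"
    and u: "u \<in> W" and X: "X \<in> tangent_space (slit_atlas A) u"
  have W: "open_set (slit_atlas A) W" and Y: "smooth_section (slit_atlas A) (VR A) W Y"
    using WY by blast+
  have chart: "\<exists>c\<in>A. q \<in> fst (slit_chart A c)" if "q \<in> W" for q
    using smooth_section_in_slit_chart[OF Y that] by blast
  have YV: "Y q \<in> VR A q" if "q \<in> W" for q using Y that unfolding smooth_section_def by blast
  define V where "V q = (Y q, - JJ (Y q))" for q
  note JY = smooth_section_JJ[OF W Y] and mJY = smooth_section_minus[OF W smooth_section_JJ[OF W Y]]
  have VV: "V q \<in> V10 A q" if q: "q \<in> W" for q
  proof -
    obtain c where "c \<in> A" "q \<in> fst (slit_chart A c)" using chart[OF q] by blast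
    then show ?thesis using V10_iff[of c q "V q"] YV[OF q] by (simp add: V_def)
  qed
  have "smooth_section (slit_atlas A) (tangent_space (slit_atlas A)) W Z"
    if "smooth_section (slit_atlas A) (VR A) W Z" for Z
    using that VR_subset unfolding smooth_section_def by blast
  then have V: "smooth_csection (slit_atlas A) (V10 A) W V"
    unfolding smooth_csection_def using VV Y mJY by (simp add: V_def)
  have X0: "(X, 0) \<in> ctangent_space (slit_atlas A) u"
    using X slit.tangent_space_zero by (simp add: ctangent_space_def)
  have "complex_extension nab u (X, 0) V = D u (X, 0) V"
    using co[unfolded coincide_def, THEN spec, THEN spec, THEN mp, OF conjI[OF W V],
        THEN bspec, OF u, THEN bspec, OF X0] .
  moreover have "complex_extension nab u (X, 0) V = (nab u X Y, - nab u X (\<lambda>q. JJ (Y q)))"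
    unfolding complex_extension_def V_def fst_conv snd_conv
      linear_connection_zero_direction[OF lin W Y u X] linear_connection_zero_direction[OF lin W mJY u X]
      linear_connection_minus[OF lin W JY u X] by simp
  ultimately have "(nab u X Y, - nab u X (\<lambda>q. JJ (Y q))) \<in> V10 A u"
    using complex_connection_in[OF clin W V u X0] by simp
  moreover obtain c where "c \<in> A" "u \<in> fst (slit_chart A c)" using chart[OF u] by blast
  ultimately have "- nab u X (\<lambda>q. JJ (Y q)) = - JJ (nab u X Y)"
    using V10_iff[of c u] by (metis fst_conv snd_conv)
  then show "nab u X (\<lambda>q. JJ (Y q)) - JJ (nab u X Y) = 0" by simp
qed

lemma frechet_derivative_complexify:
  assumes "open S" "w \<in> S" "smooth_on S \<eta>"
  shows "complexify (\<chi> j. frechet_derivative (\<lambda>x. \<eta> x $ j) (at w) e) $ \<alpha>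
    = frechet_derivative (\<lambda>x. complexify (\<eta> x) $ \<alpha>) (at w) e"
proof -
  have sm: "smooth_on S (\<lambda>x. \<eta> x $ j)" for j
    by (rule smooth_on_bounded_linear_comp[OF assms(1) bounded_linear_vec_nth assms(3)])
  show ?thesis
    by (subst frechet_derivative_Complex[OF assms(1,2) sm[of "Inl \<alpha>"] sm[of "Inr \<alpha>"]])
      (simp_all add: complexify_def)
qed

text \<open>Both sides are of type \<open>(1,0)\<close>, so it is enough to compare their complex fibre components in one
  chart.  There the derivative terms agree, and the connection terms agree because the Christoffel
  symbols are complex bilinear and equal to the coefficients of the Chern-Finsler connection.\<close>

lemma nabla_J_zero_imp_coincide:
  assumes F: "strongly_convex_complex_Finsler A F" and nab: "Cartan_connection A F nab"
    and D: "Chern_Finsler_connection A F D" and J: "nabla_J_zero A nab"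
  shows "coincide A nab D"
  unfolding coincide_def
proof (intro allI impI ballI)
  fix W and V :: "('a, 'n) tpoint \<Rightarrow> ('a, 'n) ctan" and u X
  assume WV: "open_set (slit_atlas A) W \<and> smooth_csection (slit_atlas A) (V10 A) W V"
    and u: "u \<in> W" and X: "X \<in> ctangent_space (slit_atlas A) u"
  have lin: "linear_connection (slit_atlas A) (VR A) nab"
    using nab unfolding Cartan_connection_def by blast
  have clin: "complex_linear_connection (slit_atlas A) (V10 A) D"
    using D unfolding Chern_Finsler_connection_def by blast
  have "smooth_section (slit_atlas A) (tangent_space (slit_atlas A)) W (\<lambda>q. fst (V q))"
    using WV unfolding smooth_csection_def by blast
  from smooth_section_in_slit_chart[OF this u]
  obtain c where c: "c \<in> A" and ub: "u \<in> fst (slit_chart A c)"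
    and sm: "smooth_on (snd (slit_chart A c) ` (W \<inter> fst (slit_chart A c)))
      (local_rep (slit_chart A c) (\<lambda>q. fst (V q) (slit_chart A c)))"
    by blast
  let ?b = "slit_chart A c" let ?w = "snd (slit_chart A c) u"
  define U where "U = W \<inter> fst ?b"
  have U: "open_set (slit_atlas A) U" "U \<subseteq> fst ?b" and uU: "u \<in> U"
    unfolding U_def using slit.open_set_Int[OF _ slit.open_set_chart[OF slit_chart_in[OF c]]] WV u ub
    by blast+
  note o = open_image[OF c U]
  define Y where "Y q = fst (V q)" for q
  have VV: "V q \<in> V10 A q" if "q \<in> U" for q
    using WV that unfolding U_def smooth_csection_def by blast
  have YV: "Y q \<in> VR A q" and snd_V: "snd (V q) = - JJ (Y q)" if "q \<in> U" for q
    using VV[OF that] V10_iff[OF c, of q "V q"] that U(2) unfolding Y_def by blast+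
  have smY: "smooth_on (snd ?b ` U) (local_rep ?b (\<lambda>q. snd (Y q ?b)))"
    using smooth_on_bounded_linear_comp[OF o bounded_linear_snd] sm
    by (simp add: Y_def U_def o_def)
  have Ysec: "smooth_section (slit_atlas A) (VR A) U Y"
    by (rule smooth_VR_sectionI[OF c U YV smY])
  have smC: "smooth_on (snd ?b ` U) (local_rep ?b (\<lambda>q. half_component c (V q)))"
    using smooth_on_bounded_linear_comp[OF o bounded_linear_complexify smY]
    by (simp add: half_component_def Y_def o_def)
  have Vsec: "smooth_csection (slit_atlas A) (V10 A) U V"
    by (rule smooth_csectionI[OF c U VV smC])
  note JY = smooth_section_JJ[OF U(1) Ysec]
    and mJY = smooth_section_minus[OF U(1) smooth_section_JJ[OF U(1) Ysec]]
  have XT: "fst X \<in> tangent_space (slit_atlas A) u" "snd X \<in> tangent_space (slit_atlas A) u"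
    using X by (auto simp: ctangent_space_def)
  \<comment> \<open>\<open>\<nabla> J = 0\<close> reduces the imaginary part of \<open>V\<close> to its real part.\<close>
  have nab_snd: "nab u Z (\<lambda>q. snd (V q)) = - JJ (nab u Z Y)"
    if Z: "Z \<in> tangent_space (slit_atlas A) u" for Z
  proof -
    have "nab u Z (\<lambda>q. snd (V q)) = nab u Z (\<lambda>q. - JJ (Y q))"
      by (rule connection_cong[OF lin U(1) mJY snd_V uU Z])
    also have "\<dots> = - JJ (nab u Z Y)"
      unfolding linear_connection_minus[OF lin U(1) JY uU Z] nabla_J_zeroD[OF J U(1) Ysec uU Z] ..
    finally show ?thesis .
  qed
  have ext: "complex_extension nab u X V =
      (nab u (fst X) Y + JJ (nab u (snd X) Y), nab u (snd X) Y - JJ (nab u (fst X) Y))"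
    unfolding complex_extension_def nab_snd[OF XT(1)] nab_snd[OF XT(2)] Y_def[symmetric] by simp
  have in_VR: "nab u Z Y \<in> VR A u" if "Z \<in> tangent_space (slit_atlas A) u" for Z
    by (rule connection_in[OF lin U(1) Ysec uU that])
  have ext_V10: "complex_extension nab u X V \<in> V10 A u"
    unfolding ext V10_iff[OF c ub]
    using VR_add[OF c ub in_VR[OF XT(1)] JJ_VR[OF in_VR[OF XT(2)] c ub]]
    by (simp add: JJ_add JJ_JJ)
  have D_V10: "D u X V \<in> V10 A u"
    by (rule complex_connection_in[OF clin U(1) Vsec uU X])
  interpret local_J_parallel "energy A F c" "snd ?b ` fst ?b"
    by (rule local_J_parallel_energy[OF F nab J c])
  have wS: "?w \<in> snd ?b ` fst ?b" using ub by blast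
  define C where "C j l = (\<chi> k. Gamma_hor (energy A F c) k j l ?w)" for j l
  have CJ: "C (Inr \<alpha>) l = Jvec (C (Inl \<alpha>) l)" for \<alpha> l
    unfolding C_def by (rule horizontal_J[OF wS])
  have Csym: "C j l = C l j" for j l
    unfolding C_def using Gamma_hor_sym[OF wS] by (simp add: vec_eq_iff)
  let ?d = "\<lambda>\<alpha> e. frechet_derivative (local_rep ?b (\<lambda>q. half_component c (V q) $ \<alpha>)) (at ?w) e"
  have real: "complexify (snd (nab u Z Y ?b)) $ \<alpha> = ?d \<alpha> (Z ?b)
      + (\<Sum>\<beta>\<in>UNIV. half_component c (V u) $ \<beta> * (\<Sum>\<mu>\<in>UNIV. complexify (fst (Z ?b)) $ \<mu>
          * complexify (C (Inl \<beta>) (Inl \<mu>)) $ \<alpha>))"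
    if Z: "Z \<in> tangent_space (slit_atlas A) u" for Z \<alpha>
  proof -
    have "complexify (\<chi> j. frechet_derivative (local_rep ?b (\<lambda>q. snd (Y q ?b) $ j)) (at ?w) (Z ?b)) $ \<alpha>
        = ?d \<alpha> (Z ?b)"
      using frechet_derivative_complexify[OF o imageI[OF uU] smY] by (simp add: o_def half_component_def Y_def)
    then show ?thesis
      unfolding nab_section_component[OF F nab J c U Ysec smY uU Z] linear_add[OF linear_complexify]
        vector_add_component C_def[symmetric] complexify_complex_bilinear_sum[of C, OF CJ Csym]
      by (simp add: half_component_def Y_def)
  qed
  have dz: "dz_form \<mu> (ccomp X ?b) = complexify (fst (fst X ?b)) $ \<mu> + \<i> * complexify (fst (snd X ?b)) $ \<mu>" for \<mu>
    by (simp add: dz_form_def ccomp_def complexify_def complex_eq_iff)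
  have "half_component c (complex_extension nab u X V) = half_component c (D u X V)"
  proof (rule vec_eq_iff[THEN iffD2, OF allI])
    fix \<alpha>
    have "half_component c (complex_extension nab u X V)
        = complexify (snd (nab u (fst X) Y ?b)) + \<i> *s complexify (snd (nab u (snd X) Y ?b))"
      unfolding ext by (simp add: half_component_def JJ_def linear_add[OF linear_complexify] complexify_Jvec)
    then have "half_component c (complex_extension nab u X V) $ \<alpha> = ?d \<alpha> (fst X ?b) + \<i> * ?d \<alpha> (snd X ?b)
        + (\<Sum>\<beta>\<in>UNIV. half_component c (V u) $ \<beta> * (\<Sum>\<mu>\<in>UNIV. complexify (C (Inl \<beta>) (Inl \<mu>)) $ \<alpha> * dz_form \<mu> (ccomp X ?b)))"
      by (simp add: real[OF XT(1)] real[OF XT(2)] dz algebra_simps sum.distrib sum_distrib_left)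
    also have "\<dots> = half_component c (D u X V) $ \<alpha>"
      unfolding D_section_half_component[OF D c U Vsec smC uU X] omega_form_eq[OF wS] C_def ..
    finally show "half_component c (complex_extension nab u X V) $ \<alpha> = half_component c (D u X V) $ \<alpha>" .
  qed
  then show "complex_extension nab u X V = D u X V"
    by (rule V10_eqI[OF c ub ext_V10 D_V10])
qed

end

theorem theorem1p3:
  fixes M :: "'a topology"
    and A :: "('a, complex^'n) chart set"
    and F :: "('a, 'n) tpoint \<Rightarrow> real"
    and nab :: "('a, 'n) tpoint \<Rightarrow> ('a, 'n) rtan \<Rightarrow> (('a, 'n) tpoint \<Rightarrow> ('a, 'n) rtan) \<Rightarrow> ('a, 'n) rtan"
    and D :: "('a, 'n) tpoint \<Rightarrow> ('a, 'n) ctan \<Rightarrow> (('a, 'n) tpoint \<Rightarrow> ('a, 'n) ctan) \<Rightarrow> ('a, 'n) ctan"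
  assumes "CARD('n) \<ge> 2"
    and "complex_manifold M A"
    and "strongly_convex_complex_Finsler A F"
    and "Cartan_connection A F nab"
    and "Chern_Finsler_connection A F D"
  shows "nabla_J_zero A nab \<longleftrightarrow> coincide A nab D"
proof -
  interpret complex_atlas A by (rule complex_manifold_complex_atlas[OF assms(2)])
  have "linear_connection (slit_atlas A) (VR A) nab"
    using assms(4) unfolding Cartan_connection_def by blast
  moreover have "complex_linear_connection (slit_atlas A) (V10 A) D"
    using assms(5) unfolding Chern_Finsler_connection_def by blast
  ultimately show ?thesis
    using coincide_imp_nabla_J_zero nabla_J_zero_imp_coincide[OF assms(3-5)] by blast
qed

end
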